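(* Let $X$ be a locally finite CAT(0) cube complex with a cocompact cellular action of a group $G$, and suppose $X$ is an $n$-dimensional Eulerian manifold. Then for all vertices $x,y$ of $X$, the rational functions $c_{xy}$ and $G_{xy}$ defined in the context satisfy reciprocity: $$c_{xy}(t^{-1})=(-1)^n c_{xy}(t),\qquad G_{xy}(t^{-1})=(-1)^nG_{xy}(t).$$
   Context: $d(x,y)$ denotes the $\ell_1$-distance between vertices of $X$ (the edge-path distance in the 1-skeleton). Locally finite means each vertex lies in finitely many cubes; cocompact means $X/G$ is compact. Orbit growth series: for vertices $x,y$ of $X$, $G_{xy}=\sum_{z\in Gy}t^{d(x,z)}\in\mathbb{Z}[[t]]$. It is known that this power series is the expansion at $t=0$ of a rational function of $t$, also denoted $G_{xy}(t)$; $G_{xy}(t^{-1})$ is obtained by substituting $t^{-1}$ in this rational function. The $f$-polynomial of a finite simplicial complex $L$ is $f_L(t)=\sum_{\sigma\in L}t^{\dim\sigma+1}$, where $L$ includes the empty simplex of dimension $-1$. For vertices $x,y$ of $X$ contained in a common cube, $\Box_{xy}$ is the minimal cube containing both, and $f_{xy}$ is the $f$-polynomial of the link of $\Box_{xy}$, i.e. $f_{xy}(s)=\sum_{Q\supseteq\Box_{xy}}s^{\dim Q-\dim\Box_{xy}}$, the sum being over cubes $Q$ of $X$. If $x,y$ are not in a common cube, $f_{xy}=0$. For vertices $x,y$ of $X$ put $$c_{xy}=\left(\frac{-t}{1-t^2}\right)^{d(x,y)}f_{xy}\left(\frac{t^2}{1-t^2}\right).$$ A finite simplicial complex $L$ is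 an Eulerian $m$-sphere if it is pure of dimension $m$ and for every simplex $\sigma\in L$ (including the empty one, whose link is $L$) the link of $\sigma$ has the same Euler characteristic as the sphere of dimension $m-\dim\sigma-1$ (with $S^{-1}=\emptyset$). The cube complex $X$ is an $n$-dimensional Eulerian manifold if the link of every vertex is an Eulerian $(n-1)$-sphere. *)

theory Defs
  imports
    "HOL-Analysis.Analysis"
    "HOL-Algebra.Group_Action"
    "HOL-Computational_Algebra.Computational_Algebra"
begin

section \<open>Cube complexes\<close>

text \<open>
  A cube complex is encoded by the vertex sets of its (closed, nonempty) cubes. The vertices of
  the standard cube of dimension \<open>k\<close> are the subsets of \<open>{..<k}\<close>, and its nonempty faces are the
  intervals between two comparable subsets. A chart identifies a cube with a standard cube in such
  a way that the cubes of the complex inside it are exactly its faces.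
\<close>

definition cube_chart :: "'v set set \<Rightarrow> 'v set \<Rightarrow> nat \<Rightarrow> (nat set \<Rightarrow> 'v) \<Rightarrow> bool" where
  "cube_chart X Q k \<phi> \<longleftrightarrow>
     bij_betw \<phi> (Pow {..<k}) Q \<and>
     {F \<in> X. F \<subseteq> Q} = {\<phi> ` {A. S \<subseteq> A \<and> A \<subseteq> T} | S T. S \<subseteq> T \<and> T \<subseteq> {..<k}}"

definition cube_complex :: "'v set set \<Rightarrow> bool" where
  "cube_complex X \<longleftrightarrow>
     (\<forall>Q\<in>X. \<exists>k \<phi>. cube_chart X Q k \<phi>) \<and>
     (\<forall>P\<in>X. \<forall>Q\<in>X. P \<inter> Q \<noteq> {} \<longrightarrow> P \<inter> Q \<in> X)"

definition vertices :: "'v set set \<Rightarrow> 'v set" where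
  "vertices X = \<Union>X"

definition cube_dim :: "'v set \<Rightarrow> nat" where
  "cube_dim Q = (THE k. card Q = 2 ^ k)"

definition locally_finite_complex :: "'v set set \<Rightarrow> bool" where
  "locally_finite_complex X \<longleftrightarrow> (\<forall>v\<in>vertices X. finite {Q \<in> X. v \<in> Q})"

definition edges :: "'v set set \<Rightarrow> ('v \<times> 'v) set" where
  "edges X = {(u, v). u \<noteq> v \<and> {u, v} \<in> X}"

definition edge_dist :: "'v set set \<Rightarrow> 'v \<Rightarrow> 'v \<Rightarrow> nat" where
  "edge_dist X u v = (LEAST k. (u, v) \<in> edges X ^^ k)"

section \<open>The geometric realization and its piecewise Euclidean length metric\<close>

text \<open>
  The point with coordinates \<open>u\<close> of the solid cube \<open>[0,1]\<^sup>k\<close> is encoded by the weights of the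
  vertices in its multilinear expansion: the vertex \<open>\<phi> A\<close> gets the product of the \<open>u i\<close> for
  \<open>i \<in> A\<close> and of the \<open>1 - u i\<close> for \<open>i \<notin> A\<close>. This is injective in \<open>u\<close> (the coordinate \<open>u i\<close> is the
  total weight of the facet where the \<open>i\<close>-th coordinate equals 1), does not depend on the chart up
  to symmetries of the cube, and is compatible with passing to faces, so solid cubes get glued
  exactly along their common faces.
\<close>

definition cube_point :: "nat \<Rightarrow> (nat set \<Rightarrow> 'v) \<Rightarrow> (nat \<Rightarrow> real) \<Rightarrow> 'v \<Rightarrow> real" where
  "cube_point k \<phi> u = (\<lambda>v.
     if v \<in> \<phi> ` Pow {..<k}
     then \<Prod>i<k. if i \<in> inv_into (Pow {..<k}) \<phi> v then u i else 1 - u i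
     else 0)"

definition realization :: "'v set set \<Rightarrow> ('v \<Rightarrow> real) set" where
  "realization X = {cube_point k \<phi> u | Q k \<phi> u.
     Q \<in> X \<and> cube_chart X Q k \<phi> \<and> (\<forall>i<k. 0 \<le> u i \<and> u i \<le> 1)}"

text \<open>The points \<open>p\<close> and \<open>q\<close> lie in a common cube, and \<open>l\<close> is their Euclidean distance there.\<close>

definition cube_segment :: "'v set set \<Rightarrow> ('v \<Rightarrow> real) \<Rightarrow> ('v \<Rightarrow> real) \<Rightarrow> real \<Rightarrow> bool" where
  "cube_segment X p q l \<longleftrightarrow> (\<exists>Q\<in>X. \<exists>k \<phi> u w. cube_chart X Q k \<phi> \<and>
     (\<forall>i<k. 0 \<le> u i \<and> u i \<le> 1) \<and> (\<forall>i<k. 0 \<le> w i \<and> w i \<le> 1) \<and>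
     p = cube_point k \<phi> u \<and> q = cube_point k \<phi> w \<and>
     l = sqrt (\<Sum>i<k. (u i - w i)\<^sup>2))"

text \<open>Lengths of strings \<open>p = z\<^sub>0, \<dots>, z\<^sub>m = q\<close> with consecutive points in a common cube.\<close>

definition string_lengths :: "'v set set \<Rightarrow> ('v \<Rightarrow> real) \<Rightarrow> ('v \<Rightarrow> real) \<Rightarrow> real set" where
  "string_lengths X p q = {\<Sum>i<m. l i | m z l.
     (\<forall>i\<le>m. z i \<in> realization X) \<and> z 0 = p \<and> z m = q \<and>
     (\<forall>i<m. cube_segment X (z i) (z (Suc i)) (l i))}"

text \<open>
  The value 0 in the absence of a string makes this violate the axioms of a metric on the
  realization of a disconnected complex.
\<close>

definition length_dist :: "'v set set \<Rightarrow> ('v \<Rightarrow> real) \<Rightarrow> ('v \<Rightarrow> real) \<Rightarrow> real" where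
  "length_dist X p q =
     (if string_lengths X p q = {} then 0 else Inf (string_lengths X p q))"

section \<open>CAT(0) spaces\<close>

definition geodesic_from_to ::
  "'a set \<Rightarrow> ('a \<Rightarrow> 'a \<Rightarrow> real) \<Rightarrow> (real \<Rightarrow> 'a) \<Rightarrow> 'a \<Rightarrow> 'a \<Rightarrow> bool" where
  "geodesic_from_to M d \<gamma> x y \<longleftrightarrow>
     \<gamma> 0 = x \<and> \<gamma> (d x y) = y \<and> \<gamma> ` {0..d x y} \<subseteq> M \<and>
     (\<forall>s\<in>{0..d x y}. \<forall>t\<in>{0..d x y}. d (\<gamma> s) (\<gamma> t) = \<bar>s - t\<bar>)"

text \<open>
  In the comparison inequality it suffices to treat two distinct sides of a geodesic triangle;
  they are labelled so that \<open>x\<close> is their common vertex. The points \<open>P\<close> and \<open>Q\<close> of the Euclidean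
  comparison triangle \<open>x' y' z'\<close> are the comparison points of \<open>\<gamma> s\<close> and \<open>\<delta> t\<close>.
\<close>

definition cat0_space :: "'a set \<Rightarrow> ('a \<Rightarrow> 'a \<Rightarrow> real) \<Rightarrow> bool" where
  "cat0_space M d \<longleftrightarrow>
     Metric_space M d \<and>
     (\<forall>x\<in>M. \<forall>y\<in>M. \<exists>\<gamma>. geodesic_from_to M d \<gamma> x y) \<and>
     (\<forall>x\<in>M. \<forall>y\<in>M. \<forall>z\<in>M. \<forall>\<gamma> \<delta>.
        geodesic_from_to M d \<gamma> x y \<longrightarrow> geodesic_from_to M d \<delta> x z \<longrightarrow>
        (\<forall>x' y' z' :: real^2.
           dist x' y' = d x y \<longrightarrow> dist x' z' = d x z \<longrightarrow> dist y' z' = d y z \<longrightarrow>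
           (\<forall>s\<in>{0..d x y}. \<forall>t\<in>{0..d x z}.
            \<forall>P\<in>closed_segment x' y'. \<forall>Q\<in>closed_segment x' z'.
              dist x' P = s \<longrightarrow> dist x' Q = t \<longrightarrow> d (\<gamma> s) (\<delta> t) \<le> dist P Q)))"

definition cat0_cube_complex :: "'v set set \<Rightarrow> bool" where
  "cat0_cube_complex X \<longleftrightarrow> cube_complex X \<and> cat0_space (realization X) (length_dist X)"

section \<open>Cellular actions\<close>

definition cellular_action ::
  "('g, 'b) monoid_scheme \<Rightarrow> 'v set set \<Rightarrow> ('g \<Rightarrow> 'v \<Rightarrow> 'v) \<Rightarrow> bool" where
  "cellular_action G X \<rho> \<longleftrightarrow>
     group_action G (vertices X) \<rho> \<and> (\<forall>g\<in>carrier G. \<forall>Q\<in>X. \<rho> g ` Q \<in> X)"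

text \<open>The induced action on the realization, affine on each cube: weights are pushed forward.\<close>

definition realization_action ::
  "'v set set \<Rightarrow> ('g \<Rightarrow> 'v \<Rightarrow> 'v) \<Rightarrow> 'g \<Rightarrow> ('v \<Rightarrow> real) \<Rightarrow> 'v \<Rightarrow> real" where
  "realization_action X \<rho> g p = (\<lambda>v.
     if v \<in> vertices X then p (inv_into (vertices X) (\<rho> g) v) else 0)"

text \<open>The space \<open>Y\<close> below is the set of orbits in the realization with the quotient topology.\<close>

definition cocompact_action ::
  "('g, 'b) monoid_scheme \<Rightarrow> 'v set set \<Rightarrow> ('g \<Rightarrow> 'v \<Rightarrow> 'v) \<Rightarrow> bool" where
  "cocompact_action G X \<rho> \<longleftrightarrow>
     (\<exists>Y. quotient_map (Metric_space.mtopology (realization X) (length_dist X)) Y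
            (orbit G (realization_action X \<rho>)) \<and>
          compact_space Y)"

section \<open>Simplicial complexes, links and Eulerian manifolds\<close>

definition finite_simplicial_complex :: "'a set set \<Rightarrow> bool" where
  "finite_simplicial_complex L \<longleftrightarrow>
     finite L \<and> (\<forall>\<sigma>\<in>L. finite \<sigma>) \<and> {} \<in> L \<and> (\<forall>\<sigma>\<in>L. \<forall>\<tau>. \<tau> \<subseteq> \<sigma> \<longrightarrow> \<tau> \<in> L)"

definition simplex_dim :: "'a set \<Rightarrow> int" where
  "simplex_dim \<sigma> = int (card \<sigma>) - 1"

definition pure_of_dim :: "int \<Rightarrow> 'a set set \<Rightarrow> bool" where
  "pure_of_dim m L \<longleftrightarrow>
     (\<forall>\<sigma>\<in>L. (\<forall>\<tau>\<in>L. \<sigma> \<subseteq> \<tau> \<longrightarrow> \<tau> = \<sigma>) \<longrightarrow> simplex_dim \<sigma> = m)"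

definition simplex_link :: "'a set set \<Rightarrow> 'a set \<Rightarrow> 'a set set" where
  "simplex_link L \<sigma> = {\<tau> \<in> L. \<tau> \<inter> \<sigma> = {} \<and> \<tau> \<union> \<sigma> \<in> L}"

definition euler_char :: "'a set set \<Rightarrow> int" where
  "euler_char L = (\<Sum>\<sigma>\<in>L - {{}}. (-1) ^ nat (simplex_dim \<sigma>))"

definition sphere_euler_char :: "int \<Rightarrow> int" where
  "sphere_euler_char k = (if k < 0 then 0 else 1 + (-1) ^ nat k)"

definition eulerian_sphere :: "int \<Rightarrow> 'a set set \<Rightarrow> bool" where
  "eulerian_sphere m L \<longleftrightarrow>
     finite_simplicial_complex L \<and> pure_of_dim m L \<and>
     (\<forall>\<sigma>\<in>L. euler_char (simplex_link L \<sigma>) = sphere_euler_char (m - simplex_dim \<sigma> - 1))"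

text \<open>
  The vertices of the link of a cube \<open>P\<close> are the cubes containing \<open>P\<close> as a facet; each cube
  \<open>Q \<supseteq> P\<close> contributes the simplex of dimension \<open>dim Q - dim P - 1\<close> spanned by those of them that
  lie in \<open>Q\<close> (the empty simplex for \<open>Q = P\<close>).
\<close>

definition cube_link :: "'v set set \<Rightarrow> 'v set \<Rightarrow> 'v set set set" where
  "cube_link X P =
     (\<lambda>Q. {R \<in> X. P \<subseteq> R \<and> R \<subseteq> Q \<and> cube_dim R = Suc (cube_dim P)}) ` {Q \<in> X. P \<subseteq> Q}"

definition eulerian_manifold :: "nat \<Rightarrow> 'v set set \<Rightarrow> bool" where
  "eulerian_manifold n X \<longleftrightarrow>
     (\<forall>v\<in>vertices X. eulerian_sphere (int n - 1) (cube_link X {v}))"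

section \<open>Rational functions\<close>

text \<open>The field of rational functions is the fraction field of \<open>\<int>[t]\<close>.\<close>

type_synonym ratfun = "int poly fract"

definition tvar :: ratfun where
  "tvar = Fract [:0, 1:] 1"

definition ratfun_subst :: "ratfun \<Rightarrow> ratfun \<Rightarrow> ratfun" where
  "ratfun_subst R a = (case quot_of_fract R of (p, q) \<Rightarrow>
     poly (map_poly of_int p) a / poly (map_poly of_int q) a)"

definition has_expansion_at_0 :: "ratfun \<Rightarrow> int fps \<Rightarrow> bool" where
  "has_expansion_at_0 R F \<longleftrightarrow> (\<exists>p q. poly q 0 \<noteq> 0 \<and> R = Fract p q \<and>
     fps_of_poly q * F = fps_of_poly p)"

section \<open>Orbit growth series and the coefficients \<open>c\<close>\<close>

definition orbit_series ::
  "('g, 'b) monoid_scheme \<Rightarrow> 'v set set \<Rightarrow> ('g \<Rightarrow> 'v \<Rightarrow> 'v) \<Rightarrow> 'v \<Rightarrow> 'v \<Rightarrow> int fps" where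
  "orbit_series G X \<rho> x y =
     Abs_fps (\<lambda>k. int (card {z \<in> orbit G \<rho> y. edge_dist X x z = k}))"

definition orbit_growth ::
  "('g, 'b) monoid_scheme \<Rightarrow> 'v set set \<Rightarrow> ('g \<Rightarrow> 'v \<Rightarrow> 'v) \<Rightarrow> 'v \<Rightarrow> 'v \<Rightarrow> ratfun" where
  "orbit_growth G X \<rho> x y = (THE R. has_expansion_at_0 R (orbit_series G X \<rho> x y))"

definition f_polynomial :: "'a set set \<Rightarrow> 'r::comm_ring_1 poly" where
  "f_polynomial L = (\<Sum>\<sigma>\<in>L. monom 1 (card \<sigma>))"

definition minimal_cube :: "'v set set \<Rightarrow> 'v \<Rightarrow> 'v \<Rightarrow> 'v set" where
  "minimal_cube X x y = \<Inter>{Q \<in> X. x \<in> Q \<and> y \<in> Q}"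

definition f_pair :: "'v set set \<Rightarrow> 'v \<Rightarrow> 'v \<Rightarrow> 'r::comm_ring_1 poly" where
  "f_pair X x y =
     (if \<exists>Q\<in>X. x \<in> Q \<and> y \<in> Q then f_polynomial (cube_link X (minimal_cube X x y)) else 0)"

definition c_coeff :: "'v set set \<Rightarrow> 'v \<Rightarrow> 'v \<Rightarrow> ratfun" where
  "c_coeff X x y =
     (- tvar / (1 - tvar\<^sup>2)) ^ edge_dist X x y * poly (f_pair X x y) (tvar\<^sup>2 / (1 - tvar\<^sup>2))"

end

theory Submission
  imports Defs "Jordan_Normal_Form.Determinant"
begin

text \<open>
  Fix a vertex \<open>y\<close> and follow CAT(0) geodesics towards it. Along a geodesic the coordinate of a cube
  in a given direction is affine as long as it stays in \<open>(0,1)\<close>, and it must leave \<open>(0,1)\<close> before the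
  geodesic ends, since no direction survives at the vertex \<open>y\<close>. So at every point each direction has
  a nonzero slope towards \<open>y\<close>, whose sign is locally constant. This orients the edges towards \<open>y\<close>:
  parallel edges of a cube are oriented alike, and all edges leaving a vertex \<open>x\<close> lie in one cube, the
  one that the geodesic from \<open>x\<close> to \<open>y\<close> enters. It follows that the orientation computes the
  \<open>\<ell>\<^sub>1\<close>-distance to \<open>y\<close>, that every cube has a gate for \<open>y\<close>, and that
  \<open>\<Sum>z. c x z * t ^ d z y\<close> is 1 for \<open>x = y\<close> and 0 otherwise. Summing over orbits, of which there
  are finitely many by cocompactness, the matrix of growth series is inverse to the matrix of the sums
  of \<open>c x z\<close> with \<open>z\<close> in an orbit. The reciprocity of \<open>c\<close> is the Dehn--Sommerville relation for the
  links of cubes, and the inverse matrix inherits it.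
\<close>

section \<open>Charts and faces\<close>

text \<open>Coordinates are affine for this reason: around a point whose carrier contains an edge,
  short strings stay in cubes containing that edge, where the metric is a product of an interval
  with a cross-section, and geodesics of a product have constant speed in each factor. The obstacle
  is that the metric is only an infimum over strings, so almost shortest strings are straightened
  with an error that tends to 0. The comparison inequality enters through one consequence: geodesics
  to \<open>y\<close> from nearby points stay close together, which makes the sign of a slope
  locally constant. The kernel inverts the power of \<open>t\<close> because its sum over the
  vertices of a cube factors over the directions of the cube: a direction pointing to
  \<open>y\<close> contributes -1, any other one 0. At \<open>t = 0\<close> the matrix of orbit sums
  of the kernel is the identity, so its determinant has constant term 1 and the growth series are
  rational. Substituting 1/t is a field homomorphism, since 1/t is no root of a nonzero integer
  polynomial; hence a matrix multiplied by a sign under it has an inverse multiplied by the same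
  sign.\<close>

abbreviation symdiff :: "'a set \<Rightarrow> 'a set \<Rightarrow> 'a set" where
  "symdiff A B \<equiv> (A - B) \<union> (B - A)"

lemma cube_chart_bij: "cube_chart X Q k \<phi> \<Longrightarrow> bij_betw \<phi> (Pow {..<k}) Q"
  by (simp add: cube_chart_def)

lemma cube_chart_inj: "cube_chart X Q k \<phi> \<Longrightarrow> inj_on \<phi> (Pow {..<k})"
  by (simp add: cube_chart_def bij_betw_def)

lemma cube_chart_image: "cube_chart X Q k \<phi> \<Longrightarrow> \<phi> ` Pow {..<k} = Q"
  by (simp add: cube_chart_def bij_betw_def)

lemma cube_chart_finite: "cube_chart X Q k \<phi> \<Longrightarrow> finite Q"
  using cube_chart_image by (metis finite_Pow_iff finite_imageI finite_lessThan)

lemma cube_chart_card: "cube_chart X Q k \<phi> \<Longrightarrow> card Q = 2 ^ k"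
  by (metis bij_betw_same_card card_Pow card_lessThan cube_chart_bij finite_lessThan)

lemma cube_dim_eqI: "card Q = 2 ^ k \<Longrightarrow> cube_dim Q = k"
  unfolding cube_dim_def by (rule the_equality) auto

lemma cube_chart_dim: "cube_chart X Q k \<phi> \<Longrightarrow> cube_dim Q = k"
  by (rule cube_dim_eqI[OF cube_chart_card])

lemma cube_chart_faceI:
  assumes "cube_chart X Q k \<phi>" "S \<subseteq> T" "T \<subseteq> {..<k}"
  shows "\<phi> ` {A. S \<subseteq> A \<and> A \<subseteq> T} \<in> X"
  using assms unfolding cube_chart_def by blast

lemma cube_chart_faceE:
  assumes "cube_chart X Q k \<phi>" "F \<in> X" "F \<subseteq> Q"
  obtains S T where "S \<subseteq> T" "T \<subseteq> {..<k}" "F = \<phi> ` {A. S \<subseteq> A \<and> A \<subseteq> T}"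
proof -
  have "F \<in> {F \<in> X. F \<subseteq> Q}" using assms by simp
  also have "\<dots> = {\<phi> ` {A. S \<subseteq> A \<and> A \<subseteq> T} | S T. S \<subseteq> T \<and> T \<subseteq> {..<k}}"
    using assms(1) unfolding cube_chart_def by (rule conjunct2)
  finally show thesis using that by auto
qed

lemma cube_chart_in:
  assumes "cube_chart X Q k \<phi>" shows "Q \<in> X"
proof -
  have "{A. {} \<subseteq> A \<and> A \<subseteq> {..<k}} = Pow {..<k}" by auto
  then show ?thesis
    using cube_chart_faceI[OF assms, of "{}" "{..<k}"] cube_chart_image[OF assms] by simp
qed

lemma cube_chart_vertexI: "cube_chart X Q k \<phi> \<Longrightarrow> A \<subseteq> {..<k} \<Longrightarrow> \<phi> A \<in> Q"
  using cube_chart_image by fastforce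

text \<open>Reflecting the coordinates in \<open>B\<close> keeps the free directions
  \<open>T - S\<close> of a face free and toggles its fixed coordinates, so the image is again an
  interval.\<close>

lemma symdiff_interval:
  assumes ST: "S \<subseteq> T"
  shows "(\<lambda>A. symdiff A B) ` {A. S \<subseteq> A \<and> A \<subseteq> T} =
    {A. symdiff S B - (T - S) \<subseteq> A \<and> A \<subseteq> symdiff S B \<union> (T - S)}" (is "?f ` ?I = ?J")
proof -
  have inv: "?f (?f A) = A" for A by blast
  have "?f ` ?I \<subseteq> ?J" using ST by blast
  moreover have "?f A \<in> ?I" if "A \<in> ?J" for A
    using that ST by blast
  ultimately show ?thesis
    by (metis (no_types, lifting) inv image_eqI subsetI subset_antisym)
qed

text \<open>Makes any vertex of a cube the origin of a chart. The faces through that vertex are then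
  the images of power sets \<open>Pow J\<close> and its edges correspond to singletons, which is how
  most local computations are set up.\<close>

lemma cube_chart_rebase:
  assumes c: "cube_chart X Q k \<phi>" and B: "B \<subseteq> {..<k}"
  shows "cube_chart X Q k (\<lambda>A. \<phi> (symdiff A B))"
proof -
  let ?f = "\<lambda>A. symdiff A B"
  have inv: "?f (?f A) = A" for A by blast
  have Pow: "?f ` Pow {..<k} \<subseteq> Pow {..<k}" using B by blast
  have bij: "bij_betw ?f (Pow {..<k}) (Pow {..<k})"
    by (rule bij_betw_byWitness[where f'="?f"]) (use Pow in blast)+
  have "bij_betw (\<phi> \<circ> ?f) (Pow {..<k}) Q"
    by (rule bij_betw_trans[OF bij cube_chart_bij[OF c]])
  then have 1: "bij_betw (\<lambda>A. \<phi> (?f A)) (Pow {..<k}) Q"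
    by (simp add: o_def)
  have im: "(\<lambda>A. \<phi> (?f A)) ` {A. S \<subseteq> A \<and> A \<subseteq> T} =
     \<phi> ` {A. ?f S - (T - S) \<subseteq> A \<and> A \<subseteq> ?f S \<union> (T - S)}" if "S \<subseteq> T" for S T
    unfolding symdiff_interval[OF that, of B, symmetric] by (simp add: image_image)
  have "{F \<in> X. F \<subseteq> Q} = {(\<lambda>A. \<phi> (?f A)) ` {A. S \<subseteq> A \<and> A \<subseteq> T} | S T. S \<subseteq> T \<and> T \<subseteq> {..<k}}"
    (is "?L = ?R")
  proof (rule subset_antisym)
    show "?R \<subseteq> ?L"
    proof
      fix F assume "F \<in> ?R"
      then obtain S T where ST: "S \<subseteq> T" "T \<subseteq> {..<k}"
        and F: "F = (\<lambda>A. \<phi> (?f A)) ` {A. S \<subseteq> A \<and> A \<subseteq> T}" by blast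
      have "F \<in> X" unfolding F im[OF ST(1)]
        by (rule cube_chart_faceI[OF c]) (use ST B in auto)
      moreover have "symdiff S B \<union> (T - S) \<subseteq> {..<k}" using ST B by blast
      then have "F \<subseteq> \<phi> ` Pow {..<k}" unfolding F im[OF ST(1)]
        by (intro image_mono) blast
      then have "F \<subseteq> Q" unfolding cube_chart_image[OF c] .
      ultimately show "F \<in> ?L" by simp
    qed
    show "?L \<subseteq> ?R"
    proof
      fix F assume "F \<in> ?L"
      then have "F \<in> X" "F \<subseteq> Q" by auto
      then obtain S T where ST: "S \<subseteq> T" "T \<subseteq> {..<k}" and F: "F = \<phi> ` {A. S \<subseteq> A \<and> A \<subseteq> T}"
        by (rule cube_chart_faceE[OF c])
      define S' T' where "S' = ?f S - (T - S)" and "T' = ?f S \<union> (T - S)"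
      have 2: "S' \<subseteq> T'" "T' \<subseteq> {..<k}" using ST B by (auto simp: S'_def T'_def)
      have "?f ` {A. S \<subseteq> A \<and> A \<subseteq> T} = {A. S' \<subseteq> A \<and> A \<subseteq> T'}"
        unfolding S'_def T'_def by (rule symdiff_interval[OF ST(1)])
      then have "(\<lambda>A. \<phi> (?f A)) ` {A. S' \<subseteq> A \<and> A \<subseteq> T'} = (\<lambda>A. \<phi> (?f A)) ` ?f ` {A. S \<subseteq> A \<and> A \<subseteq> T}"
        by simp
      also have "\<dots> = F" unfolding F image_image inv ..
      finally have "F = (\<lambda>A. \<phi> (?f A)) ` {A. S' \<subseteq> A \<and> A \<subseteq> T'}" ..
      with 2 show "F \<in> ?R" unfolding mem_Collect_eq by (intro exI[of _ S'] exI[of _ T'] conjI)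
    qed
  qed
  with 1 show ?thesis unfolding cube_chart_def by (rule conjI)
qed

lemma pow_interval: "{A. {} \<subseteq> A \<and> A \<subseteq> J} = Pow J" by auto

section \<open>Faces and edges at the base vertex of a chart\<close>

context
  fixes X :: "'v set set"
  assumes cc: "cube_complex X"
begin

lemma chart_exists: "Q \<in> X \<Longrightarrow> \<exists>k \<phi>. cube_chart X Q k \<phi>"
  using cc unfolding cube_complex_def by blast

lemma based_chart_exists:
  assumes "Q \<in> X" "x \<in> Q"
  obtains k \<phi> where "cube_chart X Q k \<phi>" "\<phi> {} = x"
proof -
  obtain k \<phi> where c: "cube_chart X Q k \<phi>" using chart_exists[OF assms(1)] by blast
  then obtain B where B: "B \<subseteq> {..<k}" "\<phi> B = x" using cube_chart_image[OF c] assms(2) by blast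
  have "cube_chart X Q k (\<lambda>A. \<phi> (symdiff A B))" by (rule cube_chart_rebase[OF c B(1)])
  moreover have "\<phi> (symdiff {} B) = x" using B by simp
  ultimately show thesis by (rule that)
qed

lemma cube_inter: "P \<in> X \<Longrightarrow> Q \<in> X \<Longrightarrow> z \<in> P \<Longrightarrow> z \<in> Q \<Longrightarrow> P \<inter> Q \<in> X"
  using cc unfolding cube_complex_def by blast

lemma cube_finite: "Q \<in> X \<Longrightarrow> finite Q"
  using chart_exists cube_chart_finite by blast

lemma cube_nonempty: "Q \<in> X \<Longrightarrow> Q \<noteq> {}"
  using chart_exists cube_chart_image by blast

lemma cube_vertex: "Q \<in> X \<Longrightarrow> x \<in> Q \<Longrightarrow> {x} \<in> X"
proof -
  assume "Q \<in> X" "x \<in> Q"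
  then obtain k \<phi> where c: "cube_chart X Q k \<phi>" "\<phi> {} = x" by (rule based_chart_exists)
  have "\<phi> ` {A. {} \<subseteq> A \<and> A \<subseteq> {}} \<in> X" by (rule cube_chart_faceI[OF c(1)]) auto
  then show "{x} \<in> X" using c(2) by simp
qed

lemma vertex_cube: "x \<in> vertices X \<Longrightarrow> {x} \<in> X"
  unfolding vertices_def using cube_vertex by blast

lemma pow_face:
  assumes "cube_chart X Q k \<phi>" "J \<subseteq> {..<k}"
  shows "\<phi> ` Pow J \<in> X" "cube_dim (\<phi> ` Pow J) = card J"
proof -
  show "\<phi> ` Pow J \<in> X"
    using cube_chart_faceI[OF assms(1) empty_subsetI assms(2)] by (simp only: pow_interval)
  have fin: "finite J" using assms(2) finite_subset by blast
  have "inj_on \<phi> (Pow J)"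
    using cube_chart_inj[OF assms(1)] by (rule inj_on_subset) (use assms(2) in auto)
  then have "card (\<phi> ` Pow J) = 2 ^ card J"
    using fin by (simp add: card_image card_Pow)
  then show "cube_dim (\<phi> ` Pow J) = card J" by (rule cube_dim_eqI)
qed

lemma face_at_base:
  assumes c: "cube_chart X Q k \<phi>" and F: "F \<in> X" "F \<subseteq> Q" "\<phi> {} \<in> F"
  obtains J where "J \<subseteq> {..<k}" "F = \<phi> ` Pow J" "cube_dim F = card J"
proof -
  obtain S T where ST: "S \<subseteq> T" "T \<subseteq> {..<k}" "F = \<phi> ` {A. S \<subseteq> A \<and> A \<subseteq> T}"
    by (rule cube_chart_faceE[OF c F(1,2)])
  then obtain A where A: "S \<subseteq> A" "A \<subseteq> T" "\<phi> {} = \<phi> A" using F(3) by blast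
  then have "A = {}"
    using inj_onD[OF cube_chart_inj[OF c], of "{}" A] ST by auto
  then have "S = {}" using A by blast
  then have "F = \<phi> ` Pow T" using ST(3) by (simp only: pow_interval)
  with pow_face(2)[OF c ST(2)] show thesis by (intro that[OF ST(2)]) simp_all
qed

lemma mem_pow_face:
  assumes c: "cube_chart X Q k \<phi>" and "J \<subseteq> {..<k}" "A \<subseteq> {..<k}"
  shows "\<phi> A \<in> \<phi> ` Pow J \<longleftrightarrow> A \<subseteq> J"
  using inj_on_image_mem_iff[OF cube_chart_inj[OF c], of A "Pow J"] assms by auto

lemma pow_face_subset:
  assumes c: "cube_chart X Q k \<phi>" and "J \<subseteq> {..<k}" "J' \<subseteq> {..<k}"
  shows "\<phi> ` Pow J \<subseteq> \<phi> ` Pow J' \<longleftrightarrow> J \<subseteq> J'"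
proof
  assume "\<phi> ` Pow J \<subseteq> \<phi> ` Pow J'"
  then have "\<phi> J \<in> \<phi> ` Pow J'" by blast
  then show "J \<subseteq> J'" using mem_pow_face[OF c assms(3,2)] by simp
qed blast

lemma chart_vertex_in_X:
  assumes c: "cube_chart X Q k \<phi>" "A \<subseteq> {..<k}" shows "\<phi> A \<in> vertices X"
  unfolding vertices_def using cube_chart_vertexI[OF c] cube_chart_in[OF c(1)] by blast

lemma chart_inj:
  assumes c: "cube_chart X Q k \<phi>" and "A \<subseteq> {..<k}" "B \<subseteq> {..<k}"
  shows "\<phi> A = \<phi> B \<longleftrightarrow> A = B"
  using inj_on_eq_iff[OF cube_chart_inj[OF c], of A B] assms by auto

text \<open>The intersection axiom at work: \<open>P \<inter> Q\<close> is a face of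
  \<open>Q\<close> through the base vertex, hence spanned by some \<open>J\<close>, and
  \<open>\<phi> A \<in> P\<close> forces \<open>A \<subseteq> J\<close>. So the directions in
  \<open>A\<close> span the smallest cube containing both vertices.\<close>

lemma cube_contains_pow:
  assumes c: "cube_chart X Q k \<phi>" and A: "A \<subseteq> {..<k}" and P: "P \<in> X" "\<phi> {} \<in> P" "\<phi> A \<in> P"
  shows "\<phi> ` Pow A \<subseteq> P"
proof -
  have Q: "Q \<in> X" using cube_chart_in[OF c] .
  have 0: "\<phi> {} \<in> Q" using cube_chart_vertexI[OF c, of "{}"] by auto
  have "P \<inter> Q \<in> X" using cube_inter[OF P(1) Q P(2) 0] .
  moreover have "\<phi> {} \<in> P \<inter> Q" using P 0 by simp
  ultimately obtain J where J: "J \<subseteq> {..<k}" "P \<inter> Q = \<phi> ` Pow J"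
    using face_at_base[OF c _ Int_lower2] by metis
  have "\<phi> A \<in> \<phi> ` Pow J" using J P cube_chart_vertexI[OF c A] by auto
  then have "A \<subseteq> J" using mem_pow_face[OF c J(1) A] by simp
  then show ?thesis using J by blast
qed

lemma edge_at_base:
  assumes c: "cube_chart X Q k \<phi>" and v: "v \<in> Q" "{\<phi> {}, v} \<in> X" "v \<noteq> \<phi> {}"
  obtains j where "j < k" "v = \<phi> {j}"
proof -
  have 0: "\<phi> {} \<in> Q" using cube_chart_vertexI[OF c, of "{}"] by auto
  have sub: "{\<phi> {}, v} \<subseteq> Q" using v 0 by simp
  obtain J where J: "J \<subseteq> {..<k}" "{\<phi> {}, v} = \<phi> ` Pow J"
    by (rule face_at_base[OF c v(2) sub insertI1])
  have "v \<in> \<phi> ` Pow J" unfolding J(2)[symmetric] by simp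
  then obtain A where A: "A \<subseteq> J" "v = \<phi> A" by blast
  then have "A \<noteq> {}" using v(3) by auto
  \<comment> \<open>Any \<open>j\<close> in \<open>A\<close> gives a vertex of the edge other than
    the base, which must then be \<open>v\<close>.\<close>
  then obtain j where j: "j \<in> A" by blast
  have "\<phi> {j} \<in> \<phi> ` Pow J" using j A by auto
  then have "\<phi> {j} = \<phi> {} \<or> \<phi> {j} = v" using J(2) by auto
  moreover have jk: "j < k" using j A J by blast
  moreover have "\<phi> {j} \<noteq> \<phi> {}" using chart_inj[OF c, of "{j}" "{}"] jk by simp
  ultimately show thesis using that[OF jk] by simp
qed

lemma chart_edge:
  assumes c: "cube_chart X Q k \<phi>" and A: "A \<subseteq> {..<k}" and j: "j < k" "j \<notin> A"
  shows "{\<phi> A, \<phi> (insert j A)} \<in> X" "\<phi> A \<noteq> \<phi> (insert j A)"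
proof -
  have jA: "A \<subseteq> insert j A" "insert j A \<subseteq> {..<k}" using A j by auto
  have "{B. A \<subseteq> B \<and> B \<subseteq> insert j A} = {A, insert j A}" by blast
  then have "\<phi> ` {B. A \<subseteq> B \<and> B \<subseteq> insert j A} = {\<phi> A, \<phi> (insert j A)}" by simp
  then show "{\<phi> A, \<phi> (insert j A)} \<in> X"
    using cube_chart_faceI[OF c jA] by simp
  have "A \<noteq> insert j A" using j(2) by blast
  then show "\<phi> A \<noteq> \<phi> (insert j A)" using chart_inj[OF c A jA(2)] by simp
qed

end

section \<open>Distances from a consistent orientation of the edges\<close>

lemma edges_sym: "(u, v) \<in> edges X \<Longrightarrow> (v, u) \<in> edges X"
  unfolding edges_def by (auto simp: insert_commute)

lemma edges_relpow_sym: "(u, v) \<in> edges X ^^ k \<longleftrightarrow> (v, u) \<in> edges X ^^ k"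
proof -
  have *: "(v, u) \<in> edges X ^^ k" if "(u, v) \<in> edges X ^^ k" for u v
    using that
  proof (induction k arbitrary: v)
    case (Suc k)
    then obtain w where "(u, w) \<in> edges X ^^ k" "(w, v) \<in> edges X" by auto
    then have "(w, u) \<in> edges X ^^ k" "(v, w) \<in> edges X" using Suc.IH edges_sym by fast+
    then show ?case by (rule relpow_Suc_I2[rotated])
  qed simp
  show ?thesis using * by blast
qed

lemma edge_dist_sym: "edge_dist X u v = edge_dist X v u"
  unfolding edge_dist_def using edges_relpow_sym[of u v _ X] by simp

lemma edges_in_vertices: "(u, v) \<in> edges X \<Longrightarrow> u \<in> vertices X \<and> v \<in> vertices X"
  unfolding edges_def vertices_def by auto

text \<open>The interface between geometry and combinatorics: \<open>D y u v\<close> is to mean that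
  the edge from \<open>u\<close> to \<open>v\<close> points towards \<open>y\<close>. The geometric
  sections construct such a \<open>D\<close>; distances, gates and the inversion formula are derived
  from these axioms.\<close>

locale oriented_complex =
  fixes X :: "'v set set" and D :: "'v \<Rightarrow> 'v \<Rightarrow> 'v \<Rightarrow> bool"
  assumes cc: "cube_complex X"
    and conn: "\<lbrakk>x \<in> vertices X; y \<in> vertices X\<rbrakk> \<Longrightarrow> (x, y) \<in> (edges X)\<^sup>*"
    and D_flip: "\<lbrakk>y \<in> vertices X; (u, v) \<in> edges X\<rbrakk> \<Longrightarrow> D y v u \<longleftrightarrow> \<not> D y u v"
    and D_parallel: "\<lbrakk>y \<in> vertices X; cube_chart X Q k \<phi>; A \<subseteq> {..<k}; i < k; j < k; i \<noteq> j;
        i \<notin> A; j \<notin> A\<rbrakk> \<Longrightarrow>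
        D y (\<phi> A) (\<phi> (insert i A)) \<longleftrightarrow> D y (\<phi> (insert j A)) (\<phi> (insert i (insert j A)))"
    and D_cube: "\<lbrakk>y \<in> vertices X; x \<in> vertices X\<rbrakk> \<Longrightarrow>
        \<exists>Q\<in>X. x \<in> Q \<and> (\<forall>v. (x, v) \<in> edges X \<longrightarrow> D y x v \<longrightarrow> v \<in> Q)"
    and D_sink: "\<lbrakk>y \<in> vertices X; (y, v) \<in> edges X\<rbrakk> \<Longrightarrow> \<not> D y y v"
begin

section \<open>Directed paths towards a fixed vertex\<close>

definition arrows :: "'v \<Rightarrow> ('v \<times> 'v) set" where
  "arrows y = {(u, v). (u, v) \<in> edges X \<and> D y u v}"

lemma chart_arrow:
  assumes "cube_chart X Q k \<phi>" "A \<subseteq> {..<k}" "i < k" "i \<notin> A"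
  shows "(\<phi> A, \<phi> (insert i A)) \<in> edges X"
  using chart_edge[OF cc assms] by (simp add: edges_def)

text \<open>Two arrows leaving a vertex span a square, which makes the arrows locally confluent; hence all
  directed paths to \<open>y\<close> from a given vertex have the same length.\<close>

lemma arrow_diamond:
  assumes y: "y \<in> vertices X" and v: "(x, v) \<in> arrows y" and w: "(x, w) \<in> arrows y" and "v \<noteq> w"
  obtains z where "(v, z) \<in> arrows y" "(w, z) \<in> arrows y"
proof -
  have e: "(x, v) \<in> edges X" "(x, w) \<in> edges X" "D y x v" "D y x w"
    using v w by (auto simp: arrows_def)
  have x: "x \<in> vertices X" using edges_in_vertices[OF e(1)] by simp
  obtain Q where Q: "Q \<in> X" "x \<in> Q" "\<forall>v. (x, v) \<in> edges X \<longrightarrow> D y x v \<longrightarrow> v \<in> Q"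
    using D_cube[OF y x] by auto
  obtain k \<phi> where c: "cube_chart X Q k \<phi>" and x': "\<phi> {} = x"
    using based_chart_exists[OF cc Q(1,2)] .
  have "v \<in> Q" "{\<phi> {}, v} \<in> X" "v \<noteq> \<phi> {}" using e Q x' by (auto simp: edges_def)
  then obtain i where i: "i < k" "v = \<phi> {i}" by (rule edge_at_base[OF cc c])
  have "w \<in> Q" "{\<phi> {}, w} \<in> X" "w \<noteq> \<phi> {}" using e Q x' by (auto simp: edges_def)
  then obtain j where j: "j < k" "w = \<phi> {j}" by (rule edge_at_base[OF cc c])
  have ij: "i \<noteq> j" using i j \<open>v \<noteq> w\<close> by auto
  have 1: "D y (\<phi> {j}) (\<phi> (insert i {j}))"
    using D_parallel[OF y c empty_subsetI i(1) j(1) ij] e x' i by simp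
  have 2: "D y (\<phi> {i}) (\<phi> (insert j {i}))"
    using D_parallel[OF y c empty_subsetI j(1) i(1) ij[symmetric]] e x' j by simp
  have "(\<phi> {j}, \<phi> (insert i {j})) \<in> edges X" "(\<phi> {i}, \<phi> (insert j {i})) \<in> edges X"
    using chart_arrow[OF c, of "{j}" i] chart_arrow[OF c, of "{i}" j] i j ij by auto
  with 1 2 show thesis
    by (intro that[of "\<phi> {i, j}"]) (simp_all add: arrows_def i(2) j(2) insert_commute)
qed

text \<open>Squares are laid along the given path: the diamond on its first step and the arrow to
  \<open>v\<close> moves the problem one vertex closer to \<open>y\<close>, and the recursion ends
  because no arrow leaves \<open>y\<close>. Every arrow out of \<open>x\<close> thus starts a
  directed path to \<open>y\<close> of the same length.\<close>

lemma arrows_step: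
  assumes y: "y \<in> vertices X"
  shows "(x, y) \<in> arrows y ^^ k \<Longrightarrow> (x, v) \<in> arrows y \<Longrightarrow> \<exists>j. k = Suc j \<and> (v, y) \<in> arrows y ^^ j"
proof (induction k arbitrary: x v)
  case 0
  then show ?case using D_sink[OF y] by (auto simp: arrows_def)
next
  case (Suc k)
  obtain w where w: "(x, w) \<in> arrows y" "(w, y) \<in> arrows y ^^ k"
    using relpow_Suc_D2[OF Suc.prems(1)] by auto
  show ?case
  proof (cases "v = w")
    case True then show ?thesis using w by auto
  next
    case False
    obtain z where z: "(v, z) \<in> arrows y" "(w, z) \<in> arrows y"
      using arrow_diamond[OF y Suc.prems(2) w(1) False] .
    obtain j where j: "k = Suc j" "(z, y) \<in> arrows y ^^ j" using Suc.IH[OF w(2) z(2)] by auto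
    then have "(v, y) \<in> arrows y ^^ k" using relpow_Suc_I2[OF z(1) j(2)] by simp
    then show ?thesis by auto
  qed
qed

lemma arrows_unique:
  assumes y: "y \<in> vertices X"
  shows "(x, y) \<in> arrows y ^^ k \<Longrightarrow> (x, y) \<in> arrows y ^^ l \<Longrightarrow> k = l"
proof (induction k arbitrary: x l)
  case 0
  then have "x = y" by simp
  show ?case
  proof (cases l)
    case (Suc l')
    then obtain w where "(y, w) \<in> arrows y" using relpow_Suc_D2[of x y l'] 0(2) \<open>x = y\<close> by blast
    then show ?thesis using D_sink[OF y] by (auto simp: arrows_def)
  qed simp
next
  case (Suc k)
  obtain w where w: "(x, w) \<in> arrows y" "(w, y) \<in> arrows y ^^ k"
    using relpow_Suc_D2[OF Suc.prems(1)] by auto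
  obtain j where "l = Suc j" "(w, y) \<in> arrows y ^^ j"
    using arrows_step[OF y Suc.prems(2) w(1)] by auto
  then show ?case using Suc.IH[OF w(2)] by simp
qed

text \<open>Walk along an undirected path from \<open>y\<close> to \<open>x\<close>, keeping a
  directed path back to \<open>y\<close>: an edge followed along its arrow shortens that path by
  \<open>arrows_step\<close>, an edge followed against its arrow is prepended.\<close>

lemma arrows_exist:
  assumes y: "y \<in> vertices X" and x: "x \<in> vertices X"
  shows "\<exists>k. (x, y) \<in> arrows y ^^ k"
proof -
  have "(y, x) \<in> (edges X)\<^sup>*" by (rule conn[OF y x])
  then show ?thesis
  proof (induction rule: rtrancl_induct)
    case base
    show ?case by (rule exI[of _ 0]) simp
  next
    case (step u v)
    obtain k where k: "(u, y) \<in> arrows y ^^ k" using step.IH by auto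
    show ?case
    proof (cases "D y u v")
      case True
      then have "(u, v) \<in> arrows y" using step by (simp add: arrows_def)
      from arrows_step[OF y k this] show ?thesis by auto
    next
      case False
      then have "D y v u" using D_flip[OF y step(2)] by simp
      then have "(v, u) \<in> arrows y" using edges_sym[OF step(2)] by (simp add: arrows_def)
      then show ?thesis using relpow_Suc_I2[OF _ k] by blast
    qed
  qed
qed

text \<open>Along an edge path the length of the directed path to \<open>y\<close> changes by
  exactly one per edge, so no edge path to \<open>y\<close> can be shorter than the directed
  one.\<close>

lemma edge_dist_eqI:
  assumes y: "y \<in> vertices X" and k: "(x, y) \<in> arrows y ^^ k"
  shows "edge_dist X x y = k"
proof -
  have le: "\<exists>l\<le>m. (u, y) \<in> arrows y ^^ l" if "(u, y) \<in> edges X ^^ m" for u m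
    using that
  proof (induction m arbitrary: u)
    case 0
    then show ?case by (intro exI[of _ 0]) auto
  next
    case (Suc m)
    obtain w where w: "(u, w) \<in> edges X" "(w, y) \<in> edges X ^^ m"
      using relpow_Suc_D2[OF Suc.prems] by auto
    obtain l where l: "l \<le> m" "(w, y) \<in> arrows y ^^ l" using Suc.IH[OF w(2)] by auto
    show ?case
    proof (cases "D y u w")
      case True
      then have "(u, y) \<in> arrows y ^^ Suc l"
        using relpow_Suc_I2[OF _ l(2)] w by (auto simp: arrows_def)
      then show ?thesis using l by (intro exI[of _ "Suc l"]) simp
    next
      case False
      then have "(w, u) \<in> arrows y" using edges_sym[OF w(1)] D_flip[OF y w(1)] by (simp add: arrows_def)
      then obtain j where "l = Suc j" "(u, y) \<in> arrows y ^^ j" using arrows_step[OF y l(2)] by auto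
      then show ?thesis using l by (intro exI[of _ j]) simp
    qed
  qed
  have "arrows y \<subseteq> edges X" by (auto simp: arrows_def)
  then have "arrows y ^^ m \<subseteq> edges X ^^ m" for m by (induction m) auto
  then have "(x, y) \<in> edges X ^^ k" using k by blast
  then show ?thesis unfolding edge_dist_def
  proof (rule Least_equality)
    fix m assume "(x, y) \<in> edges X ^^ m"
    then obtain l where "l \<le> m" "(x, y) \<in> arrows y ^^ l" using le by blast
    then show "k \<le> m" using arrows_unique[OF y k] by simp
  qed
qed

lemma edge_dist_arrow:
  assumes y: "y \<in> vertices X" and e: "(u, v) \<in> edges X" "D y u v"
  shows "edge_dist X u y = Suc (edge_dist X v y)"
proof -
  obtain k where k: "(v, y) \<in> arrows y ^^ k"
    using arrows_exist[OF y] edges_in_vertices[OF e(1)] by blast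
  have "(u, y) \<in> arrows y ^^ Suc k"
    using relpow_Suc_I2[OF _ k] e by (auto simp: arrows_def)
  then show ?thesis using edge_dist_eqI[OF y] k by simp
qed

lemma arrow_leaves:
  assumes y: "y \<in> vertices X" and x: "x \<in> vertices X" "x \<noteq> y"
  shows "\<exists>v. (x, v) \<in> edges X \<and> D y x v"
proof -
  obtain k where k: "(x, y) \<in> arrows y ^^ k" using arrows_exist[OF y x(1)] by blast
  then obtain j where "k = Suc j" using x(2) by (cases k) auto
  then show ?thesis using k relpow_Suc_D2[of x y j] by (auto simp: arrows_def)
qed

lemma D_chart:
  assumes y: "y \<in> vertices X" and c: "cube_chart X Q k \<phi>" and i: "i < k"
  shows "A \<subseteq> {..<k} \<Longrightarrow> i \<notin> A \<Longrightarrow> D y (\<phi> A) (\<phi> (insert i A)) \<longleftrightarrow> D y (\<phi> {}) (\<phi> {i})"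
proof -
  assume A: "A \<subseteq> {..<k}" "i \<notin> A"
  have "finite A" using A(1) finite_subset by blast
  then show ?thesis using A
  proof (induction A rule: finite_induct)
    case (insert j A)
    then show ?case using D_parallel[OF y c, of A i j] i by auto
  qed simp
qed

text \<open>The gate of \<open>y\<close> in the cube is \<open>\<phi> J\<close>.\<close>

lemma edge_dist_gate:
  assumes y: "y \<in> vertices X" and c: "cube_chart X Q k \<phi>"
    and J: "J = {i. i < k \<and> D y (\<phi> {}) (\<phi> {i})}" and A: "A \<subseteq> {..<k}"
  shows "edge_dist X (\<phi> A) y + card (A \<inter> J) = edge_dist X (\<phi> {}) y + card (A - J)"
proof -
  have "finite A" using A(1) finite_subset by blast
  then show ?thesis using A
  proof (induction A rule: finite_induct)
    case (insert i A)
    then have A: "A \<subseteq> {..<k}" "i < k" "i \<notin> A" and fin: "finite A" by auto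
    note e = chart_arrow[OF c A]
    have D: "D y (\<phi> A) (\<phi> (insert i A)) \<longleftrightarrow> i \<in> J"
      using D_chart[OF y c A(2,1,3)] J A by simp
    show ?case
    proof (cases "i \<in> J")
      case True
      then have "edge_dist X (\<phi> A) y = Suc (edge_dist X (\<phi> (insert i A)) y)"
        using edge_dist_arrow[OF y e] D by simp
      moreover have "card (insert i A \<inter> J) = Suc (card (A \<inter> J))" "insert i A - J = A - J"
        using True A(3) fin by auto
      ultimately show ?thesis using insert.IH A(1) by simp
    next
      case False
      then have "D y (\<phi> (insert i A)) (\<phi> A)" using D_flip[OF y e] D by simp
      then have "edge_dist X (\<phi> (insert i A)) y = Suc (edge_dist X (\<phi> A) y)"
        using edge_dist_arrow[OF y edges_sym[OF e]] by simp
      moreover have "insert i A \<inter> J = A \<inter> J" using False by auto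
      moreover have "card (insert i A - J) = Suc (card (A - J))" using False A(3) fin
        by (simp add: insert_Diff_if)
      ultimately show ?thesis using insert.IH A(1) by simp
    qed
  qed simp
qed

text \<open>Take the corner \<open>\<phi> {}\<close> as the target. It is a sink, so the set
  \<open>J\<close> of the gate formula is empty and \<open>card A\<close> remains.\<close>

lemma edge_dist_chart:
  assumes c: "cube_chart X Q k \<phi>" and A: "A \<subseteq> {..<k}"
  shows "edge_dist X (\<phi> {}) (\<phi> A) = card A"
proof -
  have x: "\<phi> {} \<in> vertices X" by (rule chart_vertex_in_X[OF cc c]) simp
  define J where "J = {i. i < k \<and> D (\<phi> {}) (\<phi> {}) (\<phi> {i})}"
  have "J = {}" using D_sink[OF x] chart_arrow[OF c empty_subsetI] by (auto simp: J_def)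
  moreover have "edge_dist X (\<phi> {}) (\<phi> {}) = 0" by (rule edge_dist_eqI[OF x]) simp
  ultimately show ?thesis
    using edge_dist_gate[OF x c J_def A] by (simp add: edge_dist_sym)
qed

end

section \<open>Weights of points of the realization\<close>

text \<open>Expansion of a product of binomials over the set \<open>A\<close> of factors
  contributing \<open>f\<close>. It serves both the weights of a point and, later, the sum of the
  kernel over a cube.\<close>

lemma sum_Pow_prod_if:
  fixes f g :: "'i \<Rightarrow> 'r::comm_semiring_1"
  assumes "finite I"
  shows "(\<Sum>A\<in>Pow I. \<Prod>i\<in>I. if i \<in> A then f i else g i) = (\<Prod>i\<in>I. f i + g i)"
proof -
  have "(\<Prod>i\<in>I. if i \<in> A then f i else g i) = prod f A * prod g (I - A)" if "A \<in> Pow I" for A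
  proof -
    have "I \<inter> {x. x \<in> A} = A" "I \<inter> - {x. x \<in> A} = I - A" using that by auto
    then show ?thesis using prod.If_cases[OF assms, of "\<lambda>x. x \<in> A" f g] by simp
  qed
  then show ?thesis using prod_add[OF assms, of f g] by simp
qed

definition unit_cube :: "nat \<Rightarrow> (nat \<Rightarrow> real) set" where
  "unit_cube k = {u. \<forall>i<k. 0 \<le> u i \<and> u i \<le> 1}"

lemma unit_cubeD: "u \<in> unit_cube k \<Longrightarrow> i < k \<Longrightarrow> 0 \<le> u i \<and> u i \<le> 1"
  by (simp add: unit_cube_def)

definition supp :: "('v \<Rightarrow> real) \<Rightarrow> 'v set" where
  "supp p = {v. p v \<noteq> 0}"

text \<open>Restricting to the support makes this a finite sum for points of the realization even
  when \<open>T\<close> is infinite; only the trace of \<open>T\<close> on the support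
  matters.\<close>

definition wt :: "'v set \<Rightarrow> ('v \<Rightarrow> real) \<Rightarrow> real" where
  "wt T p = (\<Sum>v\<in>T \<inter> supp p. p v)"

lemma wt_eq_sum:
  assumes "finite Q" "supp p \<subseteq> Q"
  shows "wt T p = (\<Sum>v\<in>T \<inter> Q. p v)"
  unfolding wt_def by (rule sum.mono_neutral_left) (use assms in \<open>auto simp: supp_def\<close>)

lemma cube_point_vertex:
  assumes c: "cube_chart X Q k \<phi>" and A: "A \<subseteq> {..<k}"
  shows "cube_point k \<phi> u (\<phi> A) = (\<Prod>i<k. if i \<in> A then u i else 1 - u i)"
  unfolding cube_point_def using A inv_into_f_f[OF cube_chart_inj[OF c], of A] by auto

lemma cube_point_outside:
  assumes c: "cube_chart X Q k \<phi>" and v: "v \<notin> Q"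
  shows "cube_point k \<phi> u v = 0"
  unfolding cube_point_def using v cube_chart_image[OF c] by auto

lemma supp_cube_point_subset:
  assumes c: "cube_chart X Q k \<phi>"
  shows "supp (cube_point k \<phi> u) \<subseteq> Q"
  using cube_point_outside[OF c] by (auto simp: supp_def)

lemma mem_supp_cube_point:
  assumes c: "cube_chart X Q k \<phi>" and A: "A \<subseteq> {..<k}"
  shows "\<phi> A \<in> supp (cube_point k \<phi> u) \<longleftrightarrow> (\<forall>i<k. if i \<in> A then u i \<noteq> 0 else u i \<noteq> 1)"
  unfolding supp_def mem_Collect_eq cube_point_vertex[OF c A] by (auto split: if_splits)

lemma cube_point_nonneg:
  assumes c: "cube_chart X Q k \<phi>" and u: "u \<in> unit_cube k"
  shows "0 \<le> cube_point k \<phi> u v"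
proof (cases "v \<in> Q")
  case True
  then obtain A where A: "A \<subseteq> {..<k}" "v = \<phi> A" using cube_chart_image[OF c] by blast
  show ?thesis unfolding A(2) cube_point_vertex[OF c A(1)]
    using unit_cubeD[OF u] by (auto intro!: prod_nonneg)
qed (simp add: cube_point_outside[OF c])

lemma sum_cube_chart:
  assumes c: "cube_chart X Q k \<phi>"
  shows "(\<Sum>v\<in>Q. f v) = (\<Sum>A\<in>Pow {..<k}. f (\<phi> A))"
  using sum.reindex[OF cube_chart_inj[OF c], of f] cube_chart_image[OF c] by simp

lemma wt_UNIV_cube_point:
  assumes c: "cube_chart X Q k \<phi>"
  shows "wt UNIV (cube_point k \<phi> u) = 1"
proof -
  have "wt UNIV (cube_point k \<phi> u) = (\<Sum>v\<in>Q. cube_point k \<phi> u v)"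
    using wt_eq_sum[OF cube_chart_finite[OF c] supp_cube_point_subset[OF c]] by simp
  also have "\<dots> = (\<Sum>A\<in>Pow {..<k}. \<Prod>i<k. if i \<in> A then u i else 1 - u i)"
    unfolding sum_cube_chart[OF c] by (intro sum.cong) (auto simp: cube_point_vertex[OF c])
  also have "\<dots> = 1" by (subst sum_Pow_prod_if) auto
  finally show ?thesis .
qed

text \<open>Replacing the factor \<open>1 - u j\<close> by 0 keeps just the vertices with
  \<open>j \<in> A\<close>; in the expanded product every other direction then contributes
  \<open>u i + (1 - u i) = 1\<close>.\<close>

lemma wt_direction:
  assumes c: "cube_chart X Q k \<phi>" and j: "j < k"
    and T: "\<And>A. A \<subseteq> {..<k} \<Longrightarrow> \<phi> A \<in> T \<longleftrightarrow> j \<in> A"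
  shows "wt T (cube_point k \<phi> u) = u j"
proof -
  have fin: "finite Q" by (rule cube_chart_finite[OF c])
  have "wt T (cube_point k \<phi> u) = (\<Sum>v\<in>Q \<inter> T. cube_point k \<phi> u v)"
    using wt_eq_sum[OF fin supp_cube_point_subset[OF c]] by (simp add: Int_commute)
  also have "\<dots> = (\<Sum>v\<in>Q. if v \<in> T then cube_point k \<phi> u v else 0)"
    by (rule sum.inter_restrict[OF fin])
  also have "\<dots> = (\<Sum>A\<in>Pow {..<k}. \<Prod>i<k. if i \<in> A then u i else if i = j then 0 else 1 - u i)"
    unfolding sum_cube_chart[OF c]
  proof (intro sum.cong refl)
    fix A assume A: "A \<in> Pow {..<k}"
    show "(if \<phi> A \<in> T then cube_point k \<phi> u (\<phi> A) else 0) =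
      (\<Prod>i<k. if i \<in> A then u i else if i = j then 0 else 1 - u i)"
    proof (cases "j \<in> A")
      case True
      then have "\<phi> A \<in> T" using T A by simp
      then show ?thesis using True A by (auto simp: cube_point_vertex[OF c] intro!: prod.cong)
    next
      case False
      then have "(\<Prod>i<k. if i \<in> A then u i else if i = j then 0 else 1 - u i) = 0"
        using j by (intro prod_zero) auto
      moreover have "\<phi> A \<notin> T" using T A False by simp
      ultimately show ?thesis by simp
    qed
  qed
  also have "\<dots> = (\<Prod>i<k. u i + (if i = j then 0 else 1 - u i))" by (rule sum_Pow_prod_if) simp
  also have "\<dots> = (\<Prod>i<k. if i = j then u j else 1)" by (intro prod.cong) auto
  also have "\<dots> = u j" using j by simp
  finally show ?thesis .
qed

definition flip :: "nat set \<Rightarrow> (nat \<Rightarrow> real) \<Rightarrow> nat \<Rightarrow> real" where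
  "flip B u i = (if i \<in> B then 1 - u i else u i)"

lemma cube_point_rebase:
  assumes c: "cube_chart X Q k \<phi>" and B: "B \<subseteq> {..<k}"
  shows "cube_point k (\<lambda>A. \<phi> (symdiff A B)) (flip B u) = cube_point k \<phi> u"
proof
  fix v
  note c' = cube_chart_rebase[OF c B]
  show "cube_point k (\<lambda>A. \<phi> (symdiff A B)) (flip B u) v = cube_point k \<phi> u v"
  proof (cases "v \<in> Q")
    case True
    then obtain A where A: "A \<subseteq> {..<k}" "v = \<phi> A" using cube_chart_image[OF c] by blast
    have A': "symdiff A B \<subseteq> {..<k}" using A B by auto
    have v: "v = (\<lambda>A. \<phi> (symdiff A B)) (symdiff A B)"
    proof -
      have "symdiff (symdiff A B) B = A" by blast
      then show ?thesis using A by simp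
    qed
    have "cube_point k (\<lambda>A. \<phi> (symdiff A B)) (flip B u) v =
       (\<Prod>i<k. if i \<in> symdiff A B then flip B u i else 1 - flip B u i)"
      unfolding v by (rule cube_point_vertex[OF c' A'])
    also have "\<dots> = (\<Prod>i<k. if i \<in> A then u i else 1 - u i)"
      by (intro prod.cong) (auto simp: flip_def)
    also have "\<dots> = cube_point k \<phi> u v" unfolding A(2) cube_point_vertex[OF c A(1)] ..
    finally show ?thesis .
  qed (simp add: cube_point_outside[OF c] cube_point_outside[OF c'])
qed

lemma flip_unit_cube: "flip B u \<in> unit_cube k \<longleftrightarrow> u \<in> unit_cube k"
  by (auto simp: unit_cube_def flip_def)

text \<open>A product of numbers in [0,1] varies by at most the sum of the variations of its
  factors, and each coordinate varies by at most the Euclidean distance. The constant is crude; it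
  depends on the dimension alone.\<close>

lemma cube_point_diff_le:
  assumes c: "cube_chart X Q k \<phi>" and u: "u \<in> unit_cube k" and w: "w \<in> unit_cube k"
  shows "\<bar>cube_point k \<phi> u v - cube_point k \<phi> w v\<bar> \<le> k * sqrt (\<Sum>i<k. (u i - w i)\<^sup>2)"
proof (cases "v \<in> Q")
  case True
  let ?l = "sqrt (\<Sum>i<k. (u i - w i)\<^sup>2)"
  obtain A where A: "A \<subseteq> {..<k}" "v = \<phi> A" using cube_chart_image[OF c] True by blast
  have le: "\<bar>u i - w i\<bar> \<le> ?l" if "i < k" for i
  proof -
    have "(u i - w i)\<^sup>2 \<le> (\<Sum>i<k. (u i - w i)\<^sup>2)"
      by (rule member_le_sum) (use that in auto)
    then show ?thesis by (metis real_sqrt_abs real_sqrt_le_iff)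
  qed
  have "norm ((\<Prod>i<k. if i \<in> A then u i else 1 - u i) - (\<Prod>i<k. if i \<in> A then w i else 1 - w i))
    \<le> (\<Sum>i<k. norm ((if i \<in> A then u i else 1 - u i) - (if i \<in> A then w i else 1 - w i)))"
    by (rule norm_prod_diff) (use unit_cubeD[OF u] unit_cubeD[OF w] in auto)
  also have "\<dots> \<le> (\<Sum>i<k. ?l)"
  proof (rule sum_mono)
    fix i assume "i \<in> {..<k}"
    then show "norm ((if i \<in> A then u i else 1 - u i) - (if i \<in> A then w i else 1 - w i)) \<le> ?l"
      using le[of i] by (auto simp: abs_minus_commute)
  qed
  finally show ?thesis unfolding A(2) cube_point_vertex[OF c A(1)] by simp
qed (simp add: cube_point_outside[OF c] sum_nonneg)

definition vertex_point :: "'v \<Rightarrow> 'v \<Rightarrow> real" where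
  "vertex_point x = (\<lambda>v. if v = x then 1 else 0)"

lemma supp_vertex_point: "supp (vertex_point x) = {x}"
  by (auto simp: supp_def vertex_point_def)

lemma wt_vertex_point: "wt T (vertex_point x) = (if x \<in> T then 1 else 0)"
  unfolding wt_def supp_vertex_point by (auto simp: vertex_point_def)

lemma cube_point_corner:
  assumes c: "cube_chart X Q k \<phi>"
  shows "cube_point k \<phi> (\<lambda>i. 0) = vertex_point (\<phi> {})"
proof
  fix v
  show "cube_point k \<phi> (\<lambda>i. 0) v = vertex_point (\<phi> {}) v"
  proof (cases "v \<in> Q")
    case True
    then obtain A where A: "A \<subseteq> {..<k}" "v = \<phi> A" using cube_chart_image[OF c] by blast
    have eq: "\<phi> A = \<phi> {} \<longleftrightarrow> A = {}"
      using inj_on_eq_iff[OF cube_chart_inj[OF c], of A "{}"] A by auto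
    have "(\<Prod>i<k. if i \<in> A then 0 else 1 - 0) = (if A = {} then 1 else 0 :: real)"
    proof (cases "A = {}")
      case False
      then have "(\<Prod>i<k. if i \<in> A then 0 else 1 - 0 :: real) = 0"
        using A by (intro prod_zero) auto
      then show ?thesis using False by simp
    qed auto
    then show ?thesis unfolding A(2) cube_point_vertex[OF c A(1)] vertex_point_def eq .
  next
    case False
    then have "v \<noteq> \<phi> {}" using cube_chart_vertexI[OF c, of "{}"] by auto
    then show ?thesis using cube_point_outside[OF c False] by (simp add: vertex_point_def)
  qed
qed

section \<open>The sides of the hyperplane dual to an edge\<close>

text \<open>On a cube containing the edge \<open>{a, b}\<close>, the set \<open>side X a b\<close> is the facet through \<open>b\<close> that
  omits \<open>a\<close>, so \<open>wt (side X a b)\<close> is the coordinate in the direction from \<open>a\<close> to \<open>b\<close>.\<close>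

definition side :: "'v set set \<Rightarrow> 'v \<Rightarrow> 'v \<Rightarrow> 'v set" where
  "side X a b = {w. (\<exists>Q\<in>X. {a, b, w} \<subseteq> Q) \<and> (\<forall>P\<in>X. a \<in> P \<longrightarrow> w \<in> P \<longrightarrow> b \<in> P)}"

lemma sideD: "w \<in> side X a b \<Longrightarrow> P \<in> X \<Longrightarrow> a \<in> P \<Longrightarrow> w \<in> P \<Longrightarrow> b \<in> P"
  by (simp add: side_def)

lemma sideI:
  "\<lbrakk>{a, b, w} \<subseteq> Q; Q \<in> X; \<And>P. \<lbrakk>P \<in> X; a \<in> P; w \<in> P\<rbrakk> \<Longrightarrow> b \<in> P\<rbrakk> \<Longrightarrow> w \<in> side X a b"
  unfolding side_def by auto

context
  fixes X :: "'v set set"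
  assumes cc: "cube_complex X"
begin

text \<open>The decisive test cube is the one spanned by \<open>A\<close>: it is the smallest cube
  containing \<open>\<phi> {}\<close> and \<open>\<phi> A\<close>, and it contains
  \<open>\<phi> {j}\<close> exactly when \<open>j \<in> A\<close>.\<close>

lemma mem_side_chart:
  assumes c: "cube_chart X Q k \<phi>" and j: "j < k" and A: "A \<subseteq> {..<k}"
  shows "\<phi> A \<in> side X (\<phi> {}) (\<phi> {j}) \<longleftrightarrow> j \<in> A"
proof
  assume s: "\<phi> A \<in> side X (\<phi> {}) (\<phi> {j})"
  have "\<phi> {j} \<in> \<phi> ` Pow A" by (rule sideD[OF s pow_face(1)[OF cc c A]]) auto
  then show "j \<in> A" using mem_pow_face[OF cc c A, of "{j}"] j by simp
next
  assume jA: "j \<in> A"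
  have "{\<phi> {}, \<phi> {j}, \<phi> A} \<subseteq> Q" using cube_chart_vertexI[OF c] A j by auto
  moreover have "Q \<in> X" using cube_chart_in[OF c] .
  moreover have "\<phi> {j} \<in> P" if "P \<in> X" "\<phi> {} \<in> P" "\<phi> A \<in> P" for P
    using cube_contains_pow[OF cc c A that] jA by auto
  ultimately show "\<phi> A \<in> side X (\<phi> {}) (\<phi> {j})" by (intro sideI[of _ _ _ Q])
qed

lemma wt_side:
  assumes c: "cube_chart X Q k \<phi>" and j: "j < k"
  shows "wt (side X (\<phi> {}) (\<phi> {j})) (cube_point k \<phi> u) = u j"
  by (rule wt_direction[OF c j mem_side_chart[OF c j]])

lemma realizationE:
  assumes "p \<in> realization X"
  obtains Q k \<phi> u where "cube_chart X Q k \<phi>" "u \<in> unit_cube k" "p = cube_point k \<phi> u"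
  using assms unfolding realization_def unit_cube_def by blast

lemma cube_point_realization:
  assumes c: "cube_chart X Q k \<phi>" and "u \<in> unit_cube k"
  shows "cube_point k \<phi> u \<in> realization X"
  using assms cube_chart_in[OF c] unfolding realization_def unit_cube_def by blast

lemma rebase_point:
  assumes c: "cube_chart X Q k \<phi>" and x: "x \<in> Q"
  obtains \<psi> B where "cube_chart X Q k \<psi>" "\<psi> {} = x"
    "\<And>u. cube_point k \<phi> u = cube_point k \<psi> (flip B u)"
proof -
  obtain B where B: "B \<subseteq> {..<k}" "\<phi> B = x" using cube_chart_image[OF c] x by blast
  show thesis
    by (rule that[OF cube_chart_rebase[OF c B(1)] _ cube_point_rebase[OF c B(1), symmetric]])
      (simp add: B)
qed

lemma realization_basedE:
  assumes "p \<in> realization X" "x \<in> supp p"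
  obtains Q k \<phi> u where "cube_chart X Q k \<phi>" "\<phi> {} = x" "u \<in> unit_cube k" "p = cube_point k \<phi> u"
proof -
  obtain Q k \<phi> u where c: "cube_chart X Q k \<phi>" "u \<in> unit_cube k" "p = cube_point k \<phi> u"
    using realizationE[OF assms(1)] .
  then have "x \<in> Q" using assms supp_cube_point_subset[OF c(1)] by blast
  then obtain \<psi> B where "cube_chart X Q k \<psi>" "\<psi> {} = x"
    "\<And>u. cube_point k \<phi> u = cube_point k \<psi> (flip B u)" by (rule rebase_point[OF c(1)]) blast
  then show thesis using that[of Q k \<psi> "flip B u"] c by (simp add: flip_unit_cube)
qed

lemma vertex_point_realization:
  assumes "x \<in> vertices X" shows "vertex_point x \<in> realization X"
proof -
  obtain Q where "Q \<in> X" "x \<in> Q" using assms by (auto simp: vertices_def)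
  then obtain k \<phi> where c: "cube_chart X Q k \<phi>" "\<phi> {} = x" by (rule based_chart_exists[OF cc])
  have "(\<lambda>i. 0) \<in> unit_cube k" by (simp add: unit_cube_def)
  then show ?thesis using cube_point_realization[OF c(1)] cube_point_corner[OF c(1)] c(2) by metis
qed

lemma supp_nonempty: "p \<in> realization X \<Longrightarrow> supp p \<noteq> {}"
proof -
  assume p: "p \<in> realization X"
  then obtain Q k \<phi> u where c: "cube_chart X Q k \<phi>" "p = cube_point k \<phi> u"
    by (rule realizationE)
  have "wt UNIV p = 1" unfolding c(2) by (rule wt_UNIV_cube_point[OF c(1)])
  then show "supp p \<noteq> {}" by (auto simp: wt_def)
qed

text \<open>The support is the vertex set of the carrier of the point. Seen from a chart based in
  the support no coordinate is 1, so the support is spanned by the directions with nonzero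
  coordinate.\<close>

lemma supp_cube:
  assumes "p \<in> realization X" shows "supp p \<in> X"
proof -
  obtain x where x: "x \<in> supp p" using supp_nonempty[OF assms] by blast
  obtain Q k \<phi> u where c: "cube_chart X Q k \<phi>" "\<phi> {} = x" "u \<in> unit_cube k" "p = cube_point k \<phi> u"
    using realization_basedE[OF assms x] .
  define J where "J = {i. i < k \<and> u i \<noteq> 0}"
  have J: "J \<subseteq> {..<k}" by (auto simp: J_def)
  have ne1: "u i \<noteq> 1" if "i < k" for i
    using x mem_supp_cube_point[OF c(1), of "{}" u] c(2,4) that by simp
  have "supp p \<subseteq> \<phi> ` Pow {..<k}"
    using supp_cube_point_subset[OF c(1)] c(4) cube_chart_image[OF c(1)] by simp
  moreover have "\<phi> A \<in> supp p \<longleftrightarrow> A \<subseteq> J" if "A \<subseteq> {..<k}" for A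
    unfolding c(4) mem_supp_cube_point[OF c(1) that] using ne1 that by (auto simp: J_def)
  ultimately have "supp p = \<phi> ` Pow J" using J by blast
  then show ?thesis using pow_face(1)[OF cc c(1) J] by simp
qed

lemma realization_nonneg: "p \<in> realization X \<Longrightarrow> 0 \<le> p v"
  by (erule realizationE) (simp add: cube_point_nonneg)

lemma finite_supp: "p \<in> realization X \<Longrightarrow> finite (supp p)"
  using cube_finite[OF cc supp_cube] .

lemma wt_UNIV: "p \<in> realization X \<Longrightarrow> wt UNIV p = 1"
  by (erule realizationE) (simp add: wt_UNIV_cube_point)

lemma wt_compl: "p \<in> realization X \<Longrightarrow> wt (- T) p = 1 - wt T p"
proof -
  assume p: "p \<in> realization X"
  have "wt T p + wt (- T) p = (\<Sum>v\<in>T \<inter> supp p \<union> - T \<inter> supp p. p v)"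
    unfolding wt_def using finite_supp[OF p] by (intro sum.union_disjoint[symmetric]) auto
  also have "T \<inter> supp p \<union> - T \<inter> supp p = UNIV \<inter> supp p" by auto
  finally show ?thesis using wt_UNIV[OF p] by (simp add: wt_def)
qed

lemma wt_pos_iff:
  assumes p: "p \<in> realization X" shows "0 < wt T p \<longleftrightarrow> T \<inter> supp p \<noteq> {}"
proof
  show "T \<inter> supp p \<noteq> {}" if "0 < wt T p"
    using that by (auto simp: wt_def)
  assume "T \<inter> supp p \<noteq> {}"
  then show "0 < wt T p" unfolding wt_def
    using finite_supp[OF p] realization_nonneg[OF p]
    by (intro sum_pos) (auto simp: supp_def order.strict_iff_order)
qed

lemma wt_less_one_iff:
  assumes p: "p \<in> realization X" shows "wt T p < 1 \<longleftrightarrow> supp p - T \<noteq> {}"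
  using wt_pos_iff[OF p, of "- T"] wt_compl[OF p, of T] by (auto simp: Diff_eq Int_commute)

lemma wt_singleton: "wt {v} p = p v"
proof (cases "p v = 0")
  case False
  then have "{v} \<inter> supp p = {v}" by (auto simp: supp_def)
  then show ?thesis by (simp add: wt_def)
next
  case True
  then have "{v} \<inter> supp p = {}" by (auto simp: supp_def)
  then show ?thesis using True by (simp add: wt_def)
qed

lemma wt_side_strict:
  assumes p: "p \<in> realization X" and ab: "{a, b} \<in> X" "a \<noteq> b" "a \<in> supp p" "b \<in> supp p"
  shows "0 < wt (side X a b) p" "wt (side X a b) p < 1"
proof -
  have "b \<in> side X a b" using ab supp_cube[OF p] by (auto simp: side_def)
  then show "0 < wt (side X a b) p" using wt_pos_iff[OF p] ab by blast
  have "{a} \<in> X" using cube_vertex[OF cc ab(1)] by simp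
  then have "a \<notin> side X a b" using ab(2) by (auto simp: side_def)
  then show "wt (side X a b) p < 1" using wt_less_one_iff[OF p] ab by blast
qed

lemma side_sym:
  assumes ab: "{a, b} \<in> X" "a \<noteq> b" and Q: "Q \<in> X" "a \<in> Q" "b \<in> Q" and w: "w \<in> Q"
  shows "w \<in> side X b a \<longleftrightarrow> w \<notin> side X a b"
proof -
  obtain k \<phi> where c: "cube_chart X Q k \<phi>" "\<phi> {} = a" using based_chart_exists[OF cc Q(1,2)] .
  have "{\<phi> {}, b} \<in> X" "b \<noteq> \<phi> {}" using ab c(2) by auto
  then obtain j where j: "j < k" "b = \<phi> {j}" by (rule edge_at_base[OF cc c(1) Q(3)])
  define \<psi> where "\<psi> = (\<lambda>A. \<phi> (symdiff A {j}))"
  have c': "cube_chart X Q k \<psi>" unfolding \<psi>_def using cube_chart_rebase[OF c(1)] j by simp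
  have ba: "\<psi> {} = b" "\<psi> {j} = a" by (simp_all add: \<psi>_def j c(2))
  obtain A where A: "A \<subseteq> {..<k}" "w = \<phi> A" using cube_chart_image[OF c(1)] w by blast
  define A' where "A' = symdiff A {j}"
  have A': "A' \<subseteq> {..<k}" using A j by (auto simp: A'_def)
  have "symdiff A' {j} = A" by (auto simp: A'_def)
  then have w': "w = \<psi> A'" using A by (simp add: \<psi>_def)
  have "w \<in> side X b a \<longleftrightarrow> j \<in> A'"
    using mem_side_chart[OF c' j(1) A'] w' ba by simp
  moreover have "w \<in> side X a b \<longleftrightarrow> j \<in> A"
    using mem_side_chart[OF c(1) j(1) A(1)] A(2) c(2) j(2) by simp
  ultimately show ?thesis by (auto simp: A'_def)
qed

lemma wt_side_flip:
  assumes p: "p \<in> realization X" and ab: "{a, b} \<in> X" "a \<noteq> b" "a \<in> supp p" "b \<in> supp p"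
  shows "wt (side X b a) p = 1 - wt (side X a b) p"
proof -
  have "side X b a \<inter> supp p = - side X a b \<inter> supp p"
    using side_sym[OF ab(1,2) supp_cube[OF p] ab(3,4)] by blast
  then have "wt (side X b a) p = wt (- side X a b) p" by (simp add: wt_def)
  then show ?thesis using wt_compl[OF p] by simp
qed

text \<open>An edge of the carrier that enters \<open>side X a b\<close> changes the same coordinate
  \<open>j\<close> in the same sense, so the two sides have the same trace on the carrier, and the
  weight sees only that trace.\<close>

lemma wt_side_parallel:
  assumes p: "p \<in> realization X" and ab: "{a, b} \<in> X" "a \<noteq> b" "a \<in> supp p" "b \<in> supp p"
    and cd: "{c, d} \<in> X" "c \<in> supp p" "d \<in> supp p" "c \<notin> side X a b" "d \<in> side X a b"
  shows "wt (side X c d) p = wt (side X a b) p"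
proof -
  let ?Q = "supp p"
  have Q: "?Q \<in> X" using supp_cube[OF p] .
  obtain k \<phi> where ch: "cube_chart X ?Q k \<phi>" "\<phi> {} = a" using based_chart_exists[OF cc Q ab(3)] .
  have "{\<phi> {}, b} \<in> X" "b \<noteq> \<phi> {}" using ab ch(2) by auto
  then obtain j where j: "j < k" "b = \<phi> {j}" by (rule edge_at_base[OF cc ch(1) ab(4)])
  obtain C where C: "C \<subseteq> {..<k}" "c = \<phi> C" using cube_chart_image[OF ch(1)] cd(2) by blast
  obtain E where E: "E \<subseteq> {..<k}" "d = \<phi> E" using cube_chart_image[OF ch(1)] cd(3) by blast
  have side: "\<phi> A \<in> side X a b \<longleftrightarrow> j \<in> A" if "A \<subseteq> {..<k}" for A
    using mem_side_chart[OF ch(1) j(1) that] ch(2) j(2) by simp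
  have jC: "j \<notin> C" "j \<in> E" using side C E cd by auto
  define \<psi> where "\<psi> = (\<lambda>A. \<phi> (symdiff A C))"
  have ch': "cube_chart X ?Q k \<psi>" unfolding \<psi>_def using cube_chart_rebase[OF ch(1) C(1)] .
  have c0: "\<psi> {} = c" by (simp add: \<psi>_def C)
  have "{\<psi> {}, d} \<in> X" "d \<noteq> \<psi> {}" using cd c0 by auto
  then obtain i where i: "i < k" "d = \<psi> {i}" by (rule edge_at_base[OF cc ch' cd(3)])
  have sE: "symdiff {i} C = E"
  proof -
    have "symdiff {i} C \<subseteq> {..<k}" using i(1) C(1) by auto
    moreover have "\<phi> (symdiff {i} C) = \<phi> E" using i(2) E(2) by (simp add: \<psi>_def)
    ultimately show ?thesis using chart_inj[OF cc ch(1) _ E(1)] by simp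
  qed
  have "j \<in> symdiff {i} C" unfolding sE by (rule jC(2))
  then have ij: "i = j" using jC(1) by auto
  have "w \<in> side X c d \<longleftrightarrow> w \<in> side X a b" if "w \<in> ?Q" for w
  proof -
    have "w \<in> \<psi> ` Pow {..<k}" unfolding cube_chart_image[OF ch'] by (rule that)
    then obtain A where A: "A \<subseteq> {..<k}" "w = \<psi> A" by auto
    have "w \<in> side X c d \<longleftrightarrow> j \<in> A"
      using mem_side_chart[OF ch' i(1) A(1)] A(2) c0 i(2) ij by simp
    moreover have "symdiff A C \<subseteq> {..<k}" using A C by auto
    then have "w \<in> side X a b \<longleftrightarrow> j \<in> symdiff A C" using side A(2) by (simp add: \<psi>_def)
    ultimately show ?thesis using jC by blast
  qed
  then have "side X c d \<inter> ?Q = side X a b \<inter> ?Q" by blast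
  then show ?thesis by (simp add: wt_def)
qed

text \<open>A face that meets both sides has \<open>j\<close> among its free directions, hence
  contains an edge in direction \<open>j\<close>. This hands a direction of the larger cube
  \<open>Q\<close> down to its face \<open>P\<close>.\<close>

lemma parallel_edge_exists:
  assumes ab: "{a, b} \<in> X" "a \<noteq> b" and Q: "Q \<in> X" "a \<in> Q" "b \<in> Q"
    and P: "P \<in> X" "P \<subseteq> Q" "P \<inter> side X a b \<noteq> {}" "P - side X a b \<noteq> {}"
  obtains c d where "{c, d} \<in> X" "c \<in> P" "d \<in> P" "c \<notin> side X a b" "d \<in> side X a b"
proof -
  obtain k \<phi> where ch: "cube_chart X Q k \<phi>" "\<phi> {} = a" using based_chart_exists[OF cc Q(1,2)] .
  have "{\<phi> {}, b} \<in> X" "b \<noteq> \<phi> {}" using ab ch(2) by auto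
  then obtain j where j: "j < k" "b = \<phi> {j}" by (rule edge_at_base[OF cc ch(1) Q(3)])
  have side: "\<phi> A \<in> side X a b \<longleftrightarrow> j \<in> A" if "A \<subseteq> {..<k}" for A
    using mem_side_chart[OF ch(1) j(1) that] ch(2) j(2) by simp
  obtain S T where ST: "S \<subseteq> T" "T \<subseteq> {..<k}" "P = \<phi> ` {A. S \<subseteq> A \<and> A \<subseteq> T}"
    using cube_chart_faceE[OF ch(1) P(1,2)] .
  obtain A1 where A1: "S \<subseteq> A1" "A1 \<subseteq> T" "j \<in> A1" using P(3) ST side by fastforce
  obtain A2 where A2: "S \<subseteq> A2" "A2 \<subseteq> T" "j \<notin> A2" using P(4) ST side by fastforce
  have A2k: "A2 \<subseteq> {..<k}" "insert j A2 \<subseteq> {..<k}" using A2 ST j by auto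
  show thesis
  proof (rule that)
    show "{\<phi> A2, \<phi> (insert j A2)} \<in> X" using chart_edge(1)[OF cc ch(1) A2k(1) j(1) A2(3)] .
    show "\<phi> A2 \<in> P" unfolding ST(3) using A2 by blast
    have "insert j A2 \<subseteq> T" using A1 A2 by blast
    then show "\<phi> (insert j A2) \<in> P" unfolding ST(3) using A2 by blast
    show "\<phi> A2 \<notin> side X a b" using side[OF A2k(1)] A2 by simp
    show "\<phi> (insert j A2) \<in> side X a b" using side[OF A2k(2)] by simp
  qed
qed

end

section \<open>Coordinates are affine along geodesics\<close>

lemma cube_segmentE:
  assumes "cube_segment X p q l"
  obtains Q k \<phi> u w where "cube_chart X Q k \<phi>" "u \<in> unit_cube k" "w \<in> unit_cube k"
    "p = cube_point k \<phi> u" "q = cube_point k \<phi> w" "l = sqrt (\<Sum>i<k. (u i - w i)\<^sup>2)"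
  using assms unfolding cube_segment_def unit_cube_def by auto

lemma cube_segmentI:
  assumes "cube_chart X Q k \<phi>" "u \<in> unit_cube k" "w \<in> unit_cube k"
  shows "cube_segment X (cube_point k \<phi> u) (cube_point k \<phi> w) (sqrt (\<Sum>i<k. (u i - w i)\<^sup>2))"
  unfolding cube_segment_def using assms cube_chart_in[OF assms(1)] unfolding unit_cube_def by blast

lemma cube_segment_nonneg: "cube_segment X p q l \<Longrightarrow> 0 \<le> l"
  by (erule cube_segmentE) (simp add: sum_nonneg)

lemma sum_flip_diff:
  "(\<Sum>i<k. (flip B u i - flip B w i)\<^sup>2) = (\<Sum>i<k. (u i - w i)\<^sup>2)"
  by (intro sum.cong) (auto simp: flip_def power2_commute)

text \<open>Equality case of the triangle inequality in the plane: two vectors of lengths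
  \<open>x1\<close> and \<open>x2\<close> whose sum has length at least \<open>x1 + x2\<close> are
  parallel. The hypothesis bounds the inner product from below, which makes a sum of two squares
  nonpositive.\<close>

lemma parallel_vectors:
  fixes h1 h2 B1 B2 x1 x2 :: real
  assumes "h1\<^sup>2 + B1\<^sup>2 = x1\<^sup>2" "h2\<^sup>2 + B2\<^sup>2 = x2\<^sup>2" "0 \<le> x1" "0 \<le> x2"
    and "(x1 + x2)\<^sup>2 \<le> (h1 + h2)\<^sup>2 + (B1 + B2)\<^sup>2"
  shows "B1 * x2 = B2 * x1"
proof -
  have 1: "x1 * x2 \<le> h1 * h2 + B1 * B2"
    using assms by (simp add: power2_eq_square algebra_simps)
  have "(B1 * x2 - B2 * x1)\<^sup>2 + (h1 * x2 - h2 * x1)\<^sup>2 =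
      (h1\<^sup>2 + B1\<^sup>2) * x2\<^sup>2 + (h2\<^sup>2 + B2\<^sup>2) * x1\<^sup>2 - 2 * (x1 * x2) * (h1 * h2 + B1 * B2)"
    by (simp add: power2_eq_square algebra_simps)
  also have "\<dots> = 2 * (x1 * x2) * (x1 * x2 - (h1 * h2 + B1 * B2))"
    unfolding assms(1,2) by (simp add: power2_eq_square algebra_simps)
  also have "\<dots> \<le> 0" using 1 assms(3,4) by (intro mult_nonneg_nonpos) auto
  finally have "(B1 * x2 - B2 * x1)\<^sup>2 \<le> 0" by (smt (verit) zero_le_power2)
  then show ?thesis by simp
qed

lemma sqrt_sum_triangle:
  fixes a b c e :: real
  shows "sqrt ((a + c)\<^sup>2 + (b + e)\<^sup>2) \<le> sqrt (a\<^sup>2 + b\<^sup>2) + sqrt (c\<^sup>2 + e\<^sup>2)"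
  using norm_triangle_ineq[of "(a, b)" "(c, e)"] by (simp add: norm_Pair)

text \<open>The bound on the dimension makes the Lipschitz constant of weights uniform over all
  cubes.\<close>

locale cat0_complex =
  fixes X :: "'v set set" and n :: nat
  assumes cc: "cube_complex X"
    and cat0: "cat0_space (realization X) (length_dist X)"
    and dim_le: "Q \<in> X \<Longrightarrow> cube_dim Q \<le> n"
begin

section \<open>The length metric and the Lipschitz continuity of weights\<close>

abbreviation "R \<equiv> realization X"
abbreviation "d \<equiv> length_dist X"

lemma metric: "Metric_space R d"
  using cat0 by (simp add: cat0_space_def)

lemma d_nonneg: "0 \<le> d p q" by (rule Metric_space.nonneg[OF metric])
lemma d_sym: "d p q = d q p" by (rule Metric_space.commute[OF metric])
lemma d_zero: "p \<in> R \<Longrightarrow> q \<in> R \<Longrightarrow> d p q = 0 \<longleftrightarrow> p = q" by (rule Metric_space.zero[OF metric])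
lemma d_tri: "p \<in> R \<Longrightarrow> q \<in> R \<Longrightarrow> r \<in> R \<Longrightarrow> d p r \<le> d p q + d q r"
  by (rule Metric_space.triangle[OF metric])

lemma segment_in_R: "cube_segment X p q l \<Longrightarrow> p \<in> R \<and> q \<in> R"
  by (erule cube_segmentE) (simp add: cube_point_realization[OF cc])

lemma string_lengths_nonneg: "s \<in> string_lengths X p q \<Longrightarrow> 0 \<le> s"
  unfolding string_lengths_def by (auto intro!: sum_nonneg dest: cube_segment_nonneg)

lemma d_le_string: "s \<in> string_lengths X p q \<Longrightarrow> d p q \<le> s"
  unfolding length_dist_def
  by (auto intro!: cInf_lower bdd_belowI[of _ 0] string_lengths_nonneg)

text \<open>Connectedness is hidden in the metric axioms: without a string
  \<open>length_dist\<close> takes the value 0, which is forbidden for distinct points.\<close>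

lemma string_exists:
  assumes "p \<in> R" "q \<in> R" shows "string_lengths X p q \<noteq> {}"
proof (cases "p = q")
  case True
  then have "0 \<in> string_lengths X p q"
    unfolding string_lengths_def using assms by (auto intro!: exI[of _ "0::nat"] exI[of _ "\<lambda>_. p"])
  then show ?thesis by blast
next
  case False
  then have "d p q \<noteq> 0" using d_zero assms by simp
  then show ?thesis unfolding length_dist_def by auto
qed

lemma d_approx:
  assumes "p \<in> R" "q \<in> R" "0 < \<eta>"
  obtains s where "s \<in> string_lengths X p q" "s < d p q + \<eta>"
proof -
  have "Inf (string_lengths X p q) < d p q + \<eta>"
    using assms string_exists[OF assms(1,2)] by (simp add: length_dist_def)
  then show thesis using cInf_lessD[OF string_exists[OF assms(1,2)]] that by blast
qed

lemma d_le_segment: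
  assumes "cube_segment X p q l" shows "d p q \<le> l"
proof (rule d_le_string)
  have "\<exists>m z l'. l = (\<Sum>i<m. l' i) \<and> (\<forall>i\<le>m. z i \<in> R) \<and> z 0 = p \<and> z m = q \<and>
     (\<forall>i<m. cube_segment X (z i) (z (Suc i)) (l' i))"
    using assms segment_in_R[OF assms]
    by (intro exI[of _ "1::nat"] exI[of _ "\<lambda>i. if i = 0 then p else q"] exI[of _ "\<lambda>_. l"]) auto
  then show "l \<in> string_lengths X p q" unfolding string_lengths_def by auto
qed

text \<open>A cube has at most \<open>2 ^ n\<close> vertices, and by
  \<open>cube_point_diff_le\<close> the weight of each is Lipschitz with constant
  \<open>n\<close>.\<close>

definition lip :: real where "lip = 2 ^ n * n"

lemma lip_nonneg: "0 \<le> lip" by (simp add: lip_def)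

lemma wt_segment:
  assumes "cube_segment X p q l" shows "\<bar>wt T p - wt T q\<bar> \<le> lip * l"
proof -
  obtain Q k \<phi> u w where c: "cube_chart X Q k \<phi>" "u \<in> unit_cube k" "w \<in> unit_cube k"
    and p: "p = cube_point k \<phi> u" and q: "q = cube_point k \<phi> w"
    and l: "l = sqrt (\<Sum>i<k. (u i - w i)\<^sup>2)"
    using cube_segmentE[OF assms] .
  have kn: "k \<le> n" using dim_le[OF cube_chart_in[OF c(1)]] cube_chart_dim[OF c(1)] by simp
  have fin: "finite Q" using cube_chart_finite[OF c(1)] .
  have l0: "0 \<le> l" using cube_segment_nonneg[OF assms] .
  have "\<bar>wt T p - wt T q\<bar> = \<bar>\<Sum>v\<in>T \<inter> Q. (p v - q v)\<bar>"
    using wt_eq_sum[OF fin, of p T] wt_eq_sum[OF fin, of q T] supp_cube_point_subset[OF c(1)]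
    by (simp add: p q sum_subtractf)
  also have "\<dots> \<le> (\<Sum>v\<in>T \<inter> Q. \<bar>p v - q v\<bar>)" by (rule sum_abs)
  also have "\<dots> \<le> (\<Sum>v\<in>T \<inter> Q. k * l)"
    by (rule sum_mono) (simp add: p q l cube_point_diff_le[OF c])
  also have "\<dots> = card (T \<inter> Q) * (k * l)" by simp
  also have "\<dots> \<le> 2 ^ n * (n * l)"
  proof (intro mult_mono)
    have "card (T \<inter> Q) \<le> card Q" using fin by (intro card_mono) auto
    also have "\<dots> = 2 ^ k" using cube_chart_card[OF c(1)] .
    also have "\<dots> \<le> 2 ^ n" using kn by simp
    finally show "real (card (T \<inter> Q)) \<le> 2 ^ n" by (metis of_nat_le_iff of_nat_numeral of_nat_power)
  qed (use kn l0 in auto)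
  finally show ?thesis by (simp add: lip_def mult.assoc)
qed

lemma wt_string:
  assumes "s \<in> string_lengths X p q" shows "\<bar>wt T p - wt T q\<bar> \<le> lip * s"
proof -
  obtain m z l where s: "s = (\<Sum>i<m. l i)" and z: "z 0 = p" "z m = q"
    and seg: "\<forall>i<m. cube_segment X (z i) (z (Suc i)) (l i)"
    using assms unfolding string_lengths_def by auto
  have "\<bar>wt T (z 0) - wt T (z j)\<bar> \<le> lip * (\<Sum>i<j. l i)" if "j \<le> m" for j
    using that
  proof (induction j)
    case (Suc j)
    then have "\<bar>wt T (z j) - wt T (z (Suc j))\<bar> \<le> lip * l j" using wt_segment seg by simp
    then show ?case using Suc by (simp add: algebra_simps)
  qed simp
  from this[of m] show ?thesis by (simp add: s z)
qed

lemma wt_lipschitz: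
  assumes "p \<in> R" "q \<in> R" shows "\<bar>wt T p - wt T q\<bar> \<le> lip * d p q"
proof (rule field_le_epsilon)
  fix e :: real assume e: "0 < e"
  \<comment> \<open>Adding 1 avoids a division by zero, as \<open>lip = 0\<close> for
    \<open>n = 0\<close>; the same device recurs below.\<close>
  obtain s where s: "s \<in> string_lengths X p q" "s < d p q + e / (lip + 1)"
    using d_approx[OF assms, of "e / (lip + 1)"] e lip_nonneg by auto
  have "\<bar>wt T p - wt T q\<bar> \<le> lip * s" by (rule wt_string[OF s(1)])
  also have "\<dots> \<le> lip * (d p q + e / (lip + 1))" using s lip_nonneg by (intro mult_left_mono) auto
  also have "\<dots> \<le> lip * d p q + e"
    using lip_nonneg e by (simp add: field_simps)
  finally show "\<bar>wt T p - wt T q\<bar> \<le> lip * d p q + e" .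
qed

text \<open>The weights on the finite support have a positive minimum, and by the Lipschitz bound
  none of them can drop to 0 within a small ball. Carriers can only grow under small
  perturbations.\<close>

lemma supp_nbhd:
  assumes p: "p \<in> R"
  obtains \<epsilon> where "0 < \<epsilon>" "\<And>q. q \<in> R \<Longrightarrow> d p q < \<epsilon> \<Longrightarrow> supp p \<subseteq> supp q"
proof -
  define m where "m = Min (p ` supp p)"
  have fin: "finite (p ` supp p)" "p ` supp p \<noteq> {}"
    using finite_supp[OF cc p] supp_nonempty[OF cc p] by auto
  have pos: "0 < p v" if "v \<in> supp p" for v
    using that realization_nonneg[OF cc p, of v] by (auto simp: supp_def)
  have m: "0 < m" using Min_in[OF fin] pos by (auto simp: m_def)
  show thesis
  proof (rule that)
    show "0 < m / (lip + 1)" using m lip_nonneg by auto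
    fix q assume q: "q \<in> R" "d p q < m / (lip + 1)"
    show "supp p \<subseteq> supp q"
    proof
      fix v assume v: "v \<in> supp p"
      have "p v - q v \<le> lip * d p q"
        using wt_lipschitz[OF p q(1), of "{v}"] by (simp add: wt_singleton[OF cc])
      also have "\<dots> < m"
      proof -
        have "lip * d p q \<le> (lip + 1) * d p q" using d_nonneg[of p q] by (simp add: algebra_simps)
        also have "\<dots> < m" using q(2) lip_nonneg by (simp add: pos_less_divide_eq mult.commute)
        finally show ?thesis .
      qed
      also have "m \<le> p v" unfolding m_def using fin v by simp
      finally show "v \<in> supp q" by (simp add: supp_def)
    qed
  qed
qed

text \<open>\<open>shift a b t z\<close> moves \<open>z\<close> parallel to the edge \<open>{a, b}\<close> until its coordinate in that
  direction is \<open>t\<close>.\<close>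

definition shift :: "'v \<Rightarrow> 'v \<Rightarrow> real \<Rightarrow> ('v \<Rightarrow> real) \<Rightarrow> 'v \<Rightarrow> real" where
  "shift a b t z = (\<lambda>w. z w *
     (if w \<in> side X a b then t / wt (side X a b) z else (1 - t) / (1 - wt (side X a b) z)))"

lemma shift_self:
  assumes "z \<in> R" "{a, b} \<in> X" "a \<noteq> b" "a \<in> supp z" "b \<in> supp z"
  shows "shift a b (wt (side X a b) z) z = z"
  using wt_side_strict[OF cc assms] by (auto simp: shift_def)

text \<open>Each vertex weight contains \<open>u j\<close> or \<open>1 - u j\<close> as a factor;
  dividing by it and multiplying by \<open>t\<close> or \<open>1 - t\<close> changes that coordinate
  alone.\<close>

lemma shift_chart:
  assumes c: "cube_chart X Q k \<phi>" and j: "j < k" and uj: "u j \<noteq> 0" "u j \<noteq> 1"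
  shows "shift (\<phi> {}) (\<phi> {j}) t (cube_point k \<phi> u) = cube_point k \<phi> (u(j := t))"
proof
  fix v
  show "shift (\<phi> {}) (\<phi> {j}) t (cube_point k \<phi> u) v = cube_point k \<phi> (u(j := t)) v"
  proof (cases "v \<in> Q")
    case False
    then show ?thesis by (simp add: shift_def cube_point_outside[OF c])
  next
    case True
    then have "v \<in> \<phi> ` Pow {..<k}" using cube_chart_image[OF c] by simp
    then obtain A where A: "A \<subseteq> {..<k}" "v = \<phi> A" by auto
    have split: "cube_point k \<phi> w (\<phi> A) =
      (if j \<in> A then w j else 1 - w j) * (\<Prod>i\<in>{..<k} - {j}. if i \<in> A then w i else 1 - w i)" for w
      unfolding cube_point_vertex[OF c A(1)] by (rule prod.remove) (use j in auto)
    have eq: "(\<Prod>i\<in>{..<k} - {j}. if i \<in> A then (u(j := t)) i else 1 - (u(j := t)) i) =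
      (\<Prod>i\<in>{..<k} - {j}. if i \<in> A then u i else 1 - u i)"
      by (intro prod.cong) auto
    show ?thesis
      unfolding A(2) shift_def wt_side[OF cc c j] mem_side_chart[OF cc c j A(1)] split eq
      using uj by simp
  qed
qed

lemma cube_segment_based:
  assumes s: "cube_segment X z z' l" and ab: "{a, b} \<in> X" "a \<noteq> b" "a \<in> supp z" "b \<in> supp z"
  obtains Q k \<phi> j u w where "cube_chart X Q k \<phi>" "\<phi> {} = a" "j < k" "b = \<phi> {j}"
    "u \<in> unit_cube k" "w \<in> unit_cube k" "z = cube_point k \<phi> u" "z' = cube_point k \<phi> w"
    "l = sqrt (\<Sum>i<k. (u i - w i)\<^sup>2)"
proof -
  obtain Q k \<phi> u w where c: "cube_chart X Q k \<phi>" "u \<in> unit_cube k" "w \<in> unit_cube k"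
    and p: "z = cube_point k \<phi> u" and q: "z' = cube_point k \<phi> w"
    and l: "l = sqrt (\<Sum>i<k. (u i - w i)\<^sup>2)"
    using cube_segmentE[OF s] .
  have abQ: "a \<in> Q" "b \<in> Q" using supp_cube_point_subset[OF c(1), of u] ab p by auto
  obtain \<psi> B where r: "cube_chart X Q k \<psi>" "\<psi> {} = a"
    "\<And>u. cube_point k \<phi> u = cube_point k \<psi> (flip B u)"
    by (rule rebase_point[OF cc c(1) abQ(1)]) blast
  have "{\<psi> {}, b} \<in> X" "b \<noteq> \<psi> {}" using ab r(2) by auto
  then obtain j where j: "j < k" "b = \<psi> {j}" by (rule edge_at_base[OF cc r(1) abQ(2)])
  show thesis
  proof (rule that)
    show "l = sqrt (\<Sum>i<k. (flip B u i - flip B w i)\<^sup>2)" using l sum_flip_diff by simp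
  qed (use r j c p q in \<open>simp_all add: flip_unit_cube\<close>)
qed

text \<open>Pythagoras in a cube split as an interval times a face: the component of the segment
  orthogonal to the edge is kept, while the component along the edge becomes
  \<open>t' - t\<close>.\<close>

lemma segment_shift:
  assumes s: "cube_segment X z z' l" and ab: "{a, b} \<in> X" "a \<noteq> b"
    and z: "a \<in> supp z" "b \<in> supp z" "a \<in> supp z'" "b \<in> supp z'"
    and t: "0 \<le> t" "t \<le> 1" "0 \<le> t'" "t' \<le> 1"
  shows "cube_segment X (shift a b t z) (shift a b t' z')
      (sqrt (l\<^sup>2 - (wt (side X a b) z' - wt (side X a b) z)\<^sup>2 + (t' - t)\<^sup>2))"
    and "(wt (side X a b) z' - wt (side X a b) z)\<^sup>2 \<le> l\<^sup>2"
proof -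
  obtain Q k \<phi> j u w where c: "cube_chart X Q k \<phi>" "\<phi> {} = a" and j: "j < k" "b = \<phi> {j}"
    and u: "u \<in> unit_cube k" "w \<in> unit_cube k" "z = cube_point k \<phi> u" "z' = cube_point k \<phi> w"
    and l: "l = sqrt (\<Sum>i<k. (u i - w i)\<^sup>2)"
    using cube_segment_based[OF s ab z(1,2)] .
  have wtz: "wt (side X a b) z = u j" "wt (side X a b) z' = w j"
    using wt_side[OF cc c(1) j(1)] u c j by auto
  have zR: "z \<in> R" "z' \<in> R" using segment_in_R[OF s] by auto
  have strict: "u j \<noteq> 0" "u j \<noteq> 1" "w j \<noteq> 0" "w j \<noteq> 1"
    using wt_side_strict[OF cc zR(1) ab z(1,2)] wt_side_strict[OF cc zR(2) ab z(3,4)] wtz by auto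
  have sh: "shift a b t z = cube_point k \<phi> (u(j := t))" "shift a b t' z' = cube_point k \<phi> (w(j := t'))"
    using shift_chart[OF c(1) j(1)] strict u c j by auto
  have l2: "l\<^sup>2 = (u j - w j)\<^sup>2 + (\<Sum>i\<in>{..<k} - {j}. (u i - w i)\<^sup>2)"
  proof -
    have "l\<^sup>2 = (\<Sum>i<k. (u i - w i)\<^sup>2)" unfolding l by (simp add: sum_nonneg)
    also have "\<dots> = (u j - w j)\<^sup>2 + (\<Sum>i\<in>{..<k} - {j}. (u i - w i)\<^sup>2)"
      by (rule sum.remove) (use j in auto)
    finally show ?thesis .
  qed
  have "(\<Sum>i<k. ((u(j := t)) i - (w(j := t')) i)\<^sup>2) =
     (t - t')\<^sup>2 + (\<Sum>i\<in>{..<k} - {j}. ((u(j := t)) i - (w(j := t')) i)\<^sup>2)"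
    using sum.remove[of "{..<k}" j "\<lambda>i. ((u(j := t)) i - (w(j := t')) i)\<^sup>2"] j by simp
  also have "(\<Sum>i\<in>{..<k} - {j}. ((u(j := t)) i - (w(j := t')) i)\<^sup>2) = (\<Sum>i\<in>{..<k} - {j}. (u i - w i)\<^sup>2)"
    by (intro sum.cong) auto
  finally have eq: "(\<Sum>i<k. ((u(j := t)) i - (w(j := t')) i)\<^sup>2) =
     l\<^sup>2 - (w j - u j)\<^sup>2 + (t' - t)\<^sup>2" using l2 by (simp add: power2_commute)
  have "u(j := t) \<in> unit_cube k" "w(j := t') \<in> unit_cube k"
    using u t by (auto simp: unit_cube_def)
  from cube_segmentI[OF c(1) this] show "cube_segment X (shift a b t z) (shift a b t' z')
      (sqrt (l\<^sup>2 - (wt (side X a b) z' - wt (side X a b) z)\<^sup>2 + (t' - t)\<^sup>2))"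
    unfolding sh wtz eq .
  show "(wt (side X a b) z' - wt (side X a b) z)\<^sup>2 \<le> l\<^sup>2"
    unfolding wtz using l2 by (simp add: power2_commute sum_nonneg)
qed

text \<open>A string from \<open>q\<close> to \<open>r\<close> all of whose break points have
  \<open>a\<close> and \<open>b\<close> in their support. \<open>L\<close> is its length and
  \<open>H\<close> the length of its projection orthogonal to the edge \<open>{a, b}\<close>,
  accumulated segment by segment.\<close>

inductive hpath :: "'v \<Rightarrow> 'v \<Rightarrow> ('v \<Rightarrow> real) \<Rightarrow> ('v \<Rightarrow> real) \<Rightarrow> real \<Rightarrow> real \<Rightarrow> bool" for a b where
  hpath_refl: "q \<in> R \<Longrightarrow> a \<in> supp q \<Longrightarrow> b \<in> supp q \<Longrightarrow> hpath a b q q 0 0"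
| hpath_step: "hpath a b q r H L \<Longrightarrow> cube_segment X r r' l \<Longrightarrow> a \<in> supp r' \<Longrightarrow> b \<in> supp r' \<Longrightarrow>
    hpath a b q r' (H + sqrt (l\<^sup>2 - (wt (side X a b) r' - wt (side X a b) r)\<^sup>2)) (L + l)"

lemma hpath_ends: "hpath a b q r H L \<Longrightarrow>
    q \<in> R \<and> r \<in> R \<and> a \<in> supp q \<and> b \<in> supp q \<and> a \<in> supp r \<and> b \<in> supp r"
  by (induction rule: hpath.induct) (auto dest: segment_in_R)

lemma hpath_trans:
  assumes "hpath a b q r H L" "hpath a b r s H' L'"
  shows "hpath a b q s (H + H') (L + L')"
  using assms(2,1)
proof (induction rule: hpath.induct)
  case (hpath_step r r' H' L' r'' l)
  then show ?case using hpath.hpath_step[OF hpath_step.IH[OF hpath_step.prems] hpath_step.hyps(2-4)]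
    by (simp add: add.assoc)
qed simp

text \<open>Each segment is a planar vector with components orthogonal to and along the edge; the
  triangle inequality compares the sum of these vectors with the total length
  \<open>L\<close>.\<close>

lemma hpath_length:
  assumes ab: "{a, b} \<in> X" "a \<noteq> b" and "hpath a b q r H L"
  shows "0 \<le> H \<and> sqrt (H\<^sup>2 + (wt (side X a b) r - wt (side X a b) q)\<^sup>2) \<le> L"
  using assms(3)
proof (induction rule: hpath.induct)
  case (hpath_step q r H L r' l)
  let ?f = "wt (side X a b)"
  let ?h = "sqrt (l\<^sup>2 - (?f r' - ?f r)\<^sup>2)"
  have le: "(?f r' - ?f r)\<^sup>2 \<le> l\<^sup>2"
    using segment_shift(2)[OF hpath_step.hyps(2) ab, of 0 0] hpath_ends[OF hpath_step.hyps(1)] hpath_step by simp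
  have "sqrt ((H + ?h)\<^sup>2 + (?f r' - ?f q)\<^sup>2) \<le>
      sqrt (H\<^sup>2 + (?f r - ?f q)\<^sup>2) + sqrt (?h\<^sup>2 + (?f r' - ?f r)\<^sup>2)"
    using sqrt_sum_triangle[of H ?h "?f r - ?f q" "?f r' - ?f r"] by simp
  also have "sqrt (?h\<^sup>2 + (?f r' - ?f r)\<^sup>2) = l"
    using le cube_segment_nonneg[OF hpath_step.hyps(2)] by simp
  finally show ?case using hpath_step le by simp
qed simp

text \<open>A string is made shorter by changing its coordinate in the direction of the edge at constant
  rate; the slack \<open>\<eta>\<close> avoids a case distinction for strings parallel to the edge.\<close>

lemma hpath_straighten:
  assumes ab: "{a, b} \<in> X" "a \<noteq> b" and "hpath a b q r H L"
  shows "\<lbrakk>0 < \<eta>; 0 \<le> t; t \<le> 1; 0 \<le> t'; t' \<le> 1\<rbrakk> \<Longrightarrow>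
    shift a b t q \<in> R \<and> shift a b t' r \<in> R \<and>
    d (shift a b t q) (shift a b t' r) \<le> sqrt ((H + \<eta>)\<^sup>2 + (t' - t)\<^sup>2)"
  using assms(3)
proof (induction arbitrary: \<eta> t' rule: hpath.induct)
  case (hpath_refl q)
  obtain Q k \<phi> u where c: "cube_chart X Q k \<phi>" "u \<in> unit_cube k" "q = cube_point k \<phi> u"
    using realizationE[OF cc hpath_refl.hyps(1)] .
  have "cube_segment X q q 0" using cube_segmentI[OF c(1,2,2)] c(3) by simp
  note seg = segment_shift(1)[OF this ab hpath_refl.hyps(2,3,2,3) hpath_refl.prems(2-5)]
  have "d (shift a b t q) (shift a b t' q) \<le> sqrt ((t' - t)\<^sup>2)"
    using d_le_segment[OF seg] by simp
  also have "\<dots> \<le> sqrt ((0 + \<eta>)\<^sup>2 + (t' - t)\<^sup>2)" by simp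
  finally show ?case using segment_in_R[OF seg] by simp
next
  case (hpath_step q r H L r' l)
  let ?f = "wt (side X a b)"
  let ?h = "sqrt (l\<^sup>2 - (?f r' - ?f r)\<^sup>2)"
  note ends = hpath_ends[OF hpath_step.hyps(1)]
  have le: "(?f r' - ?f r)\<^sup>2 \<le> l\<^sup>2"
    using segment_shift(2)[OF hpath_step.hyps(2) ab, of 0 0] ends hpath_step by simp
  then have h: "0 \<le> ?h" by simp
  have H: "0 \<le> H" using hpath_length[OF ab hpath_step.hyps(1)] by simp
  \<comment> \<open>The fraction of the orthogonal length, slack included, taken up by the part
    before \<open>r\<close>; half of \<open>\<eta>\<close> is given to each of the two parts. The
    new coordinate at \<open>r\<close> is chosen by this fraction.\<close>
  define \<theta> where "\<theta> = (H + \<eta> / 2) / (H + ?h + \<eta>)"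
  have den: "0 < H + ?h + \<eta>" using H h hpath_step.prems(1) by linarith
  have th: "0 \<le> \<theta>" "\<theta> \<le> 1" unfolding \<theta>_def using H h hpath_step.prems(1) den by (auto simp: field_simps)
  define s where "s = t + (t' - t) * \<theta>"
  have s_conv: "s = (1 - \<theta>) * t + \<theta> * t'" by (simp add: s_def algebra_simps)
  have s: "0 \<le> s" "s \<le> 1"
  proof -
    show "0 \<le> s" unfolding s_conv using th hpath_step by simp
    have "(1 - \<theta>) * t + \<theta> * t' \<le> (1 - \<theta>) * 1 + \<theta> * 1"
      using th hpath_step by (intro add_mono mult_left_mono) auto
    then show "s \<le> 1" unfolding s_conv by simp
  qed
  \<comment> \<open>The slope common to both parts: an orthogonal length \<open>x\<close> then costs
    \<open>x * sqrt (1 + \<kappa>\<^sup>2)\<close> in either, so the two lengths add up without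
    loss.\<close>
  define \<kappa> where "\<kappa> = (t' - t) / (H + ?h + \<eta>)"
  have st: "s - t = \<kappa> * (H + \<eta> / 2)" "t' - s = \<kappa> * (?h + \<eta> / 2)" "t' - t = \<kappa> * (H + ?h + \<eta>)"
  proof -
    show "s - t = \<kappa> * (H + \<eta> / 2)" by (simp add: s_def \<theta>_def \<kappa>_def)
    show 3: "t' - t = \<kappa> * (H + ?h + \<eta>)" using den by (simp add: \<kappa>_def)
    have "t' - s = \<kappa> * (H + ?h + \<eta>) - \<kappa> * (H + \<eta> / 2)"
      using 3 \<open>s - t = _\<close> by simp
    then show "t' - s = \<kappa> * (?h + \<eta> / 2)" by (simp add: algebra_simps)
  qed
  have scale: "sqrt (x\<^sup>2 + (\<kappa> * x)\<^sup>2) = x * sqrt (1 + \<kappa>\<^sup>2)" if "0 \<le> x" for x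
  proof -
    have "x\<^sup>2 + (\<kappa> * x)\<^sup>2 = x\<^sup>2 * (1 + \<kappa>\<^sup>2)" by (simp add: power_mult_distrib algebra_simps)
    then show ?thesis using that by (simp add: real_sqrt_mult)
  qed
  have IH: "shift a b t q \<in> R" "shift a b s r \<in> R"
    "d (shift a b t q) (shift a b s r) \<le> sqrt ((H + \<eta> / 2)\<^sup>2 + (s - t)\<^sup>2)"
    using hpath_step.IH[of "\<eta> / 2" s] hpath_step.prems(1-3) s by auto
  note seg = segment_shift(1)[OF hpath_step.hyps(2) ab _ _ hpath_step.hyps(3,4) s hpath_step.prems(4,5)]
  have seg: "cube_segment X (shift a b s r) (shift a b t' r') (sqrt (?h\<^sup>2 + (t' - s)\<^sup>2))"
    using seg ends le by simp
  have "d (shift a b t q) (shift a b t' r') \<le>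
      d (shift a b t q) (shift a b s r) + d (shift a b s r) (shift a b t' r')"
    using d_tri IH segment_in_R[OF seg] by blast
  also have "\<dots> \<le> sqrt ((H + \<eta> / 2)\<^sup>2 + (s - t)\<^sup>2) + sqrt (?h\<^sup>2 + (t' - s)\<^sup>2)"
    using IH d_le_segment[OF seg] by simp
  also have "sqrt (?h\<^sup>2 + (t' - s)\<^sup>2) \<le> sqrt ((?h + \<eta> / 2)\<^sup>2 + (t' - s)\<^sup>2)"
  proof -
    have "?h\<^sup>2 \<le> (?h + \<eta> / 2)\<^sup>2" using h hpath_step.prems(1) by (intro power_mono) auto
    then show ?thesis by (simp only: real_sqrt_le_iff add_le_cancel_right)
  qed
  also have "sqrt ((H + \<eta> / 2)\<^sup>2 + (s - t)\<^sup>2) + sqrt ((?h + \<eta> / 2)\<^sup>2 + (t' - s)\<^sup>2) =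
      (H + \<eta> / 2) * sqrt (1 + \<kappa>\<^sup>2) + (?h + \<eta> / 2) * sqrt (1 + \<kappa>\<^sup>2)"
    unfolding st(1,2) using H h hpath_step.prems(1) scale by simp
  also have "\<dots> = (H + ?h + \<eta>) * sqrt (1 + \<kappa>\<^sup>2)" by (simp add: algebra_simps)
  also have "\<dots> = sqrt ((H + ?h + \<eta>)\<^sup>2 + (t' - t)\<^sup>2)"
    unfolding st(3) using scale[of "H + ?h + \<eta>"] den by simp
  finally show ?case using IH segment_in_R[OF seg] by simp
qed

text \<open>Straightening with the actual coordinates of the end points as boundary values, so that
  \<open>shift\<close> leaves both points fixed.\<close>

lemma hpath_dist:
  assumes ab: "{a, b} \<in> X" "a \<noteq> b" and p: "hpath a b q r H L" and \<eta>: "0 < \<eta>"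
  shows "d q r \<le> sqrt ((H + \<eta>)\<^sup>2 + (wt (side X a b) r - wt (side X a b) q)\<^sup>2)"
proof -
  note ends = hpath_ends[OF p]
  have "0 < wt (side X a b) q" "wt (side X a b) q < 1" "0 < wt (side X a b) r" "wt (side X a b) r < 1"
    using wt_side_strict[OF cc _ ab] ends by auto
  then show ?thesis
    using hpath_straighten[OF ab p \<eta>, of "wt (side X a b) q" "wt (side X a b) r"]
      shift_self[OF _ ab] ends by simp
qed

text \<open>The break points of a string shorter than \<open>d q r + \<eta>\<close> are closer to
  \<open>q\<close> than that, so the whole string stays where \<open>a\<close> and \<open>b\<close>
  are in the support.\<close>

lemma hpath_of_string:
  assumes q: "q \<in> R" and r: "r \<in> R" and \<eta>: "0 < \<eta>"
    and nb: "\<And>z. z \<in> R \<Longrightarrow> d q z < d q r + \<eta> \<Longrightarrow> a \<in> supp z \<and> b \<in> supp z"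
  obtains H L where "hpath a b q r H L" "L < d q r + \<eta>"
proof -
  obtain s where "s \<in> string_lengths X q r" and s: "s < d q r + \<eta>"
    using d_approx[OF q r \<eta>] .
  then obtain m z l where sm: "s = (\<Sum>i<m. l i)" and z: "z 0 = q" "z m = r" "\<And>i. i \<le> m \<Longrightarrow> z i \<in> R"
    and seg: "\<forall>i<m. cube_segment X (z i) (z (Suc i)) (l i)"
    unfolding string_lengths_def by auto
  have lnn: "0 \<le> l i" if "i < m" for i using seg cube_segment_nonneg that by blast
  have "d q (z j) \<le> (\<Sum>i<j. l i) \<and> (\<exists>H. hpath a b q (z j) H (\<Sum>i<j. l i))" if "j \<le> m" for j
    using that
  proof (induction j)
    case 0
    have qq: "d q q = 0" using d_zero q by simp
    then have "a \<in> supp q \<and> b \<in> supp q" using nb[OF q] d_nonneg[of q r] \<eta> by simp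
    then show ?case using hpath_refl[OF q] qq z by auto
  next
    case (Suc j)
    then obtain H where H: "hpath a b q (z j) H (\<Sum>i<j. l i)" "d q (z j) \<le> (\<Sum>i<j. l i)" by auto
    have sg: "cube_segment X (z j) (z (Suc j)) (l j)" using seg Suc by simp
    have "d q (z (Suc j)) \<le> d q (z j) + d (z j) (z (Suc j))"
      using d_tri[OF q] z Suc by simp
    also have "\<dots> \<le> (\<Sum>i<Suc j. l i)" using H d_le_segment[OF sg] by simp
    finally have le: "d q (z (Suc j)) \<le> (\<Sum>i<Suc j. l i)" .
    also have "\<dots> \<le> s" unfolding sm using Suc lnn by (intro sum_mono2) auto
    finally have "a \<in> supp (z (Suc j)) \<and> b \<in> supp (z (Suc j))"
      using nb z Suc s by auto
    then show ?case using hpath_step[OF H(1) sg] le by auto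
  qed
  from this[of m] obtain H where "hpath a b q r H s" using z sm by auto
  then show thesis using that s by blast
qed

text \<open>Almost shortest strings from \<open>q\<close> to \<open>m\<close> and from
  \<open>m\<close> to \<open>r\<close> are joined and straightened. As \<open>d q r\<close> is the
  sum of the two distances, nothing can be gained in the limit, so the planar vectors of the two
  halves are parallel: the coordinate changes at the same rate before and after
  \<open>m\<close>.\<close>

lemma wt_collinear:
  assumes ab: "{a, b} \<in> X" "a \<noteq> b" and pts: "q \<in> R" "m \<in> R" "r \<in> R"
    and col: "d q r = d q m + d m r" and \<epsilon>: "0 < \<epsilon>"
    and nb1: "\<And>z. z \<in> R \<Longrightarrow> d q z < d q m + \<epsilon> \<Longrightarrow> a \<in> supp z \<and> b \<in> supp z"
    and nb2: "\<And>z. z \<in> R \<Longrightarrow> d m z < d m r + \<epsilon> \<Longrightarrow> a \<in> supp z \<and> b \<in> supp z"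
  shows "(wt (side X a b) m - wt (side X a b) q) * d m r = (wt (side X a b) r - wt (side X a b) m) * d q m"
proof -
  let ?f = "wt (side X a b)"
  define x1 x2 B1 B2 where "x1 = d q m" and "x2 = d m r" and "B1 = ?f m - ?f q" and "B2 = ?f r - ?f m"
  \<comment> \<open>Bounds the square of the straightened length when each string has excess below
    \<open>\<eta>\<close>; the orthogonal lengths are estimated by Pythagoras.\<close>
  define F where "F = (\<lambda>\<eta>. (sqrt ((x1 + \<eta>)\<^sup>2 - B1\<^sup>2) + sqrt ((x2 + \<eta>)\<^sup>2 - B2\<^sup>2) + \<eta>)\<^sup>2 + (B1 + B2)\<^sup>2)"
  have key: "(x1 + x2)\<^sup>2 \<le> F \<eta> \<and> \<bar>B1\<bar> \<le> x1 + \<eta> \<and> \<bar>B2\<bar> \<le> x2 + \<eta>" if \<eta>: "0 < \<eta>" "\<eta> < \<epsilon>" for \<eta>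
  proof -
    obtain H1 L1 where 1: "hpath a b q m H1 L1" "L1 < x1 + \<eta>"
      using hpath_of_string[OF pts(1,2) \<eta>(1), of a b] nb1 \<eta>(2) unfolding x1_def by (smt (verit))
    obtain H2 L2 where 2: "hpath a b m r H2 L2" "L2 < x2 + \<eta>"
      using hpath_of_string[OF pts(2,3) \<eta>(1), of a b] nb2 \<eta>(2) unfolding x2_def by (smt (verit))
    have l1: "0 \<le> H1" "sqrt (H1\<^sup>2 + B1\<^sup>2) \<le> x1 + \<eta>"
      using hpath_length[OF ab 1(1)] 1(2) by (auto simp: B1_def)
    have l2: "0 \<le> H2" "sqrt (H2\<^sup>2 + B2\<^sup>2) \<le> x2 + \<eta>"
      using hpath_length[OF ab 2(1)] 2(2) by (auto simp: B2_def)
    have s1: "H1\<^sup>2 + B1\<^sup>2 \<le> (x1 + \<eta>)\<^sup>2" using l1(2) by (rule sqrt_le_D)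
    have s2: "H2\<^sup>2 + B2\<^sup>2 \<le> (x2 + \<eta>)\<^sup>2" using l2(2) by (rule sqrt_le_D)
    have nn: "0 \<le> x1 + \<eta>" "0 \<le> x2 + \<eta>" using d_nonneg \<eta> by (auto simp: x1_def x2_def)
    have b: "\<bar>B1\<bar> \<le> x1 + \<eta>" "\<bar>B2\<bar> \<le> x2 + \<eta>"
    proof -
      have "B1\<^sup>2 \<le> (x1 + \<eta>)\<^sup>2" using s1 by (smt (verit) zero_le_power2)
      then show "\<bar>B1\<bar> \<le> x1 + \<eta>" using nn abs_le_square_iff[of B1 "x1 + \<eta>"] by simp
      have "B2\<^sup>2 \<le> (x2 + \<eta>)\<^sup>2" using s2 by (smt (verit) zero_le_power2)
      then show "\<bar>B2\<bar> \<le> x2 + \<eta>" using nn abs_le_square_iff[of B2 "x2 + \<eta>"] by simp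
    qed
    have H1: "H1 \<le> sqrt ((x1 + \<eta>)\<^sup>2 - B1\<^sup>2)" using s1 l1(1) by (intro real_le_rsqrt) simp
    have H2: "H2 \<le> sqrt ((x2 + \<eta>)\<^sup>2 - B2\<^sup>2)" using s2 l2(1) by (intro real_le_rsqrt) simp
    have "x1 + x2 = d q r" using col by (simp add: x1_def x2_def)
    also have "\<dots> \<le> sqrt ((H1 + H2 + \<eta>)\<^sup>2 + (?f r - ?f q)\<^sup>2)"
      by (rule hpath_dist[OF ab hpath_trans[OF 1(1) 2(1)] \<eta>(1)])
    finally have "(x1 + x2)\<^sup>2 \<le> (sqrt ((H1 + H2 + \<eta>)\<^sup>2 + (?f r - ?f q)\<^sup>2))\<^sup>2"
      using d_nonneg by (intro power_mono) (auto simp: x1_def x2_def)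
    also have "\<dots> = (H1 + H2 + \<eta>)\<^sup>2 + (B1 + B2)\<^sup>2" by (simp add: B1_def B2_def)
    also have "\<dots> \<le> F \<eta>" unfolding F_def
      using H1 H2 l1 l2 \<eta> by (intro add_mono power_mono order_refl) auto
    finally show ?thesis using b by simp
  qed
  \<comment> \<open>The estimates hold for small positive \<open>\<eta>\<close> and pass to the
    limit at 0 because \<open>F\<close> is continuous, also where a square root vanishes.\<close>
  have ev: "eventually (\<lambda>\<eta>. 0 < \<eta> \<and> \<eta> < \<epsilon>) (at_right 0)"
    using eventually_at_right[of 0 \<epsilon> "\<lambda>\<eta>. 0 < \<eta> \<and> \<eta> < \<epsilon>"] \<epsilon> by auto
  have F: "(F \<longlongrightarrow> F 0) (at_right 0)"
    unfolding F_def by (intro tendsto_intros)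
  have 1: "(x1 + x2)\<^sup>2 \<le> F 0"
    by (rule tendsto_lowerbound[OF F]) (use ev key in \<open>auto elim: eventually_mono\<close>)
  have "((\<lambda>\<eta>. x1 + \<eta>) \<longlongrightarrow> x1 + 0) (at_right 0)" by (intro tendsto_intros)
  then have b1: "\<bar>B1\<bar> \<le> x1 + 0"
    by (rule tendsto_lowerbound) (use ev key in \<open>auto elim: eventually_mono\<close>)
  have "((\<lambda>\<eta>. x2 + \<eta>) \<longlongrightarrow> x2 + 0) (at_right 0)" by (intro tendsto_intros)
  then have b2: "\<bar>B2\<bar> \<le> x2 + 0"
    by (rule tendsto_lowerbound) (use ev key in \<open>auto elim: eventually_mono\<close>)
  have x: "0 \<le> x1" "0 \<le> x2" using d_nonneg by (auto simp: x1_def x2_def)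
  have sq: "B1\<^sup>2 \<le> x1\<^sup>2" "B2\<^sup>2 \<le> x2\<^sup>2"
    using b1 b2 x by (auto intro: abs_le_square_iff[THEN iffD1])
  have "B1 * x2 = B2 * x1"
    by (rule parallel_vectors[of "sqrt (x1\<^sup>2 - B1\<^sup>2)" _ _ "sqrt (x2\<^sup>2 - B2\<^sup>2)"])
      (use sq x 1 in \<open>simp_all add: F_def\<close>)
  then show ?thesis by (simp add: x1_def x2_def B1_def B2_def)
qed

end

section \<open>Geodesic rays towards a vertex\<close>

text \<open>The definition of \<open>cat0_space\<close> speaks about all comparison triangles; one
  with the prescribed sides has to be exhibited before it says anything.\<close>

lemma comparison_triangle:
  fixes L L' D :: real
  assumes "0 \<le> L" "0 \<le> L'" "\<bar>L - L'\<bar> \<le> D" "D \<le> L + L'"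
  shows "\<exists>y z :: real^2. norm y = L \<and> norm z = L' \<and> dist y z = D"
proof (cases "L = 0")
  case True
  then have D: "D = L'" using assms by simp
  have "norm (vector [L', 0] :: real^2) = L'"
    using assms by (simp add: norm_vec_def L2_set_def UNIV_2)
  then show ?thesis using True D
    by (intro exI[of _ 0] exI[of _ "vector [L', 0]"]) simp
next
  case False
  then have L: "0 < L" using assms by simp
  \<comment> \<open>Law of cosines: the first coordinate of the third vertex when the side of length
    \<open>L\<close> lies on the first axis.\<close>
  define c where "c = (L\<^sup>2 + L'\<^sup>2 - D\<^sup>2) / (2 * L)"
  have cL: "2 * L * c = L\<^sup>2 + L'\<^sup>2 - D\<^sup>2" using L by (simp add: c_def)
  have D0: "0 \<le> D" using assms by simp
  have "(L - L')\<^sup>2 \<le> D\<^sup>2" using assms(3) D0 abs_le_square_iff[of "L - L'" D] by simp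
  then have 1: "2 * L * c \<le> 2 * L * L'" unfolding cL by (simp add: power2_eq_square algebra_simps)
  have "D\<^sup>2 \<le> (L + L')\<^sup>2" using assms D0 by (intro power_mono) auto
  then have 2: "2 * L * (- L') \<le> 2 * L * c" unfolding cL by (simp add: power2_eq_square algebra_simps)
  have "c \<le> L'" "- L' \<le> c"
    using mult_left_le_imp_le[OF 1] mult_left_le_imp_le[OF 2] L by auto
  then have "\<bar>c\<bar> \<le> \<bar>L'\<bar>" by linarith
  then have c: "c\<^sup>2 \<le> L'\<^sup>2" using abs_le_square_iff[of c L'] by simp
  define z :: "real^2" where "z = vector [c, sqrt (L'\<^sup>2 - c\<^sup>2)]"
  define y :: "real^2" where "y = vector [L, 0]"
  have "norm y = L" using L by (simp add: y_def norm_vec_def L2_set_def UNIV_2)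
  moreover have "norm z = L'" using c assms(2) by (simp add: z_def norm_vec_def L2_set_def UNIV_2)
  moreover have "dist y z = D"
  proof -
    have "(L - c)\<^sup>2 + (L'\<^sup>2 - c\<^sup>2) = D\<^sup>2" using cL by (simp add: power2_eq_square algebra_simps)
    then show ?thesis
      using c D0 by (simp add: z_def y_def dist_vec_def L2_set_def UNIV_2 dist_real_def)
  qed
  ultimately show ?thesis by blast
qed

lemma affine_extend:
  fixes g :: "real \<Rightarrow> real"
  assumes aff: "\<And>\<tau>. s \<le> \<tau> \<Longrightarrow> \<tau> \<le> e \<Longrightarrow> g \<tau> = g s + \<kappa>' * (\<tau> - s)"
    and se: "s < e" and t: "s \<le> t" "t \<le> e" and \<delta>: "0 < \<delta>"
    and near: "\<And>\<tau>. s \<le> \<tau> \<Longrightarrow> \<tau> \<le> e \<Longrightarrow> \<bar>\<tau> - t\<bar> < \<delta> \<Longrightarrow> g \<tau> = c + \<kappa> * \<tau>"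
    and \<tau>: "s \<le> \<tau>" "\<tau> \<le> e"
  shows "g \<tau> = c + \<kappa> * \<tau>"
proof -
  \<comment> \<open>A nonzero step from \<open>t\<close> into the half of the interval where there
    is room, short enough for \<open>near\<close>; two points determine an affine function.\<close>
  define h where "h = (if t \<le> (s + e) / 2 then min (\<delta> / 2) ((e - s) / 2) else - min (\<delta> / 2) ((e - s) / 2))"
  have h: "h \<noteq> 0" "s \<le> t + h" "t + h \<le> e" "\<bar>h\<bar> < \<delta>"
    using se t \<delta> by (auto simp: h_def min_def field_simps)
  have 1: "g s + \<kappa>' * (t - s) = c + \<kappa> * t" using aff[OF t] near[OF t] \<delta> by simp
  have 2: "g s + \<kappa>' * (t + h - s) = c + \<kappa> * (t + h)"
    using aff[OF h(2,3)] near[OF h(2,3)] h(4) by simp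
  have "\<kappa>' * h = (g s + \<kappa>' * (t + h - s)) - (g s + \<kappa>' * (t - s))"
    by (simp add: algebra_simps)
  also have "\<dots> = \<kappa> * h" unfolding 1 2 by (simp add: algebra_simps)
  finally have "\<kappa>' * h = \<kappa> * h" .
  then have "\<kappa>' = \<kappa>" using h(1) by simp
  then show ?thesis using aff[OF \<tau>] 1 by (simp add: algebra_simps)
qed

lemma affine_between:
  fixes c \<kappa> :: real
  assumes "0 \<le> t" "t \<le> L" "m \<le> c" "m \<le> c + \<kappa> * L"
  shows "m \<le> c + \<kappa> * t"
proof (cases "0 \<le> \<kappa>")
  case True
  then show ?thesis using assms(3) mult_nonneg_nonneg[OF True assms(1)] by linarith
next
  case False
  then have "\<kappa> * L \<le> \<kappa> * t" using assms by (intro mult_left_mono_neg) auto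
  then show ?thesis using assms by simp
qed

section \<open>Geodesics to a fixed point and their dependence on the start\<close>

context cat0_complex
begin

definition geo :: "('v \<Rightarrow> real) \<Rightarrow> ('v \<Rightarrow> real) \<Rightarrow> real \<Rightarrow> 'v \<Rightarrow> real" where
  "geo y b = (SOME \<gamma>. geodesic_from_to R d \<gamma> y b)"

lemma geo: "y \<in> R \<Longrightarrow> b \<in> R \<Longrightarrow> geodesic_from_to R d (geo y b) y b"
  unfolding geo_def using cat0 unfolding cat0_space_def by (metis someI_ex)

text \<open>Geodesics are chosen from \<open>y\<close> outwards so that any two share a vertex of a
  comparison triangle; \<open>ray\<close> reverses the parameter and starts at
  \<open>b\<close>.\<close>

definition ray :: "('v \<Rightarrow> real) \<Rightarrow> ('v \<Rightarrow> real) \<Rightarrow> real \<Rightarrow> 'v \<Rightarrow> real" where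
  "ray y b t = geo y b (d b y - t)"

lemma ray_0: "y \<in> R \<Longrightarrow> b \<in> R \<Longrightarrow> ray y b 0 = b"
  using geo[of y b] d_sym[of b y] by (simp add: geodesic_from_to_def ray_def)

lemma ray_end: "y \<in> R \<Longrightarrow> b \<in> R \<Longrightarrow> ray y b (d b y) = y"
  using geo[of y b] by (simp add: geodesic_from_to_def ray_def)

lemma ray_in_R: "y \<in> R \<Longrightarrow> b \<in> R \<Longrightarrow> 0 \<le> t \<Longrightarrow> t \<le> d b y \<Longrightarrow> ray y b t \<in> R"
  using geo[of y b] d_sym[of b y] by (auto simp: geodesic_from_to_def ray_def)

lemma ray_dist:
  assumes "y \<in> R" "b \<in> R" "0 \<le> s" "s \<le> d b y" "0 \<le> t" "t \<le> d b y"
  shows "d (ray y b s) (ray y b t) = \<bar>s - t\<bar>"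
proof -
  have "d (geo y b (d b y - s)) (geo y b (d b y - t)) = \<bar>(d b y - s) - (d b y - t)\<bar>"
    using geo[OF assms(1,2)] assms(3-6) d_sym[of b y] unfolding geodesic_from_to_def by simp
  then show ?thesis by (simp add: ray_def abs_minus_commute)
qed

text \<open>In the comparison triangle with apex 0 the points at proportion \<open>\<theta>\<close>
  are scalar multiples of the other two vertices, so their distance is \<open>\<theta>\<close> times
  the opposite side.\<close>

lemma geo_convex:
  assumes y: "y \<in> R" and b: "b \<in> R" "b' \<in> R" and \<theta>: "0 \<le> \<theta>" "\<theta> \<le> 1"
  shows "d (geo y b (\<theta> * d y b)) (geo y b' (\<theta> * d y b')) \<le> \<theta> * d b b'"
proof -
  have tri: "\<bar>d y b - d y b'\<bar> \<le> d b b'" "d b b' \<le> d y b + d y b'"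
    using d_tri[OF y b(1,2)] d_tri[OF y b(2,1)] d_tri[OF b(1) y b(2)] d_sym by (auto simp: d_sym)
  obtain B B' :: "real^2" where B: "norm B = d y b" "norm B' = d y b'" "dist B B' = d b b'"
    using comparison_triangle[OF d_nonneg d_nonneg tri] by auto
  have comp: "\<forall>x'\<in>R. \<forall>y'\<in>R. \<forall>z'\<in>R. \<forall>\<gamma> \<delta>.
        geodesic_from_to R d \<gamma> x' y' \<longrightarrow> geodesic_from_to R d \<delta> x' z' \<longrightarrow>
        (\<forall>xe ye ze :: real^2.
           dist xe ye = d x' y' \<longrightarrow> dist xe ze = d x' z' \<longrightarrow> dist ye ze = d y' z' \<longrightarrow>
           (\<forall>s\<in>{0..d x' y'}. \<forall>t\<in>{0..d x' z'}.
            \<forall>P\<in>closed_segment xe ye. \<forall>Q\<in>closed_segment xe ze.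
              dist xe P = s \<longrightarrow> dist xe Q = t \<longrightarrow> d (\<gamma> s) (\<delta> t) \<le> dist P Q))"
    using cat0 unfolding cat0_space_def by (elim conjE)
  have "d (geo y b (\<theta> * d y b)) (geo y b' (\<theta> * d y b')) \<le> dist (\<theta> *\<^sub>R B) (\<theta> *\<^sub>R B')"
  proof (rule comp[rule_format, OF y b geo[OF y b(1)] geo[OF y b(2)]])
    show "dist (0 :: real^2) B = d y b" "dist (0 :: real^2) B' = d y b'" "dist B B' = d b b'"
      using B by auto
    show "\<theta> * d y b \<in> {0..d y b}" "\<theta> * d y b' \<in> {0..d y b'}"
      using \<theta> d_nonneg by (auto simp: mult_left_le_one_le)
    show "\<theta> *\<^sub>R B \<in> closed_segment 0 B" "\<theta> *\<^sub>R B' \<in> closed_segment 0 B'"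
      using \<theta> by (auto simp: closed_segment_def)
    show "dist 0 (\<theta> *\<^sub>R B) = \<theta> * d y b" "dist 0 (\<theta> *\<^sub>R B') = \<theta> * d y b'"
      using \<theta> B by auto
  qed
  also have "\<dots> = \<theta> * d b b'"
    using \<theta> B(3) by (simp add: dist_norm flip: scaleR_diff_right)
  finally show ?thesis .
qed

text \<open>Equal times instead of equal proportions: \<open>geo_convex\<close> costs one
  \<open>d b b'\<close>, and the difference of the two lengths costs another.\<close>

lemma ray_close:
  assumes y: "y \<in> R" and b: "b \<in> R" "b' \<in> R" and t: "0 \<le> t" "t \<le> d b y" "t \<le> d b' y"
  shows "d (ray y b t) (ray y b' t) \<le> 2 * d b b'"
proof -
  have *: "d (ray y b t) (ray y b' t) \<le> 2 * d b b'"
    if b: "b \<in> R" "b' \<in> R" and t: "0 \<le> t" "t \<le> d b' y" and le: "d b' y \<le> d b y" for b b'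
  proof (cases "d b y = 0")
    case True
    then have "t = 0" using t le by simp
    then show ?thesis using ray_0[OF y] b d_nonneg[of b b'] by simp
  next
    case False
    \<comment> \<open>\<open>\<theta>\<close> is the proportion remaining at time \<open>t\<close>
      on the longer geodesic; on the shorter one that proportion is reached at time
      \<open>(1 - \<theta>) * L'\<close>.\<close>
    define L L' \<theta> where "L = d b y" and "L' = d b' y" and "\<theta> = 1 - t / L"
    have L: "0 < L" "L' \<le> L" "t \<le> L'" using False d_nonneg[of b y] le t by (auto simp: L_def L'_def)
    have \<theta>: "0 \<le> \<theta>" "\<theta> \<le> 1" using L t by (auto simp: \<theta>_def)
    have 1: "ray y b t = geo y b (\<theta> * d y b)"
      using L by (simp add: ray_def \<theta>_def d_sym[of y b] L_def algebra_simps)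
    have s: "0 \<le> (1 - \<theta>) * L'" "(1 - \<theta>) * L' \<le> L'"
      using \<theta> L t by (auto simp: mult_left_le_one_le)
    have 2: "ray y b' ((1 - \<theta>) * L') = geo y b' (\<theta> * d y b')"
      by (simp add: ray_def d_sym[of y b'] L'_def algebra_simps)
    have "d (ray y b' ((1 - \<theta>) * L')) (ray y b' t) = \<bar>(1 - \<theta>) * L' - t\<bar>"
      by (rule ray_dist[OF y b(2)]) (use s t in \<open>auto simp: L'_def\<close>)
    also have "\<dots> = (t / L) * (L - L')"
    proof -
      have "(1 - \<theta>) * L' - t = - ((t / L) * (L - L'))"
        using L by (simp add: \<theta>_def field_simps)
      moreover have "0 \<le> (t / L) * (L - L')" using L t by simp
      ultimately show ?thesis by linarith
    qed
    also have "\<dots> \<le> L - L'" using L t by (intro mult_left_le_one_le) auto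
    also have "\<dots> \<le> d b b'" using d_tri[OF b(1,2) y] by (simp add: L_def L'_def)
    finally have A: "d (ray y b' ((1 - \<theta>) * L')) (ray y b' t) \<le> d b b'" .
    have B: "d (ray y b t) (ray y b' ((1 - \<theta>) * L')) \<le> \<theta> * d b b'"
      unfolding 1 2 by (rule geo_convex[OF y b \<theta>])
    have "\<theta> * d b b' \<le> d b b'" using \<theta> d_nonneg[of b b'] by (simp add: mult_left_le_one_le)
    then show ?thesis
      using A B d_tri[of "ray y b t" "ray y b' ((1 - \<theta>) * L')" "ray y b' t"]
        ray_in_R[OF y] b s t le by (simp add: L'_def)
  qed
  show ?thesis
  proof (cases "d b' y \<le> d b y")
    case True then show ?thesis using *[OF b t(1,3)] by simp
  next
    case False then show ?thesis using *[OF b(2,1) t(1,2)] d_sym by simp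
  qed
qed

text \<open>A ball around \<open>p\<close> in which the directions of the carrier of
  \<open>p\<close> survive and their coordinates are affine along geodesics. Affinity is expressed
  by triples of collinear points, so that no geodesic has to be named.\<close>

definition good_radius :: "('v \<Rightarrow> real) \<Rightarrow> real \<Rightarrow> bool" where
  "good_radius p \<epsilon> \<longleftrightarrow> 0 < \<epsilon> \<and> (\<forall>q\<in>R. d p q < \<epsilon> \<longrightarrow> supp p \<subseteq> supp q) \<and>
     (\<forall>a b q m r. {a, b} \<in> X \<longrightarrow> a \<noteq> b \<longrightarrow> a \<in> supp p \<longrightarrow> b \<in> supp p \<longrightarrow> q \<in> R \<longrightarrow> m \<in> R \<longrightarrow> r \<in> R \<longrightarrow>
       d p q < \<epsilon> \<longrightarrow> d p m < \<epsilon> \<longrightarrow> d p r < \<epsilon> \<longrightarrow> d q r = d q m + d m r \<longrightarrow>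
       (wt (side X a b) m - wt (side X a b) q) * d m r = (wt (side X a b) r - wt (side X a b) m) * d q m)"

lemma good_radius_collinear:
  assumes "good_radius p \<epsilon>" "{a, b} \<in> X" "a \<noteq> b" "a \<in> supp p" "b \<in> supp p"
    "q \<in> R" "m \<in> R" "r \<in> R" "d p q < \<epsilon>" "d p m < \<epsilon>" "d p r < \<epsilon>" "d q r = d q m + d m r"
  shows "(wt (side X a b) m - wt (side X a b) q) * d m r = (wt (side X a b) r - wt (side X a b) m) * d q m"
  using assms(1)[unfolded good_radius_def, THEN conjunct2, THEN conjunct2] assms(2-) by blast

lemma good_radius_exists:
  assumes p: "p \<in> R" obtains \<epsilon> where "good_radius p \<epsilon>"
proof -
  obtain \<epsilon> where \<epsilon>: "0 < \<epsilon>" "\<And>q. q \<in> R \<Longrightarrow> d p q < \<epsilon> \<Longrightarrow> supp p \<subseteq> supp q"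
    by (rule supp_nbhd[OF p]) blast
  \<comment> \<open>A string that starts at \<open>x\<close> in the smaller ball and is shorter than
    \<open>d x x' + \<epsilon> / 4\<close> stays within
    \<open>\<epsilon> / 4 + \<epsilon> / 2 + \<epsilon> / 4\<close> of \<open>p\<close>.\<close>
  have "good_radius p (\<epsilon> / 4)"
    unfolding good_radius_def
  proof (intro conjI ballI allI impI)
    show "0 < \<epsilon> / 4" using \<epsilon> by simp
    show "supp p \<subseteq> supp q" if "q \<in> R" "d p q < \<epsilon> / 4" for q
      using \<epsilon> that d_nonneg[of p q] by simp
    fix a b q m r
    assume ab: "{a, b} \<in> X" "a \<noteq> b" "a \<in> supp p" "b \<in> supp p" and pts: "q \<in> R" "m \<in> R" "r \<in> R"
      and near: "d p q < \<epsilon> / 4" "d p m < \<epsilon> / 4" "d p r < \<epsilon> / 4" and col: "d q r = d q m + d m r"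
    have nb: "a \<in> supp z \<and> b \<in> supp z"
      if z: "z \<in> R" "d x z < d x x' + \<epsilon> / 4" and x: "x \<in> R" "x' \<in> R" "d p x < \<epsilon> / 4" "d p x' < \<epsilon> / 4" for z x x'
    proof -
      have "d p z \<le> d p x + d x z" "d x x' \<le> d x p + d p x'" using d_tri p z x by auto
      then have "d p z < \<epsilon>" using z x d_sym[of x p] by simp
      then show ?thesis using \<epsilon>(2)[OF z(1)] ab by blast
    qed
    show "(wt (side X a b) m - wt (side X a b) q) * d m r = (wt (side X a b) r - wt (side X a b) m) * d q m"
      by (rule wt_collinear[OF ab(1,2) pts col, of "\<epsilon> / 4"]) (use \<epsilon> nb pts near in auto)
  qed
  then show thesis by (rule that)
qed

lemma good_radius_pos: "good_radius p \<epsilon> \<Longrightarrow> 0 < \<epsilon>"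
  by (simp add: good_radius_def)

lemma good_radius_supp: "good_radius p \<epsilon> \<Longrightarrow> q \<in> R \<Longrightarrow> d p q < \<epsilon> \<Longrightarrow> supp p \<subseteq> supp q"
  by (simp add: good_radius_def)

lemma ray_affine:
  assumes y: "y \<in> R" and b: "b \<in> R" and p: "good_radius p \<epsilon>"
    and uv: "{u, v} \<in> X" "u \<noteq> v" "u \<in> supp p" "v \<in> supp p"
    and se: "0 \<le> s" "s \<le> e" "e \<le> d b y"
    and near: "\<And>t. s \<le> t \<Longrightarrow> t \<le> e \<Longrightarrow> d p (ray y b t) < \<epsilon>"
  obtains \<kappa> where "\<And>t. s \<le> t \<Longrightarrow> t \<le> e \<Longrightarrow>
    wt (side X u v) (ray y b t) = wt (side X u v) (ray y b s) + \<kappa> * (t - s)"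
proof -
  define g where "g t = wt (side X u v) (ray y b t)" for t
  have aff: "(g t - g s) * (e - t) = (g e - g t) * (t - s)" if t: "s \<le> t" "t \<le> e" for t
  proof -
    let ?q = "ray y b s" and ?m = "ray y b t" and ?r = "ray y b e"
    have pts: "?q \<in> R" "?m \<in> R" "?r \<in> R" using ray_in_R[OF y b] se t by auto
    have ds: "d ?q ?r = e - s" "d ?q ?m = t - s" "d ?m ?r = e - t"
      using ray_dist[OF y b] se t by auto
    have "d p ?q < \<epsilon>" "d p ?m < \<epsilon>" "d p ?r < \<epsilon>" using near se t by auto
    then have "(g t - g s) * d ?m ?r = (g e - g t) * d ?q ?m"
      unfolding g_def by (intro good_radius_collinear[OF p uv pts]) (simp_all add: ds)
    then show ?thesis unfolding ds .
  qed
  have "g t = g s + (g e - g s) / (e - s) * (t - s)" if t: "s \<le> t" "t \<le> e" for t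
  proof (cases "s = e")
    case True then show ?thesis using t by simp
  next
    case False
    then show ?thesis using aff[OF t] se by (simp add: field_simps)
  qed
  then show thesis using that unfolding g_def by blast
qed

text \<open>The affine function \<open>c + \<kappa> * \<tau>\<close> is fixed for the whole
  geodesic, while the edge \<open>{u, v}\<close> that represents the direction may change with the
  time \<open>t\<close>.\<close>

definition tracks :: "('v \<Rightarrow> real) \<Rightarrow> ('v \<Rightarrow> real) \<Rightarrow> real \<Rightarrow> real \<Rightarrow> 'v \<Rightarrow> 'v \<Rightarrow> real \<Rightarrow> bool" where
  "tracks y b c \<kappa> u v t \<longleftrightarrow> {u, v} \<in> X \<and> u \<noteq> v \<and> u \<in> supp (ray y b t) \<and> v \<in> supp (ray y b t) \<and>
     (\<exists>\<delta>>0. \<forall>\<tau>. 0 \<le> \<tau> \<longrightarrow> \<tau> \<le> d b y \<longrightarrow> \<bar>\<tau> - t\<bar> < \<delta> \<longrightarrow> wt (side X u v) (ray y b \<tau>) = c + \<kappa> * \<tau>)"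

lemma tracks_at: "tracks y b c \<kappa> u v t \<Longrightarrow> 0 \<le> t \<Longrightarrow> t \<le> d b y \<Longrightarrow>
    wt (side X u v) (ray y b t) = c + \<kappa> * t"
  unfolding tracks_def by auto

text \<open>On the window of radius \<open>\<epsilon> / 2\<close> around \<open>t1\<close> the
  coordinate is affine by the choice of \<open>\<epsilon>\<close>; it agrees with
  \<open>c + \<kappa> * \<tau>\<close> near one point of the window, hence throughout.\<close>

lemma tracks_extend:
  assumes y: "y \<in> R" and b: "b \<in> R" and L: "0 < d b y"
    and t1: "0 \<le> t1" "t1 \<le> d b y" and \<epsilon>: "good_radius (ray y b t1) \<epsilon>"
    and uv: "{u, v} \<in> X" "u \<noteq> v" "u \<in> supp (ray y b t1)" "v \<in> supp (ray y b t1)"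
    and t: "0 \<le> t" "t \<le> d b y" "\<bar>t - t1\<bar> < \<epsilon> / 2" and \<delta>: "0 < \<delta>"
    and eq: "\<And>\<tau>. 0 \<le> \<tau> \<Longrightarrow> \<tau> \<le> d b y \<Longrightarrow> \<bar>\<tau> - t\<bar> < \<delta> \<Longrightarrow> wt (side X u v) (ray y b \<tau>) = c + \<kappa> * \<tau>"
    and t': "0 \<le> t'" "t' \<le> d b y" "\<bar>t' - t1\<bar> < \<epsilon> / 2"
  shows "tracks y b c \<kappa> u v t'"
proof -
  define s e where "s = max 0 (t1 - \<epsilon> / 2)" and "e = min (d b y) (t1 + \<epsilon> / 2)"
  have \<epsilon>0: "0 < \<epsilon>" using good_radius_pos[OF \<epsilon>] .
  have se: "0 \<le> s" "s < e" "e \<le> d b y" using t1 \<epsilon>0 L by (auto simp: s_def e_def)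
  have near: "d (ray y b t1) (ray y b \<tau>) < \<epsilon>" if "s \<le> \<tau>" "\<tau> \<le> e" for \<tau>
    using ray_dist[OF y b t1, of \<tau>] that se \<epsilon>0 by (auto simp: s_def e_def abs_if)
  obtain \<kappa>' where \<kappa>': "\<And>\<tau>. s \<le> \<tau> \<Longrightarrow> \<tau> \<le> e \<Longrightarrow>
    wt (side X u v) (ray y b \<tau>) = wt (side X u v) (ray y b s) + \<kappa>' * (\<tau> - s)"
    by (rule ray_affine[OF y b \<epsilon> uv se(1) less_imp_le[OF se(2)] se(3) near]) blast+
  have all: "wt (side X u v) (ray y b \<tau>) = c + \<kappa> * \<tau>" if \<tau>: "s \<le> \<tau>" "\<tau> \<le> e" for \<tau>
  proof (rule affine_extend[where g = "\<lambda>\<tau>. wt (side X u v) (ray y b \<tau>)", OF \<kappa>' se(2) _ _ \<delta> eq \<tau>])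
    have "t1 - \<epsilon> / 2 \<le> t" "t \<le> t1 + \<epsilon> / 2" using t(3) by linarith+
    then show "s \<le> t" "t \<le> e" using t by (auto simp: s_def e_def)
  qed (use se in auto)
  have "t1 - \<epsilon> / 2 \<le> t'" "t' \<le> t1 + \<epsilon> / 2" using t'(3) by linarith+
  then have "d (ray y b t1) (ray y b t') < \<epsilon>" using near[of t'] t' by (simp add: s_def e_def)
  then have "supp (ray y b t1) \<subseteq> supp (ray y b t')"
    using good_radius_supp[OF \<epsilon>] ray_in_R[OF y b t'(1,2)] by simp
  moreover have "\<exists>\<delta>>0. \<forall>\<tau>. 0 \<le> \<tau> \<longrightarrow> \<tau> \<le> d b y \<longrightarrow> \<bar>\<tau> - t'\<bar> < \<delta> \<longrightarrow>
      wt (side X u v) (ray y b \<tau>) = c + \<kappa> * \<tau>"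
  proof (intro exI[of _ "\<epsilon> / 2 - \<bar>t' - t1\<bar>"] conjI allI impI)
    show "0 < \<epsilon> / 2 - \<bar>t' - t1\<bar>" using t' by simp
    fix \<tau> assume \<tau>: "0 \<le> \<tau>" "\<tau> \<le> d b y" "\<bar>\<tau> - t'\<bar> < \<epsilon> / 2 - \<bar>t' - t1\<bar>"
    then have "t1 - \<epsilon> / 2 \<le> \<tau>" "\<tau> \<le> t1 + \<epsilon> / 2" by linarith+
    then show "wt (side X u v) (ray y b \<tau>) = c + \<kappa> * \<tau>"
      using \<tau> by (intro all) (auto simp: s_def e_def)
  qed
  ultimately show ?thesis using uv unfolding tracks_def by blast
qed

text \<open>Follow the direction of the edge along the geodesic: as long as the coordinate stays away from 0
  and 1, it survives in the supports of the points of the geodesic. At the vertex \<open>y\<close> no direction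
  is left.\<close>

lemma coordinate_exits:
  assumes y: "y \<in> vertices X" and b: "b \<in> R" and L: "0 < d b (vertex_point y)"
    and start: "tracks (vertex_point y) b c \<kappa> u0 v0 0"
  shows "\<not> (0 < c + \<kappa> * d b (vertex_point y) \<and> c + \<kappa> * d b (vertex_point y) < 1)"
proof
  let ?y = "vertex_point y"
  let ?L = "d b ?y"
  let ?r = "ray ?y b"
  assume end01: "0 < c + \<kappa> * ?L \<and> c + \<kappa> * ?L < 1"
  have yR: "?y \<in> R" by (rule vertex_point_realization[OF cc y])
  have c: "0 < c" "c < 1"
  proof -
    have "wt (side X u0 v0) b = c"
      using tracks_at[OF start] L ray_0[OF yR b] by simp
    moreover have "{u0, v0} \<in> X" "u0 \<noteq> v0" "u0 \<in> supp b" "v0 \<in> supp b"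
      using start ray_0[OF yR b] by (auto simp: tracks_def)
    ultimately show "0 < c" "c < 1" using wt_side_strict[OF cc b] by auto
  qed
  \<comment> \<open>The margin: on an interval an affine function stays at least as far from 0 and 1
    as its two end values.\<close>
  define m where "m = min (min c (1 - c)) (min (c + \<kappa> * ?L) (1 - (c + \<kappa> * ?L)))"
  have m0: "0 < m" using c end01 by (simp add: m_def)
  have m: "m \<le> c + \<kappa> * t" "c + \<kappa> * t \<le> 1 - m" if "0 \<le> t" "t \<le> ?L" for t
  proof -
    show "m \<le> c + \<kappa> * t" by (rule affine_between[OF that]) (auto simp: m_def)
    have "m \<le> (1 - c) + (- \<kappa>) * t" by (rule affine_between[OF that]) (auto simp: m_def)
    then show "c + \<kappa> * t \<le> 1 - m" by simp
  qed
  have "\<exists>u v. tracks ?y b c \<kappa> u v ?L"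
  \<comment> \<open>Connectedness of the interval: it suffices that near each \<open>t1\<close> the
    property passes between any two times.\<close>
  proof (rule connected_induction_simple[of "{0..?L}" 0 ?L "\<lambda>t. \<exists>u v. tracks ?y b c \<kappa> u v t"])
    show "\<exists>u v. tracks ?y b c \<kappa> u v 0" using start by blast
    fix t1 assume t1: "t1 \<in> {0..?L}"
    have t1': "0 \<le> t1" "t1 \<le> ?L" using t1 by auto
    have pR: "?r t1 \<in> R" using ray_in_R[OF yR b t1'] .
    obtain \<epsilon> where \<epsilon>: "good_radius (?r t1) \<epsilon>" using good_radius_exists[OF pR] .
    \<comment> \<open>The second bound keeps the coordinate at \<open>t1\<close> within
      \<open>m\<close> of \<open>c + \<kappa> * t\<close>, hence strictly between 0 and 1.\<close>
    define \<delta> where "\<delta> = min (\<epsilon> / 2) (m / (lip + 1))"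
    have \<delta>: "0 < \<delta>" using good_radius_pos[OF \<epsilon>] m0 lip_nonneg by (simp add: \<delta>_def)
    have step: "\<exists>u v. tracks ?y b c \<kappa> u v t'"
      if t: "t \<in> {0..?L}" "\<bar>t - t1\<bar> < \<delta>" and t': "t' \<in> {0..?L}" "\<bar>t' - t1\<bar> < \<delta>"
        and tr: "tracks ?y b c \<kappa> u v t" for t t' u v
    proof -
      have tL: "0 \<le> t" "t \<le> ?L" using t by auto
      have tR: "?r t \<in> R" using ray_in_R[OF yR b tL] .
      have dist: "d (?r t1) (?r t) = \<bar>t - t1\<bar>"
        using ray_dist[OF yR b t1' tL] by (simp add: abs_minus_commute)
      have uv: "{u, v} \<in> X" "u \<noteq> v" "u \<in> supp (?r t)" "v \<in> supp (?r t)"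
        using tr by (auto simp: tracks_def)
      have sub: "supp (?r t1) \<subseteq> supp (?r t)"
        using good_radius_supp[OF \<epsilon> tR] dist t(2) good_radius_pos[OF \<epsilon>] by (simp add: \<delta>_def)
      have "\<bar>wt (side X u v) (?r t1) - wt (side X u v) (?r t)\<bar> \<le> lip * \<bar>t - t1\<bar>"
        using wt_lipschitz[OF pR tR] dist by simp
      also have "\<dots> < m"
      proof -
        have "lip * \<bar>t - t1\<bar> \<le> (lip + 1) * \<bar>t - t1\<bar>" by (simp add: algebra_simps)
        also have "\<dots> < m"
          using t(2) lip_nonneg by (simp add: \<delta>_def pos_less_divide_eq mult.commute)
        finally show ?thesis .
      qed
      finally have "\<bar>wt (side X u v) (?r t1) - (c + \<kappa> * t)\<bar> < m" using tracks_at[OF tr tL] by simp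
      then have "0 < wt (side X u v) (?r t1)" "wt (side X u v) (?r t1) < 1" using m[OF tL] by auto
      then have meet: "supp (?r t1) \<inter> side X u v \<noteq> {}" "supp (?r t1) - side X u v \<noteq> {}"
        using wt_pos_iff[OF cc pR] wt_less_one_iff[OF cc pR] by (auto simp: Int_commute)
      \<comment> \<open>The carrier at \<open>t1\<close> may be a proper face of the carrier at
        \<open>t\<close> that lacks \<open>u\<close> or \<open>v\<close>; since it meets both sides,
        it still contains a parallel edge.\<close>
      obtain u' v' where e: "{u', v'} \<in> X" "u' \<in> supp (?r t1)" "v' \<in> supp (?r t1)"
          "u' \<notin> side X u v" "v' \<in> side X u v"
        by (rule parallel_edge_exists[OF cc uv(1,2) supp_cube[OF cc tR] uv(3,4) supp_cube[OF cc pR] sub meet])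
      have ne: "u' \<noteq> v'" using e by auto
      obtain \<delta>' where \<delta>': "0 < \<delta>'" "\<And>\<tau>. 0 \<le> \<tau> \<Longrightarrow> \<tau> \<le> ?L \<Longrightarrow> \<bar>\<tau> - t\<bar> < \<delta>' \<Longrightarrow>
          wt (side X u v) (?r \<tau>) = c + \<kappa> * \<tau>"
        using tr unfolding tracks_def by blast
      obtain \<epsilon>' where \<epsilon>': "good_radius (?r t) \<epsilon>'" using good_radius_exists[OF tR] .
      have eq: "wt (side X u' v') (?r \<tau>) = c + \<kappa> * \<tau>"
        if \<tau>: "0 \<le> \<tau>" "\<tau> \<le> ?L" "\<bar>\<tau> - t\<bar> < min \<delta>' \<epsilon>'" for \<tau>
      proof -
        have \<tau>R: "?r \<tau> \<in> R" using ray_in_R[OF yR b \<tau>(1,2)] .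
        have "d (?r t) (?r \<tau>) < \<epsilon>'"
          using ray_dist[OF yR b tL \<tau>(1,2)] \<tau>(3) by (simp add: abs_minus_commute)
        then have "supp (?r t) \<subseteq> supp (?r \<tau>)" using good_radius_supp[OF \<epsilon>' \<tau>R] by simp
        then have "wt (side X u' v') (?r \<tau>) = wt (side X u v) (?r \<tau>)"
          using uv e sub by (intro wt_side_parallel[OF cc \<tau>R]) auto
        then show ?thesis using \<delta>'(2) \<tau> by simp
      qed
      have "tracks ?y b c \<kappa> u' v' t'"
        by (rule tracks_extend[OF yR b L t1' \<epsilon> e(1) ne e(2,3) tL _ _ eq, of "min \<delta>' \<epsilon>'"])
          (use t t' \<delta>' good_radius_pos[OF \<epsilon>'] in \<open>auto simp: \<delta>_def\<close>)
      then show ?thesis by blast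
    qed
    show "\<exists>T. openin (top_of_set {0..?L}) T \<and> t1 \<in> T \<and>
        (\<forall>x\<in>T. \<forall>z\<in>T. (\<exists>u v. tracks ?y b c \<kappa> u v x) \<longrightarrow> (\<exists>u v. tracks ?y b c \<kappa> u v z))"
    proof (intro exI[of _ "{0..?L} \<inter> ball t1 \<delta>"] conjI ballI impI)
      show "openin (top_of_set {0..?L}) ({0..?L} \<inter> ball t1 \<delta>)" by (simp add: openin_open_Int)
      show "t1 \<in> {0..?L} \<inter> ball t1 \<delta>" using t1 \<delta> by simp
      fix x z assume "x \<in> {0..?L} \<inter> ball t1 \<delta>" "z \<in> {0..?L} \<inter> ball t1 \<delta>"
        "\<exists>u v. tracks ?y b c \<kappa> u v x"
      then show "\<exists>u v. tracks ?y b c \<kappa> u v z"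
        using step[of x z] by (auto simp: dist_real_def abs_minus_commute)
    qed
  qed (use L in auto)
  then obtain u v where "u \<noteq> v" "u \<in> supp (?r ?L)" "v \<in> supp (?r ?L)"
    unfolding tracks_def by blast
  then show False using ray_end[OF yR b] by (simp add: supp_vertex_point)
qed

end

section \<open>The orientation of the edges towards a vertex\<close>

context cat0_complex
begin

definition slope :: "'v \<Rightarrow> ('v \<Rightarrow> real) \<Rightarrow> 'v \<Rightarrow> 'v \<Rightarrow> real \<Rightarrow> bool" where
  "slope y p a b \<kappa> \<longleftrightarrow> tracks (vertex_point y) p (wt (side X a b) p) \<kappa> a b 0"

definition toward :: "'v \<Rightarrow> ('v \<Rightarrow> real) \<Rightarrow> 'v \<Rightarrow> 'v \<Rightarrow> bool" where
  "toward y p a b \<longleftrightarrow> (\<exists>\<kappa>>0. slope y p a b \<kappa>)"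

lemma dist_to_vertex_pos:
  assumes y: "y \<in> vertices X" and p: "p \<in> R" and "a \<noteq> b" "a \<in> supp p" "b \<in> supp p"
  shows "0 < d p (vertex_point y)"
proof -
  have "p \<noteq> vertex_point y" using assms(3-5) supp_vertex_point[of y] by auto
  then have "d p (vertex_point y) \<noteq> 0"
    using d_zero[OF p vertex_point_realization[OF cc y]] by simp
  then show ?thesis using d_nonneg[of p "vertex_point y"] by simp
qed

text \<open>The window \<open>e\<close> and the radius belong to \<open>p\<close>, while the
  geodesic starts at a nearby \<open>p'\<close>. The slope becomes a difference quotient over a
  window common to all nearby points, so slopes at different points can be compared.\<close>

lemma slope_affine:
  assumes y: "y \<in> vertices X" and p': "p' \<in> R" and \<epsilon>: "good_radius p \<epsilon>"
    and ab: "{a, b} \<in> X" "a \<noteq> b" "a \<in> supp p" "b \<in> supp p"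
    and e: "0 < e" "e \<le> d p' (vertex_point y)"
    and near: "\<And>t. 0 \<le> t \<Longrightarrow> t \<le> e \<Longrightarrow> d p (ray (vertex_point y) p' t) < \<epsilon>"
  obtains \<kappa> where "slope y p' a b \<kappa>"
    "wt (side X a b) (ray (vertex_point y) p' e) = wt (side X a b) p' + \<kappa> * e"
proof -
  have yR: "vertex_point y \<in> R" by (rule vertex_point_realization[OF cc y])
  obtain \<kappa> where \<kappa>: "\<And>t. 0 \<le> t \<Longrightarrow> t \<le> e \<Longrightarrow>
    wt (side X a b) (ray (vertex_point y) p' t) = wt (side X a b) (ray (vertex_point y) p' 0) + \<kappa> * (t - 0)"
    by (rule ray_affine[OF yR p' \<epsilon> ab order_refl less_imp_le[OF e(1)] e(2) near]) blast+
  have "d p p' < \<epsilon>" using near[of 0] e ray_0[OF yR p'] by simp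
  then have "a \<in> supp p'" "b \<in> supp p'" using good_radius_supp[OF \<epsilon> p'] ab by auto
  moreover have "\<exists>\<delta>>0. \<forall>\<tau>. 0 \<le> \<tau> \<longrightarrow> \<tau> \<le> d p' (vertex_point y) \<longrightarrow> \<bar>\<tau> - 0\<bar> < \<delta> \<longrightarrow>
     wt (side X a b) (ray (vertex_point y) p' \<tau>) = wt (side X a b) p' + \<kappa> * \<tau>"
    using \<kappa> e ray_0[OF yR p'] by (intro exI[of _ e]) auto
  ultimately have "slope y p' a b \<kappa>"
    using ab ray_0[OF yR p'] unfolding slope_def tracks_def by simp
  then show thesis using that \<kappa>[of e] e ray_0[OF yR p'] by simp
qed

lemma slope_exists:
  assumes y: "y \<in> vertices X" and p: "p \<in> R"
    and ab: "{a, b} \<in> X" "a \<noteq> b" "a \<in> supp p" "b \<in> supp p"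
  obtains \<kappa> where "slope y p a b \<kappa>"
proof -
  obtain \<epsilon> where \<epsilon>: "good_radius p \<epsilon>" using good_radius_exists[OF p] .
  have yR: "vertex_point y \<in> R" by (rule vertex_point_realization[OF cc y])
  note L = dist_to_vertex_pos[OF y p ab(2-4)]
  define e where "e = min (d p (vertex_point y)) (\<epsilon> / 2)"
  have e: "0 < e" "e \<le> d p (vertex_point y)" "e < \<epsilon>"
    using L good_radius_pos[OF \<epsilon>] by (auto simp: e_def)
  show thesis
  proof (rule slope_affine[OF y p \<epsilon> ab e(1,2)])
    fix t assume "0 \<le> t" "t \<le> e"
    then show "d p (ray (vertex_point y) p t) < \<epsilon>"
      using ray_dist[OF yR p, of 0 t] ray_0[OF yR p] e by simp
  qed (rule that)
qed

lemma slope_unique: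
  assumes y: "y \<in> vertices X" and p: "p \<in> R" and s: "slope y p a b \<kappa>" "slope y p a b \<kappa>'"
  shows "\<kappa> = \<kappa>'"
proof -
  let ?y = "vertex_point y"
  have yR: "?y \<in> R" by (rule vertex_point_realization[OF cc y])
  have "a \<noteq> b" "a \<in> supp p" "b \<in> supp p"
    using s(1) ray_0[OF yR p] by (auto simp: slope_def tracks_def)
  then have L: "0 < d p ?y" by (rule dist_to_vertex_pos[OF y p])
  obtain \<delta> where \<delta>: "0 < \<delta>" "\<And>\<tau>. 0 \<le> \<tau> \<Longrightarrow> \<tau> \<le> d p ?y \<Longrightarrow> \<bar>\<tau> - 0\<bar> < \<delta> \<Longrightarrow>
     wt (side X a b) (ray ?y p \<tau>) = wt (side X a b) p + \<kappa> * \<tau>"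
    using s(1) unfolding slope_def tracks_def by blast
  obtain \<delta>' where \<delta>': "0 < \<delta>'" "\<And>\<tau>. 0 \<le> \<tau> \<Longrightarrow> \<tau> \<le> d p ?y \<Longrightarrow> \<bar>\<tau> - 0\<bar> < \<delta>' \<Longrightarrow>
     wt (side X a b) (ray ?y p \<tau>) = wt (side X a b) p + \<kappa>' * \<tau>"
    using s(2) unfolding slope_def tracks_def by blast
  define \<tau> where "\<tau> = min (d p ?y) (min \<delta> \<delta>') / 2"
  have "0 < \<tau>" "\<tau> \<le> d p ?y" "\<bar>\<tau> - 0\<bar> < \<delta>" "\<bar>\<tau> - 0\<bar> < \<delta>'"
    using L \<delta>(1) \<delta>'(1) by (auto simp: \<tau>_def)
  then show ?thesis using \<delta>(2)[of \<tau>] \<delta>'(2)[of \<tau>] by simp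
qed

lemma toward_iff:
  assumes y: "y \<in> vertices X" and p: "p \<in> R" and s: "slope y p a b \<kappa>"
  shows "toward y p a b \<longleftrightarrow> 0 < \<kappa>"
  using slope_unique[OF y p s] s unfolding toward_def by blast

text \<open>By \<open>coordinate_exits\<close> the extrapolated value at the end of the geodesic
  lies outside (0,1), while the initial value lies inside. A positive slope is therefore bounded
  below by the distance of the coordinate from 1 divided by the distance to \<open>y\<close>, which
  matters when \<open>p\<close> approaches a vertex.\<close>

lemma slope_exits:
  assumes y: "y \<in> vertices X" and p: "p \<in> R" and s: "slope y p a b \<kappa>"
  shows "\<kappa> \<noteq> 0" "0 < \<kappa> \<Longrightarrow> 1 \<le> wt (side X a b) p + \<kappa> * d p (vertex_point y)"
proof -
  let ?y = "vertex_point y"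
  have yR: "?y \<in> R" by (rule vertex_point_realization[OF cc y])
  have ab: "{a, b} \<in> X" "a \<noteq> b" "a \<in> supp p" "b \<in> supp p"
    using s ray_0[OF yR p] by (auto simp: slope_def tracks_def)
  have L: "0 < d p ?y" by (rule dist_to_vertex_pos[OF y p ab(2-4)])
  have c: "0 < wt (side X a b) p" "wt (side X a b) p < 1"
    using wt_side_strict[OF cc p ab] by auto
  have no: "\<not> (0 < wt (side X a b) p + \<kappa> * d p ?y \<and> wt (side X a b) p + \<kappa> * d p ?y < 1)"
    using coordinate_exits[OF y p L] s unfolding slope_def by blast
  show "\<kappa> \<noteq> 0" using no c by auto
  assume "0 < \<kappa>"
  then have "0 < \<kappa> * d p ?y" using L by simp
  then show "1 \<le> wt (side X a b) p + \<kappa> * d p ?y" using no c by linarith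
qed

text \<open>Over the common window \<open>e\<close> the increments of the coordinate from
  \<open>p\<close> and from \<open>p'\<close> differ by at most \<open>3 * lip * d p p'\<close>; for
  close points this is less than the nonzero increment \<open>\<bar>\<kappa>\<bar> * e\<close>, and
  the signs agree.\<close>

lemma toward_local:
  assumes y: "y \<in> vertices X" and p: "p \<in> R"
    and ab: "{a, b} \<in> X" "a \<noteq> b" "a \<in> supp p" "b \<in> supp p"
  obtains \<epsilon> where "0 < \<epsilon>" "\<And>p'. p' \<in> R \<Longrightarrow> d p p' < \<epsilon> \<Longrightarrow> toward y p' a b \<longleftrightarrow> toward y p a b"
proof -
  let ?y = "vertex_point y" and ?f = "wt (side X a b)"
  have yR: "?y \<in> R" by (rule vertex_point_realization[OF cc y])
  define L where "L = d p ?y"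
  have L: "0 < L" unfolding L_def by (rule dist_to_vertex_pos[OF y p ab(2-4)])
  obtain \<epsilon> where \<epsilon>: "good_radius p \<epsilon>" using good_radius_exists[OF p] .
  have \<epsilon>0: "0 < \<epsilon>" using good_radius_pos[OF \<epsilon>] .
  define e where "e = min (\<epsilon> / 4) (L / 2)"
  have e: "0 < e" "e \<le> \<epsilon> / 4" "e \<le> L / 2" using \<epsilon>0 L by (auto simp: e_def)
  have near: "d p (ray ?y p' t) < \<epsilon>" if p': "p' \<in> R" "d p p' < \<epsilon> / 4" and t: "0 \<le> t" "t \<le> e" "e \<le> d p' ?y" for p' t
  proof -
    have "d p' (ray ?y p' t) = t" using ray_dist[OF yR p'(1), of 0 t] ray_0[OF yR p'(1)] t by simp
    then show ?thesis using d_tri[OF p p'(1) ray_in_R[OF yR p'(1), of t]] p' t e \<epsilon>0 by simp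
  qed
  have "d p p = 0" using d_zero[OF p p] by simp
  then obtain \<kappa> where \<kappa>: "slope y p a b \<kappa>" "?f (ray ?y p e) = ?f p + \<kappa> * e"
    using slope_affine[OF y p \<epsilon> ab e(1) _ near[OF p]] \<epsilon>0 e L by (auto simp: L_def)
  have k0: "\<kappa> \<noteq> 0" by (rule slope_exits(1)[OF y p \<kappa>(1)])
  \<comment> \<open>In \<open>3 * lip\<close>, one share comes from the starting points and two from
    \<open>ray_close\<close> at time \<open>e\<close>.\<close>
  define \<eta> where "\<eta> = min (min (\<epsilon> / 4) (L / 4)) (\<bar>\<kappa>\<bar> * e / (3 * lip + 1))"
  have pos: "0 < 3 * lip + 1" using lip_nonneg by simp
  show thesis
  proof (rule that)
    show "0 < \<eta>" using \<epsilon>0 L k0 e pos by (simp add: \<eta>_def)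
    fix p' assume p': "p' \<in> R" "d p p' < \<eta>"
    have small: "d p p' < \<epsilon> / 4" "d p p' < L / 4" "d p p' * (3 * lip + 1) < \<bar>\<kappa>\<bar> * e"
      using p'(2) pos by (auto simp: \<eta>_def pos_less_divide_eq)
    have L': "e \<le> d p' ?y" using d_tri[OF p p'(1) yR] small(2) e(3) L by (simp add: L_def)
    obtain \<kappa>' where \<kappa>': "slope y p' a b \<kappa>'" "?f (ray ?y p' e) = ?f p' + \<kappa>' * e"
      using slope_affine[OF y p'(1) \<epsilon> ab e(1) L' near[OF p'(1) small(1) _ _ L']] by blast
    have rR: "ray ?y p e \<in> R" "ray ?y p' e \<in> R"
      using ray_in_R[OF yR p, of e] ray_in_R[OF yR p'(1), of e] e L' L by (auto simp: L_def)
    have "d (ray ?y p e) (ray ?y p' e) \<le> 2 * d p p'"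
      by (rule ray_close[OF yR p p'(1)]) (use e L' L in \<open>auto simp: L_def\<close>)
    then have "lip * d (ray ?y p e) (ray ?y p' e) \<le> lip * (2 * d p p')"
      using lip_nonneg by (intro mult_left_mono)
    then have 1: "\<bar>?f (ray ?y p e) - ?f (ray ?y p' e)\<bar> \<le> lip * (2 * d p p')"
      using wt_lipschitz[OF rR, of "side X a b"] by linarith
    have 2: "\<bar>?f p - ?f p'\<bar> \<le> lip * d p p'" by (rule wt_lipschitz[OF p p'(1)])
    have "\<bar>\<kappa> * e - \<kappa>' * e\<bar> \<le> lip * (2 * d p p') + lip * d p p'"
      using 1 2 \<kappa>(2) \<kappa>'(2) by linarith
    also have "\<dots> \<le> d p p' * (3 * lip + 1)" using d_nonneg[of p p'] by (simp add: algebra_simps)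
    also have "\<dots> < \<bar>\<kappa> * e\<bar>" using small(3) e(1) by (simp add: abs_mult)
    finally have "0 < \<kappa> * e \<longleftrightarrow> 0 < \<kappa>' * e" by linarith
    then have "0 < \<kappa> \<longleftrightarrow> 0 < \<kappa>'" using e(1) by (simp add: zero_less_mult_iff)
    then show "toward y p' a b \<longleftrightarrow> toward y p a b"
      using toward_iff[OF y p \<kappa>(1)] toward_iff[OF y p'(1) \<kappa>'(1)] by simp
  qed
qed

text \<open>The conditions on \<open>u\<close> and \<open>w\<close> say that
  \<open>\<phi> {}\<close> and \<open>\<phi> {j}\<close> lie in the support. They persist along the
  segment from \<open>u\<close> to \<open>w\<close>, and a locally constant sign on a segment is
  constant.\<close>

lemma toward_chart:
  assumes y: "y \<in> vertices X" and c: "cube_chart X Q k \<phi>" and j: "j < k"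
    and u: "u \<in> unit_cube k" "u j \<noteq> 0" "\<And>i. i < k \<Longrightarrow> u i \<noteq> 1"
    and w: "w \<in> unit_cube k" "w j \<noteq> 0" "\<And>i. i < k \<Longrightarrow> w i \<noteq> 1"
  shows "toward y (cube_point k \<phi> u) (\<phi> {}) (\<phi> {j}) \<longleftrightarrow> toward y (cube_point k \<phi> w) (\<phi> {}) (\<phi> {j})"
proof -
  define z where "z s = (\<lambda>i. (1 - s) * u i + s * w i)" for s :: real
  define p where "p s = cube_point k \<phi> (z s)" for s
  have e: "{\<phi> {}, \<phi> {j}} \<in> X" "\<phi> {} \<noteq> \<phi> {j}" using chart_edge[OF cc c, of "{}" j] j by auto
  have z: "z s \<in> unit_cube k" "z s j \<noteq> 0" "\<And>i. i < k \<Longrightarrow> z s i \<noteq> 1" if s: "s \<in> {0..1}" for s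
  proof -
    have ineq: "0 \<le> z s i \<and> z s i < 1" if "i < k" for i
    proof -
      have "0 \<le> u i" "u i < 1" "0 \<le> w i" "w i < 1"
        using unit_cubeD[OF u(1) that] unit_cubeD[OF w(1) that] u(3)[OF that] w(3)[OF that] by auto
      moreover from this have "(1 - s) * u i + s * w i < 1"
        using convex_bound_lt[of "u i" 1 "w i" "1 - s" s] s by auto
      ultimately show ?thesis using s by (auto simp: z_def)
    qed
    then show "z s \<in> unit_cube k" by (simp add: unit_cube_def less_imp_le)
    show "z s i \<noteq> 1" if "i < k" for i using ineq[OF that] by simp
    have "0 < u j" "0 < w j" using unit_cubeD[OF u(1) j] unit_cubeD[OF w(1) j] u(2) w(2) by auto
    then have "0 < (1 - s) * u j + s * w j"
      using s by (cases "s = 0") (auto intro!: add_nonneg_pos)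
    then show "z s j \<noteq> 0" by (simp add: z_def)
  qed
  have pR: "p s \<in> R" if "s \<in> {0..1}" for s
    unfolding p_def by (rule cube_point_realization[OF cc c z(1)[OF that]])
  have sp: "\<phi> {} \<in> supp (p s)" "\<phi> {j} \<in> supp (p s)" if s: "s \<in> {0..1}" for s
    unfolding p_def using mem_supp_cube_point[OF c, of "{}" "z s"] mem_supp_cube_point[OF c, of "{j}" "z s"]
      z[OF s] j by auto
  define K where "K = sqrt (\<Sum>i<k. (u i - w i)\<^sup>2)"
  have K: "0 \<le> K" by (simp add: K_def sum_nonneg)
  have dist: "d (p s) (p s') \<le> \<bar>s - s'\<bar> * K" if "s \<in> {0..1}" "s' \<in> {0..1}" for s s'
  proof -
    have "z s i - z s' i = (s' - s) * (u i - w i)" for i by (simp add: z_def algebra_simps)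
    then have "(\<Sum>i<k. (z s i - z s' i)\<^sup>2) = (s' - s)\<^sup>2 * (\<Sum>i<k. (u i - w i)\<^sup>2)"
      by (simp add: power_mult_distrib sum_distrib_left)
    then have "sqrt (\<Sum>i<k. (z s i - z s' i)\<^sup>2) = \<bar>s - s'\<bar> * K"
      by (simp add: K_def real_sqrt_mult abs_minus_commute)
    then show ?thesis
      using d_le_segment[OF cube_segmentI[OF c z(1)[OF that(1)] z(1)[OF that(2)]]] by (simp add: p_def)
  qed
  define P where "P s \<longleftrightarrow> (toward y (p s) (\<phi> {}) (\<phi> {j}) \<longleftrightarrow> toward y (p 0) (\<phi> {}) (\<phi> {j}))" for s
  have "P 1"
  proof (rule connected_induction_simple[of "{0..1::real}" 0 1 P])
    show "P 0" by (simp add: P_def)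
    fix s assume s: "s \<in> {0..1::real}"
    obtain \<epsilon> where \<epsilon>: "0 < \<epsilon>" "\<And>p'. p' \<in> R \<Longrightarrow> d (p s) p' < \<epsilon> \<Longrightarrow>
       toward y p' (\<phi> {}) (\<phi> {j}) \<longleftrightarrow> toward y (p s) (\<phi> {}) (\<phi> {j})"
      by (rule toward_local[OF y pR[OF s] e sp[OF s]]) blast
    have loc: "toward y (p x) (\<phi> {}) (\<phi> {j}) \<longleftrightarrow> toward y (p s) (\<phi> {}) (\<phi> {j})"
      if "x \<in> {0..1} \<inter> ball s (\<epsilon> / (K + 1))" for x
    proof -
      have x: "x \<in> {0..1}" "\<bar>s - x\<bar> * (K + 1) < \<epsilon>"
        using that K by (auto simp: dist_real_def pos_less_divide_eq)
      have "d (p s) (p x) \<le> \<bar>s - x\<bar> * K" by (rule dist[OF s x(1)])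
      also have "\<dots> \<le> \<bar>s - x\<bar> * (K + 1)" by (intro mult_left_mono) auto
      finally show ?thesis using \<epsilon>(2)[OF pR[OF x(1)]] x(2) by simp
    qed
    show "\<exists>T. openin (top_of_set {0..1}) T \<and> s \<in> T \<and> (\<forall>x\<in>T. \<forall>z\<in>T. P x \<longrightarrow> P z)"
    proof (intro exI[of _ "{0..1} \<inter> ball s (\<epsilon> / (K + 1))"] conjI ballI impI)
      show "openin (top_of_set {0..1}) ({0..1} \<inter> ball s (\<epsilon> / (K + 1)))" by (simp add: openin_open_Int)
      show "s \<in> {0..1} \<inter> ball s (\<epsilon> / (K + 1))" using s \<epsilon> K by simp
      fix x x' assume "x \<in> {0..1} \<inter> ball s (\<epsilon> / (K + 1))" "x' \<in> {0..1} \<inter> ball s (\<epsilon> / (K + 1))" "P x"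
      then show "P x'" using loc[of x] loc[of x'] by (simp add: P_def)
    qed
  qed auto
  moreover have "z 0 = u" "z 1 = w" by (auto simp: z_def)
  ultimately show ?thesis by (simp add: P_def p_def)
qed

section \<open>The orientation of an edge, tested at its midpoint\<close>

definition midpoint_of :: "'v \<Rightarrow> 'v \<Rightarrow> 'v \<Rightarrow> real" where
  "midpoint_of a b = (\<lambda>v. if v = a \<or> v = b then 1 / 2 else 0)"

lemma midpoint_of_chart:
  assumes c: "cube_chart X Q k \<phi>" and j: "j < k"
  shows "midpoint_of (\<phi> {}) (\<phi> {j}) = cube_point k \<phi> (\<lambda>i. if i = j then 1 / 2 else 0)"
proof
  fix v
  show "midpoint_of (\<phi> {}) (\<phi> {j}) v = cube_point k \<phi> (\<lambda>i. if i = j then 1 / 2 else 0) v"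
  proof (cases "v \<in> Q")
    case False
    moreover have "\<phi> {} \<in> Q" "\<phi> {j} \<in> Q" using cube_chart_vertexI[OF c] j by auto
    ultimately show ?thesis by (auto simp: midpoint_of_def cube_point_outside[OF c])
  next
    case True
    then have "v \<in> \<phi> ` Pow {..<k}" using cube_chart_image[OF c] by simp
    then obtain A where A: "A \<subseteq> {..<k}" "v = \<phi> A" by auto
    have eq: "\<phi> A = \<phi> {} \<longleftrightarrow> A = {}" "\<phi> A = \<phi> {j} \<longleftrightarrow> A = {j}"
      using chart_inj[OF cc c A(1)] j by auto
    let ?u = "\<lambda>i. if i = j then 1 / 2 else 0 :: real"
    have "(\<Prod>i<k. if i \<in> A then ?u i else 1 - ?u i) = (if A = {} \<or> A = {j} then 1 / 2 else 0)"
    proof (cases "A \<subseteq> {j}")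
      case True
      then have "A = {} \<or> A = {j}" by auto
      moreover have "(\<Prod>i<k. if i \<in> A then ?u i else 1 - ?u i) = (\<Prod>i<k. if i = j then 1 / 2 else 1)"
        using True by (intro prod.cong) auto
      ultimately show ?thesis using j by simp
    next
      case False
      then obtain i where i: "i \<in> A" "i \<noteq> j" by auto
      then have "(\<Prod>i<k. if i \<in> A then ?u i else 1 - ?u i) = 0"
        using A(1) by (intro prod_zero bexI[of _ i]) auto
      then show ?thesis using i by auto
    qed
    then show ?thesis unfolding A(2) cube_point_vertex[OF c A(1)] by (simp add: midpoint_of_def eq)
  qed
qed

definition D :: "'v \<Rightarrow> 'v \<Rightarrow> 'v \<Rightarrow> bool" where
  "D y u v \<longleftrightarrow> toward y (midpoint_of u v) u v"

lemma supp_midpoint: "supp (midpoint_of u v) = {u, v}"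
  by (auto simp: supp_def midpoint_of_def)

lemma edge_chart:
  assumes "(u, v) \<in> edges X"
  obtains Q k \<phi> j where "cube_chart X Q k \<phi>" "\<phi> {} = u" "j < k" "\<phi> {j} = v"
proof -
  have e: "{u, v} \<in> X" "u \<noteq> v" using assms by (auto simp: edges_def)
  obtain k \<phi> where c: "cube_chart X {u, v} k \<phi>" "\<phi> {} = u"
    by (rule based_chart_exists[OF cc e(1), of u]) auto
  have "{\<phi> {}, v} \<in> X" "v \<noteq> \<phi> {}" using e c(2) by auto
  then obtain j where "j < k" "v = \<phi> {j}" by (rule edge_at_base[OF cc c(1), rotated]) auto
  then show thesis using that c by simp
qed

lemma midpoint_in_R:
  assumes "(u, v) \<in> edges X" shows "midpoint_of u v \<in> R"
proof -
  obtain Q k \<phi> j where c: "cube_chart X Q k \<phi>" "\<phi> {} = u" "j < k" "\<phi> {j} = v"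
    using edge_chart[OF assms] .
  have "(\<lambda>i. if i = j then 1 / 2 else 0) \<in> unit_cube k" by (simp add: unit_cube_def)
  then show ?thesis using midpoint_of_chart[OF c(1,3)] cube_point_realization[OF cc c(1)] c by simp
qed

text \<open>Used with \<open>\<alpha> = 1\<close>, \<open>\<beta> = - 1\<close> for the reversed
  edge and with \<open>\<alpha> = 0\<close>, \<open>\<beta> = 1\<close> for a parallel one.\<close>

lemma slope_transfer:
  assumes y: "y \<in> vertices X" and p: "p \<in> R" and s: "slope y p a b \<kappa>"
    and a'b': "{a', b'} \<in> X" "a' \<noteq> b'" "a' \<in> supp p" "b' \<in> supp p"
    and eq: "\<And>q. q \<in> R \<Longrightarrow> supp p \<subseteq> supp q \<Longrightarrow> wt (side X a' b') q = \<alpha> + \<beta> * wt (side X a b) q"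
  shows "slope y p a' b' (\<beta> * \<kappa>)"
proof -
  let ?y = "vertex_point y"
  have yR: "?y \<in> R" by (rule vertex_point_realization[OF cc y])
  obtain \<delta> where \<delta>: "0 < \<delta>" "\<And>\<tau>. 0 \<le> \<tau> \<Longrightarrow> \<tau> \<le> d p ?y \<Longrightarrow> \<bar>\<tau> - 0\<bar> < \<delta> \<Longrightarrow>
     wt (side X a b) (ray ?y p \<tau>) = wt (side X a b) p + \<kappa> * \<tau>"
    using s unfolding slope_def tracks_def by blast
  obtain \<epsilon> where \<epsilon>: "good_radius p \<epsilon>" using good_radius_exists[OF p] .
  have "wt (side X a' b') (ray ?y p \<tau>) = wt (side X a' b') p + \<beta> * \<kappa> * \<tau>"
    if \<tau>: "0 \<le> \<tau>" "\<tau> \<le> d p ?y" "\<bar>\<tau> - 0\<bar> < min \<delta> \<epsilon>" for \<tau>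
  proof -
    have R: "ray ?y p \<tau> \<in> R" using ray_in_R[OF yR p \<tau>(1,2)] .
    have "d p (ray ?y p \<tau>) < \<epsilon>" using ray_dist[OF yR p, of 0 \<tau>] ray_0[OF yR p] \<tau> by simp
    then have sub: "supp p \<subseteq> supp (ray ?y p \<tau>)" by (rule good_radius_supp[OF \<epsilon> R])
    show ?thesis using \<delta>(2) \<tau> eq[OF R sub] eq[OF p order_refl] by (simp add: algebra_simps)
  qed
  moreover have "0 < min \<delta> \<epsilon>" using \<delta>(1) good_radius_pos[OF \<epsilon>] by simp
  ultimately have "\<exists>\<delta>>0. \<forall>\<tau>. 0 \<le> \<tau> \<longrightarrow> \<tau> \<le> d p ?y \<longrightarrow> \<bar>\<tau> - 0\<bar> < \<delta> \<longrightarrow>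
      wt (side X a' b') (ray ?y p \<tau>) = wt (side X a' b') p + \<beta> * \<kappa> * \<tau>" by blast
  then show ?thesis
    unfolding slope_def tracks_def using a'b' ray_0[OF yR p] by simp
qed

lemma D_flip':
  assumes y: "y \<in> vertices X" and e: "(u, v) \<in> edges X"
  shows "D y v u \<longleftrightarrow> \<not> D y u v"
proof -
  let ?m = "midpoint_of u v"
  have uv: "{u, v} \<in> X" "u \<noteq> v" using e by (auto simp: edges_def)
  have vu: "{v, u} \<in> X" "v \<noteq> u" using uv by (auto simp: insert_commute)
  have m: "?m \<in> R" "midpoint_of v u = ?m" using midpoint_in_R[OF e] by (auto simp: midpoint_of_def)
  obtain \<kappa> where \<kappa>: "slope y ?m u v \<kappa>"
    using slope_exists[OF y m(1) uv] by (auto simp: supp_midpoint)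
  have "slope y ?m v u (- 1 * \<kappa>)"
  proof (rule slope_transfer[OF y m(1) \<kappa> vu, of 1])
    fix q assume q: "q \<in> R" "supp ?m \<subseteq> supp q"
    then show "wt (side X v u) q = 1 + - 1 * wt (side X u v) q"
      using wt_side_flip[OF cc q(1) uv] by (simp add: supp_midpoint)
  qed (simp_all add: supp_midpoint)
  then have "D y v u \<longleftrightarrow> 0 < - \<kappa>" using toward_iff[OF y m(1)] by (simp add: D_def m(2))
  moreover have "D y u v \<longleftrightarrow> 0 < \<kappa>" using toward_iff[OF y m(1) \<kappa>] by (simp add: D_def)
  ultimately show ?thesis using slope_exits(1)[OF y m(1) \<kappa>] by linarith
qed

text \<open>The two edges are opposite sides of a square and are both tested at its centre
  \<open>m\<close>: \<open>toward_chart\<close> moves the test point there from either midpoint, and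
  around \<open>m\<close> the two coordinates coincide by \<open>wt_side_parallel\<close>.\<close>

lemma D_parallel':
  assumes y: "y \<in> vertices X" and c: "cube_chart X Q k \<phi>" and A: "A \<subseteq> {..<k}"
    and ij: "i < k" "j < k" "i \<noteq> j" "i \<notin> A" "j \<notin> A"
  shows "D y (\<phi> A) (\<phi> (insert i A)) \<longleftrightarrow> D y (\<phi> (insert j A)) (\<phi> (insert i (insert j A)))"
proof -
  define \<psi> where "\<psi> = (\<lambda>C. \<phi> (symdiff C A))"
  define \<omega> where "\<omega> = (\<lambda>C. \<psi> (symdiff C {j}))"
  have c\<psi>: "cube_chart X Q k \<psi>" unfolding \<psi>_def by (rule cube_chart_rebase[OF c A])
  have c\<omega>: "cube_chart X Q k \<omega>" unfolding \<omega>_def by (rule cube_chart_rebase[OF c\<psi>]) (use ij in auto)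
  have s: "symdiff {i} A = insert i A" "symdiff {j} A = insert j A"
    "symdiff (symdiff {i} {j}) A = insert i (insert j A)" using ij by auto
  have v: "\<psi> {} = \<phi> A" "\<psi> {i} = \<phi> (insert i A)" "\<omega> {} = \<phi> (insert j A)"
    "\<omega> {i} = \<phi> (insert i (insert j A))"
    using s by (simp_all add: \<psi>_def \<omega>_def)
  \<comment> \<open>Coordinates 1/2 are invariant under the reflection in \<open>j\<close>, so the
    centre has the same coordinates in both charts.\<close>
  define h where "h = (\<lambda>l. if l = i \<or> l = j then 1 / 2 else 0 :: real)"
  define m where "m = cube_point k \<psi> h"
  have h: "h \<in> unit_cube k" "h i \<noteq> 0" "\<And>l. h l \<noteq> 1" "flip {j} h = h"
    by (auto simp: h_def unit_cube_def flip_def)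
  have m': "m = cube_point k \<omega> h"
    using cube_point_rebase[OF c\<psi>, of "{j}" h] ij h(4) by (simp add: m_def \<omega>_def)
  have mR: "m \<in> R" unfolding m_def by (rule cube_point_realization[OF cc c\<psi> h(1)])
  have e: "(\<lambda>l. if l = i then 1 / 2 else 0 :: real) \<in> unit_cube k" by (simp add: unit_cube_def)
  have 1: "D y (\<phi> A) (\<phi> (insert i A)) \<longleftrightarrow> toward y m (\<psi> {}) (\<psi> {i})"
    unfolding D_def v(1,2)[symmetric] midpoint_of_chart[OF c\<psi> ij(1)] m_def
    by (rule toward_chart[OF y c\<psi> ij(1) e _ _ h(1-3)]) auto
  have 2: "D y (\<phi> (insert j A)) (\<phi> (insert i (insert j A))) \<longleftrightarrow> toward y m (\<omega> {}) (\<omega> {i})"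
    unfolding D_def v(3,4)[symmetric] midpoint_of_chart[OF c\<omega> ij(1)] m'
    by (rule toward_chart[OF y c\<omega> ij(1) e _ _ h(1-3)]) auto
  have p\<psi>: "{\<psi> {}, \<psi> {i}} \<in> X" "\<psi> {} \<noteq> \<psi> {i}" using chart_edge[OF cc c\<psi>, of "{}" i] ij by auto
  have p\<omega>: "{\<omega> {}, \<omega> {i}} \<in> X" "\<omega> {} \<noteq> \<omega> {i}" using chart_edge[OF cc c\<omega>, of "{}" i] ij by auto
  have sp: "\<psi> {} \<in> supp m" "\<psi> {i} \<in> supp m" unfolding m_def
    using mem_supp_cube_point[OF c\<psi>, of "{}" h] mem_supp_cube_point[OF c\<psi>, of "{i}" h] ij h(2,3) by auto
  have sp': "\<omega> {} \<in> supp m" "\<omega> {i} \<in> supp m" unfolding m'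
    using mem_supp_cube_point[OF c\<omega>, of "{}" h] mem_supp_cube_point[OF c\<omega>, of "{i}" h] ij h(2,3) by auto
  have \<omega>\<psi>: "\<omega> {} = \<psi> {j}" "\<omega> {i} = \<psi> {i, j}"
  proof -
    have "symdiff {i} {j} = {i, j}" using ij by auto
    then show "\<omega> {} = \<psi> {j}" "\<omega> {i} = \<psi> {i, j}" by (simp_all add: \<omega>_def)
  qed
  have sides: "\<omega> {} \<notin> side X (\<psi> {}) (\<psi> {i})" "\<omega> {i} \<in> side X (\<psi> {}) (\<psi> {i})"
    unfolding \<omega>\<psi> using mem_side_chart[OF cc c\<psi> ij(1), of "{j}"] mem_side_chart[OF cc c\<psi> ij(1), of "{i, j}"] ij by auto
  obtain \<kappa> where \<kappa>: "slope y m (\<psi> {}) (\<psi> {i}) \<kappa>" using slope_exists[OF y mR p\<psi> sp] .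
  have "slope y m (\<omega> {}) (\<omega> {i}) (1 * \<kappa>)"
  proof (rule slope_transfer[OF y mR \<kappa> p\<omega> sp', of 0])
    fix q assume q: "q \<in> R" "supp m \<subseteq> supp q"
    show "wt (side X (\<omega> {}) (\<omega> {i})) q = 0 + 1 * wt (side X (\<psi> {}) (\<psi> {i})) q"
      using wt_side_parallel[OF cc q(1) p\<psi> _ _ p\<omega>(1) _ _ sides] q(2) sp sp' by auto
  qed
  then have "toward y m (\<omega> {}) (\<omega> {i}) \<longleftrightarrow> toward y m (\<psi> {}) (\<psi> {i})"
    using toward_iff[OF y mR] \<kappa> by simp
  then show ?thesis using 1 2 by simp
qed

section \<open>Geodesics that start near a vertex\<close>

lemma supp_near_vertex:
  assumes x: "x \<in> vertices X" and q: "q \<in> R" "d (vertex_point x) q * (lip + 1) < 1"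
  shows "x \<in> supp q"
proof -
  have "\<bar>wt {x} (vertex_point x) - wt {x} q\<bar> \<le> lip * d (vertex_point x) q"
    by (rule wt_lipschitz[OF vertex_point_realization[OF cc x] q(1)])
  then have "1 - q x \<le> lip * d (vertex_point x) q"
    by (simp add: wt_singleton[OF cc] wt_vertex_point)
  also have "\<dots> < 1" using q(2) d_nonneg[of "vertex_point x" q] by (simp add: algebra_simps)
  finally show ?thesis by (simp add: supp_def)
qed

text \<open>Start on the edge at height \<open>\<beta>\<close> above \<open>x\<close>. While the
  geodesic is so close to \<open>x\<close> that \<open>x\<close> stays in the support, a positive
  coordinate keeps \<open>v\<close> in the support too, so the edge itself can be tracked, for a
  time that does not shrink as \<open>\<beta>\<close> tends to 0.\<close>

lemma near_vertex:
  assumes y: "y \<in> vertices X" and e: "(x, v) \<in> edges X" "D y x v" and \<beta>: "0 < \<beta>" "\<beta> < 1"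
  obtains b \<kappa> where "b \<in> R" "d (vertex_point x) b \<le> \<beta>" "0 < d b (vertex_point y)" "0 < \<kappa>"
    "1 \<le> \<beta> + \<kappa> * d b (vertex_point y)"
    "\<And>\<tau>. 0 \<le> \<tau> \<Longrightarrow> \<tau> \<le> d b (vertex_point y) \<Longrightarrow> (\<tau> + \<beta>) * (lip + 1) < 1 \<Longrightarrow>
      wt (side X x v) (ray (vertex_point y) b \<tau>) = \<beta> + \<kappa> * \<tau>"
proof -
  let ?y = "vertex_point y"
  have yR: "?y \<in> R" by (rule vertex_point_realization[OF cc y])
  have x: "x \<in> vertices X" using edges_in_vertices[OF e(1)] by simp
  have xR: "vertex_point x \<in> R" by (rule vertex_point_realization[OF cc x])
  have xv: "{x, v} \<in> X" "x \<noteq> v" using e by (auto simp: edges_def)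
  obtain Q k \<phi> j where c: "cube_chart X Q k \<phi>" "\<phi> {} = x" "j < k" "\<phi> {j} = v"
    using edge_chart[OF e(1)] .
  define u where "u = (\<lambda>i. if i = j then \<beta> else 0)"
  define b where "b = cube_point k \<phi> u"
  have u: "u \<in> unit_cube k" "u j \<noteq> 0" "\<And>i. u i \<noteq> 1" using \<beta> by (auto simp: u_def unit_cube_def)
  have bR: "b \<in> R" unfolding b_def by (rule cube_point_realization[OF cc c(1) u(1)])
  have sb: "x \<in> supp b" "v \<in> supp b" unfolding b_def
    using mem_supp_cube_point[OF c(1), of "{}" u] mem_supp_cube_point[OF c(1), of "{j}" u] c u by auto
  have wb: "wt (side X x v) b = \<beta>"
    using wt_side[OF cc c(1,3), of u] c by (simp add: b_def u_def)
  have db: "d (vertex_point x) b \<le> \<beta>"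
  proof -
    have 0: "(\<lambda>i. 0) \<in> unit_cube k" by (simp add: unit_cube_def)
    have "(\<Sum>i<k. (0 - u i)\<^sup>2) = (\<Sum>i<k. if i = j then \<beta>\<^sup>2 else 0)"
      by (intro sum.cong) (auto simp: u_def)
    then have "sqrt (\<Sum>i<k. (0 - u i)\<^sup>2) = \<beta>" using c(3) \<beta> by simp
    then show ?thesis
      using d_le_segment[OF cube_segmentI[OF c(1) 0 u(1)]] cube_point_corner[OF c(1)] c(2) by (simp add: b_def)
  qed
  have L: "0 < d b ?y" by (rule dist_to_vertex_pos[OF y bR xv(2) sb])
  have half: "(\<lambda>i. if i = j then 1 / 2 else 0 :: real) \<in> unit_cube k" by (simp add: unit_cube_def)
  have "toward y b (\<phi> {}) (\<phi> {j}) \<longleftrightarrow> D y x v"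
    unfolding D_def b_def c(2,4)[symmetric] midpoint_of_chart[OF c(1,3)]
    by (rule toward_chart[OF y c(1,3) u half]) auto
  then have "toward y b x v" using e(2) c by simp
  then obtain \<kappa> where \<kappa>: "0 < \<kappa>" "slope y b x v \<kappa>" unfolding toward_def by blast
  have exit: "1 \<le> \<beta> + \<kappa> * d b ?y" using slope_exits(2)[OF y bR \<kappa>(2,1)] wb by simp
  have formula: "wt (side X x v) (ray ?y b \<tau>) = \<beta> + \<kappa> * \<tau>"
    if \<tau>: "0 \<le> \<tau>" "\<tau> \<le> d b ?y" "(\<tau> + \<beta>) * (lip + 1) < 1" for \<tau>
  proof -
    have "tracks ?y b \<beta> \<kappa> x v \<tau>"
    proof (rule connected_induction_simple[of "{0..\<tau>}" 0 \<tau> "tracks ?y b \<beta> \<kappa> x v"])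
      show "tracks ?y b \<beta> \<kappa> x v 0" using \<kappa>(2) wb by (simp add: slope_def)
      fix t1 assume "t1 \<in> {0..\<tau>}"
      then have t1: "0 \<le> t1" "t1 \<le> d b ?y" "t1 \<le> \<tau>" using \<tau> by auto
      let ?p = "ray ?y b t1"
      have pR: "?p \<in> R" by (rule ray_in_R[OF yR bR t1(1,2)])
      obtain \<epsilon> where \<epsilon>: "good_radius ?p \<epsilon>" using good_radius_exists[OF pR] .
      \<comment> \<open>Since \<open>\<kappa>\<close> is positive, the tracked coordinate is at
        least \<open>\<beta>\<close>; the second bound then keeps the coordinate at
        \<open>t1\<close> positive.\<close>
      define \<delta> where "\<delta> = min (\<epsilon> / 2) (\<beta> / (lip + 1))"
      have \<delta>: "0 < \<delta>" using good_radius_pos[OF \<epsilon>] \<beta> lip_nonneg by (simp add: \<delta>_def)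
      have xp: "x \<in> supp ?p"
      proof (rule supp_near_vertex[OF x pR])
        have "d (vertex_point x) ?p \<le> d (vertex_point x) b + d b ?p" by (rule d_tri[OF xR bR pR])
        also have "\<dots> \<le> \<tau> + \<beta>"
          using db ray_dist[OF yR bR, of 0 t1] ray_0[OF yR bR] t1 by simp
        finally have "d (vertex_point x) ?p * (lip + 1) \<le> (\<tau> + \<beta>) * (lip + 1)"
          using lip_nonneg by (intro mult_right_mono) auto
        then show "d (vertex_point x) ?p * (lip + 1) < 1" using \<tau>(3) by simp
      qed
      have step: "tracks ?y b \<beta> \<kappa> x v t'"
        if t: "t \<in> {0..\<tau>}" "\<bar>t - t1\<bar> < \<delta>" and t': "t' \<in> {0..\<tau>}" "\<bar>t' - t1\<bar> < \<delta>"
          and tr: "tracks ?y b \<beta> \<kappa> x v t" for t t'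
      proof -
        have tL: "0 \<le> t" "t \<le> d b ?y" "0 \<le> t'" "t' \<le> d b ?y" using t t' \<tau> by auto
        have tR: "ray ?y b t \<in> R" by (rule ray_in_R[OF yR bR tL(1,2)])
        have "\<bar>wt (side X x v) ?p - wt (side X x v) (ray ?y b t)\<bar> \<le> lip * \<bar>t - t1\<bar>"
          using wt_lipschitz[OF pR tR] ray_dist[OF yR bR t1(1,2) tL(1,2)] by (simp add: abs_minus_commute)
        also have "\<dots> \<le> (lip + 1) * \<bar>t - t1\<bar>" by (simp add: algebra_simps)
        also have "\<dots> < \<beta>" using t(2) lip_nonneg by (simp add: \<delta>_def pos_less_divide_eq mult.commute)
        finally have "\<bar>wt (side X x v) ?p - (\<beta> + \<kappa> * t)\<bar> < \<beta>" using tracks_at[OF tr tL(1,2)] by simp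
        moreover have "0 \<le> \<kappa> * t" using \<kappa> tL by simp
        ultimately have "0 < wt (side X x v) ?p" by linarith
        then obtain w where w: "w \<in> side X x v" "w \<in> supp ?p" using wt_pos_iff[OF cc pR] by blast
        \<comment> \<open>The carrier contains \<open>x\<close> and a vertex of
          \<open>side X x v\<close>, hence \<open>v\<close>, by the very definition of
          \<open>side\<close>.\<close>
        have vp: "v \<in> supp ?p" by (rule sideD[OF w(1) supp_cube[OF cc pR] xp w(2)])
        obtain \<delta>' where \<delta>': "0 < \<delta>'" "\<And>\<tau>. 0 \<le> \<tau> \<Longrightarrow> \<tau> \<le> d b ?y \<Longrightarrow> \<bar>\<tau> - t\<bar> < \<delta>' \<Longrightarrow>
            wt (side X x v) (ray ?y b \<tau>) = \<beta> + \<kappa> * \<tau>"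
          using tr unfolding tracks_def by blast
        show ?thesis
          by (rule tracks_extend[OF yR bR L t1(1,2) \<epsilon> xv xp vp tL(1,2) _ \<delta>' tL(3,4)])
            (use t t' in \<open>auto simp: \<delta>_def\<close>)
      qed
      show "\<exists>T. openin (top_of_set {0..\<tau>}) T \<and> t1 \<in> T \<and>
          (\<forall>s\<in>T. \<forall>t\<in>T. tracks ?y b \<beta> \<kappa> x v s \<longrightarrow> tracks ?y b \<beta> \<kappa> x v t)"
      proof (intro exI[of _ "{0..\<tau>} \<inter> ball t1 \<delta>"] conjI ballI impI)
        show "openin (top_of_set {0..\<tau>}) ({0..\<tau>} \<inter> ball t1 \<delta>)" by (simp add: openin_open_Int)
        show "t1 \<in> {0..\<tau>} \<inter> ball t1 \<delta>" using t1 \<delta> by simp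
        fix s t assume "s \<in> {0..\<tau>} \<inter> ball t1 \<delta>" "t \<in> {0..\<tau>} \<inter> ball t1 \<delta>" "tracks ?y b \<beta> \<kappa> x v s"
        then show "tracks ?y b \<beta> \<kappa> x v t"
          using step[of s t] by (auto simp: dist_real_def abs_minus_commute)
      qed
    qed (use \<tau> in auto)
    then show ?thesis using tracks_at \<tau> by blast
  qed
  show thesis by (rule that[OF bR db L \<kappa>(1) exit formula])
qed

text \<open>Otherwise start on the edge close to \<open>y\<close>: the geodesic reaches
  \<open>y\<close> while the edge is still tracked, so with a positive coordinate, but at the vertex
  point of \<open>y\<close> this coordinate is 0.\<close>

lemma D_sink':
  assumes y: "y \<in> vertices X" and e: "(y, v) \<in> edges X" shows "\<not> D y y v"
proof
  let ?y = "vertex_point y"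
  assume D: "D y y v"
  have yR: "?y \<in> R" by (rule vertex_point_realization[OF cc y])
  \<comment> \<open>The geodesic takes time at most \<open>\<beta>\<close>, so the time limit of
    \<open>near_vertex\<close> follows from \<open>2 * \<beta> * (lip + 1) < 1\<close>; the left
    side is 1/2 here.\<close>
  define \<beta> where "\<beta> = 1 / (4 * (lip + 1))"
  have lip: "0 < lip + 1" using lip_nonneg by simp
  have \<beta>: "0 < \<beta>" "\<beta> < 1" "2 * \<beta> * (lip + 1) < 1"
    using lip_nonneg by (auto simp: \<beta>_def field_simps)
  obtain b \<kappa> where b: "b \<in> R" "d ?y b \<le> \<beta>" "0 < d b ?y" "0 < \<kappa>"
    "\<And>\<tau>. 0 \<le> \<tau> \<Longrightarrow> \<tau> \<le> d b ?y \<Longrightarrow> (\<tau> + \<beta>) * (lip + 1) < 1 \<Longrightarrow>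
      wt (side X y v) (ray ?y b \<tau>) = \<beta> + \<kappa> * \<tau>"
    by (rule near_vertex[OF y e D \<beta>(1,2)]) blast
  have "(d b ?y + \<beta>) * (lip + 1) \<le> 2 * \<beta> * (lip + 1)"
    using b(2) d_sym[of b ?y] lip by (intro mult_right_mono) auto
  then have "wt (side X y v) ?y = \<beta> + \<kappa> * d b ?y"
    using b(5)[of "d b ?y"] b(3) \<beta>(3) ray_end[OF yR b(1)] by simp
  then have "0 < wt (side X y v) ?y" using \<beta> b by (simp add: add_pos_pos)
  then have "y \<in> side X y v" by (simp add: wt_vertex_point split: if_splits)
  then have "v \<in> {y}" using sideD[of y X y v "{y}"] vertex_cube[OF cc y] by simp
  then show False using e by (simp add: edges_def)
qed

text \<open>The cube is the one that the geodesic from \<open>x\<close> to \<open>y\<close> enters: the lower bound on slopes does not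
  degenerate when the base point on an edge tends to \<open>x\<close>.\<close>

lemma D_cube':
  assumes y: "y \<in> vertices X" and x: "x \<in> vertices X"
  shows "\<exists>Q\<in>X. x \<in> Q \<and> (\<forall>v. (x, v) \<in> edges X \<longrightarrow> D y x v \<longrightarrow> v \<in> Q)"
proof (cases "x = y")
  case True
  then show ?thesis using D_sink'[OF y] vertex_cube[OF cc y] by blast
next
  case False
  let ?x = "vertex_point x" and ?y = "vertex_point y"
  have yR: "?y \<in> R" and xR: "?x \<in> R" using vertex_point_realization[OF cc] x y by auto
  have "supp ?x \<noteq> supp ?y" using False by (simp add: supp_vertex_point)
  then have ne: "?x \<noteq> ?y" by auto
  define L where "L = d ?x ?y"
  have L: "0 < L" using ne d_zero[OF xR yR] d_nonneg[of ?x ?y] by (simp add: L_def)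
  have lip: "0 < lip + 1" using lip_nonneg by simp
  \<comment> \<open>A time chosen before \<open>v\<close>, so that one carrier serves all edges; the
    second bound keeps \<open>x\<close> in the support and leaves room for \<open>\<beta>\<close> in
    the time limit of \<open>near_vertex\<close>.\<close>
  define \<tau> where "\<tau> = min (L / 2) (1 / (4 * (lip + 1)))"
  have \<tau>: "0 < \<tau>" "\<tau> \<le> L / 2" "\<tau> * (lip + 1) \<le> 1 / 4"
  proof -
    show "0 < \<tau>" "\<tau> \<le> L / 2" using L lip by (auto simp: \<tau>_def)
    have "\<tau> * (lip + 1) \<le> (1 / (4 * (lip + 1))) * (lip + 1)"
      using lip by (intro mult_right_mono) (auto simp: \<tau>_def)
    also have "(1 / (4 * (lip + 1))) * (lip + 1) = 1 / 4" using lip by (simp add: field_simps)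
    finally show "\<tau> * (lip + 1) \<le> 1 / 4" .
  qed
  let ?q = "ray ?y ?x \<tau>"
  have qR: "?q \<in> R" using ray_in_R[OF yR xR, of \<tau>] \<tau> L by (simp add: L_def)
  have dq: "d ?x ?q = \<tau>" using ray_dist[OF yR xR, of 0 \<tau>] ray_0[OF yR xR] \<tau> L by (simp add: L_def)
  have xq: "x \<in> supp ?q" by (rule supp_near_vertex[OF x qR]) (use dq \<tau> in simp)
  have "v \<in> supp ?q" if e: "(x, v) \<in> edges X" "D y x v" for v
  proof -
    \<comment> \<open>As \<open>\<beta>\<close> is at most 1/2 and the start has distance at most
      \<open>2 * L\<close> from \<open>y\<close>, the slope is at least \<open>1 / (4 * L)\<close>,
      so the coordinate has grown by at least \<open>\<tau> / (4 * L)\<close> at time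
      \<open>\<tau>\<close>. Passing to the geodesic from \<open>x\<close> costs at most
      \<open>2 * \<beta> * lip\<close>, which the factor 8 makes no larger.\<close>
    define M where "M = 8 * L * (lip + 1)"
    have M: "0 < M" using L lip by (simp add: M_def)
    define \<beta> where "\<beta> = min (min (1 / 2) (L / 2)) (min (1 / (4 * (lip + 1))) (\<tau> / M))"
    have \<beta>: "0 < \<beta>" "\<beta> \<le> 1 / 2" "\<beta> \<le> L / 2" "\<beta> \<le> 1 / (4 * (lip + 1))" "\<beta> \<le> \<tau> / M"
    proof -
      show "0 < \<beta>" using L lip \<tau>(1) M by (simp add: \<beta>_def)
      show "\<beta> \<le> 1 / 2" unfolding \<beta>_def by (rule min.coboundedI1[OF min.cobounded1])
      show "\<beta> \<le> L / 2" unfolding \<beta>_def by (rule min.coboundedI1[OF min.cobounded2])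
      show "\<beta> \<le> 1 / (4 * (lip + 1))" unfolding \<beta>_def by (rule min.coboundedI2[OF min.cobounded1])
      show "\<beta> \<le> \<tau> / M" unfolding \<beta>_def by (rule min.coboundedI2[OF min.cobounded2])
    qed
    have "\<beta> * (lip + 1) \<le> (1 / (4 * (lip + 1))) * (lip + 1)"
      using lip \<beta>(4) by (intro mult_right_mono) auto
    also have "(1 / (4 * (lip + 1))) * (lip + 1) = 1 / 4" using lip by (simp add: field_simps)
    finally have b2: "\<beta> * (lip + 1) \<le> 1 / 4" .
    have b3: "\<beta> * M \<le> \<tau>" using \<beta>(5) M by (simp add: field_simps)
    have \<beta>1: "\<beta> < 1" using \<beta> by simp
    obtain b \<kappa> where b: "b \<in> R" "d ?x b \<le> \<beta>" "0 < d b ?y" "0 < \<kappa>"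
      "1 \<le> \<beta> + \<kappa> * d b ?y"
      "\<And>\<tau>. 0 \<le> \<tau> \<Longrightarrow> \<tau> \<le> d b ?y \<Longrightarrow> (\<tau> + \<beta>) * (lip + 1) < 1 \<Longrightarrow>
        wt (side X x v) (ray ?y b \<tau>) = \<beta> + \<kappa> * \<tau>"
      by (rule near_vertex[OF y e \<beta>(1) \<beta>1]) blast
    have Lb: "d b ?y \<le> 2 * L" "\<tau> \<le> d b ?y"
      using d_tri[OF b(1) xR yR] d_tri[OF xR b(1) yR] d_sym[of b ?x] b(2) \<beta>(3) \<tau>(2) L
      by (auto simp: L_def)
    have "(\<tau> + \<beta>) * (lip + 1) < 1" using \<tau>(3) b2 by (simp add: algebra_simps)
    then have w: "wt (side X x v) (ray ?y b \<tau>) = \<beta> + \<kappa> * \<tau>" using b(6)[of \<tau>] Lb(2) \<tau>(1) by simp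
    have "1 / 2 \<le> \<kappa> * d b ?y" using b(5) \<beta>(2) by simp
    also have "\<dots> \<le> \<kappa> * (2 * L)" using Lb(1) b(4) by (intro mult_left_mono) auto
    finally have \<kappa>: "1 \<le> \<kappa> * (4 * L)" by simp
    have bt: "ray ?y b \<tau> \<in> R" using ray_in_R[OF yR b(1), of \<tau>] Lb \<tau>(1) by simp
    have "d ?q (ray ?y b \<tau>) \<le> 2 * d ?x b"
      by (rule ray_close[OF yR xR b(1)]) (use \<tau> Lb L in \<open>auto simp: L_def\<close>)
    also have "\<dots> \<le> 2 * \<beta>" using b(2) by simp
    finally have "lip * d ?q (ray ?y b \<tau>) \<le> lip * (2 * \<beta>)" using lip_nonneg by (intro mult_left_mono)
    then have "wt (side X x v) (ray ?y b \<tau>) - wt (side X x v) ?q \<le> lip * (2 * \<beta>)"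
      using wt_lipschitz[OF qR bt, of "side X x v"] by linarith
    then have lower: "\<beta> + \<kappa> * \<tau> - 2 * \<beta> * lip \<le> wt (side X x v) ?q" using w by (simp add: algebra_simps)
    have "2 * \<beta> * lip < \<kappa> * \<tau> + \<beta>"
    proof -
      have "2 * \<beta> * lip * (4 * L) \<le> \<beta> * M"
        using \<beta>(1) L lip_nonneg by (simp add: M_def algebra_simps)
      also have "\<dots> \<le> \<tau>" by (rule b3)
      also have "\<dots> \<le> \<tau> * (\<kappa> * (4 * L))" using \<kappa> \<tau>(1) by simp
      finally have "2 * \<beta> * lip * (4 * L) \<le> \<kappa> * \<tau> * (4 * L)" by (simp add: mult_ac)
      then have "2 * \<beta> * lip \<le> \<kappa> * \<tau>" by (rule mult_right_le_imp_le) (use L in simp)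
      then show ?thesis using \<beta>(1) by simp
    qed
    then have "0 < wt (side X x v) ?q" using lower by linarith
    then obtain w where "w \<in> side X x v" "w \<in> supp ?q" using wt_pos_iff[OF cc qR] by blast
    then show ?thesis using sideD[OF _ supp_cube[OF cc qR] xq] by blast
  qed
  then show ?thesis using supp_cube[OF cc qR] xq by blast
qed

section \<open>Connectedness of the 1-skeleton\<close>

lemma cube_connected:
  assumes "Q \<in> X" "a \<in> Q" "b \<in> Q" shows "(a, b) \<in> (edges X)\<^sup>*"
proof -
  obtain k \<phi> where c: "cube_chart X Q k \<phi>" "\<phi> {} = a" using based_chart_exists[OF cc assms(1,2)] .
  have "b \<in> \<phi> ` Pow {..<k}" using cube_chart_image[OF c(1)] assms(3) by simp
  then obtain A where A: "A \<subseteq> {..<k}" "b = \<phi> A" by auto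
  have "finite A" using A(1) finite_subset by blast
  then have "(\<phi> {}, \<phi> A) \<in> (edges X)\<^sup>*" using A(1)
  proof (induction A rule: finite_induct)
    case (insert i A)
    then have "(\<phi> A, \<phi> (insert i A)) \<in> edges X"
      using chart_edge[OF cc c(1), of A i] by (simp add: edges_def)
    then show ?case using insert by simp
  qed simp
  then show ?thesis using A c by simp
qed

text \<open>Follow a string between the two vertex points: consecutive supports lie in a common
  cube, and a cube is connected by edges.\<close>

lemma vertices_connected:
  assumes x: "x \<in> vertices X" and y: "y \<in> vertices X" shows "(x, y) \<in> (edges X)\<^sup>*"
proof -
  have R: "vertex_point x \<in> R" "vertex_point y \<in> R" using vertex_point_realization[OF cc] x y by auto
  obtain s where "s \<in> string_lengths X (vertex_point x) (vertex_point y)"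
    using string_exists[OF R] by blast
  then obtain m z l where z: "z 0 = vertex_point x" "z m = vertex_point y" "\<And>i. i \<le> m \<Longrightarrow> z i \<in> R"
    and seg: "\<forall>i<m. cube_segment X (z i) (z (Suc i)) (l i)"
    unfolding string_lengths_def by auto
  have "\<forall>v\<in>supp (z j). (x, v) \<in> (edges X)\<^sup>*" if "j \<le> m" for j
    using that
  proof (induction j)
    case 0
    then show ?case by (simp add: z supp_vertex_point)
  next
    case (Suc j)
    have "cube_segment X (z j) (z (Suc j)) (l j)" using seg Suc by simp
    then obtain Q k \<phi> u w where c: "cube_chart X Q k \<phi>" "z j = cube_point k \<phi> u" "z (Suc j) = cube_point k \<phi> w"
      by (rule cube_segmentE)
    have sub: "supp (z j) \<subseteq> Q" "supp (z (Suc j)) \<subseteq> Q"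
      unfolding c(2,3) using supp_cube_point_subset[OF c(1)] by auto
    obtain a where a: "a \<in> supp (z j)" using supp_nonempty[OF cc z(3)[of j]] Suc by auto
    have "(x, a) \<in> (edges X)\<^sup>*" using Suc a by simp
    then show ?case
      using cube_connected[OF cube_chart_in[OF c(1)]] a sub by (meson rtrancl_trans subsetD)
  qed
  from this[of m] show ?thesis by (simp add: z supp_vertex_point)
qed

lemma oriented: "oriented_complex X D"
  by unfold_locales
    (auto simp: cc vertices_connected D_flip' D_sink' intro: D_cube' D_parallel'[THEN iffD1] D_parallel'[THEN iffD2])

end

section \<open>Dehn--Sommerville relations\<close>

text \<open>With the empty simplex counted and cardinality in place of dimension, the alternating
  sum is 1 minus the Euler characteristic, that is, minus the reduced one, which for a sphere is a
  single sign.\<close>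

lemma eulerian_sphere_alternating_sum:
  fixes L :: "'a set set"
  assumes L: "eulerian_sphere (int n - 1) L" and \<sigma>: "\<sigma> \<in> L" "card \<sigma> \<le> n"
  shows "(\<Sum>\<tau>\<in>simplex_link L \<sigma>. (-1) ^ card \<tau>) = (-1 :: int) ^ (n - card \<sigma>)"
proof -
  let ?K = "simplex_link L \<sigma>"
  have sc: "finite_simplicial_complex L" using L by (simp add: eulerian_sphere_def)
  have fin: "finite ?K" and 0: "{} \<in> ?K"
    using sc \<sigma> by (auto simp: finite_simplicial_complex_def simplex_link_def)
  have "(-1 :: int) ^ card \<tau> = - ((-1) ^ nat (simplex_dim \<tau>))" if \<tau>: "\<tau> \<in> ?K - {{}}" for \<tau>
  proof -
    have "finite \<tau>" using sc \<tau> by (auto simp: finite_simplicial_complex_def simplex_link_def)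
    then obtain m where m: "card \<tau> = Suc m" using \<tau> by (cases "card \<tau>") auto
    then show ?thesis by (simp add: simplex_dim_def)
  qed
  then have "(\<Sum>\<tau>\<in>?K - {{}}. (-1 :: int) ^ card \<tau>) = - euler_char ?K"
    by (simp add: euler_char_def sum_negf)
  then have "(\<Sum>\<tau>\<in>?K. (-1 :: int) ^ card \<tau>) = 1 - euler_char ?K"
    using sum.remove[OF fin 0, of "\<lambda>\<tau>. (-1 :: int) ^ card \<tau>"] by simp
  also have "euler_char ?K = sphere_euler_char (int n - 1 - simplex_dim \<sigma> - 1)"
    using L \<sigma> by (simp add: eulerian_sphere_def)
  also have "1 - \<dots> = (-1) ^ (n - card \<sigma>)"
  proof (cases "card \<sigma> = n")
    \<comment> \<open>The comparison sphere has dimension -1 and Euler characteristic 0.\<close>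
    case True
    then show ?thesis by (simp add: simplex_dim_def sphere_euler_char_def)
  next
    case False
    then obtain m where m: "n = card \<sigma> + Suc m" using \<sigma>(2) less_natE le_neq_implies_less by (metis add_Suc_right)
    then show ?thesis by (simp add: simplex_dim_def sphere_euler_char_def)
  qed
  finally show ?thesis .
qed

lemma eulerian_sphere_card_le:
  assumes L: "eulerian_sphere (int n - 1) L" and \<sigma>: "\<sigma> \<in> L"
  shows "card \<sigma> \<le> n"
proof -
  have sc: "finite L" "\<And>\<sigma>. \<sigma> \<in> L \<Longrightarrow> finite \<sigma>"
    using L by (auto simp: eulerian_sphere_def finite_simplicial_complex_def)
  obtain \<tau> where \<tau>: "\<tau> \<in> L" "\<sigma> \<subseteq> \<tau>" "\<And>\<rho>. \<rho> \<in> L \<Longrightarrow> \<tau> \<subseteq> \<rho> \<Longrightarrow> \<tau> = \<rho>"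
    using finite_has_maximal2[OF sc(1) \<sigma>] by auto
  then have "simplex_dim \<tau> = int n - 1"
    using L unfolding eulerian_sphere_def pure_of_dim_def by blast
  then show ?thesis using card_mono[OF sc(2)[OF \<tau>(1)] \<tau>(2)] by (simp add: simplex_dim_def)
qed

lemma sum_Pow_power_card:
  fixes s :: "'r::comm_ring_1"
  assumes "finite A" shows "(\<Sum>B\<in>Pow A. s ^ card B) = (1 + s) ^ card A"
proof -
  have "(\<Sum>B\<in>Pow A. s ^ card B) = (\<Sum>B\<in>Pow A. \<Prod>i\<in>A. if i \<in> B then s else 1)"
  proof (rule sum.cong)
    fix B assume "B \<in> Pow A"
    then have "A \<inter> {x. x \<in> B} = B" by auto
    then show "s ^ card B = (\<Prod>i\<in>A. if i \<in> B then s else 1)"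
      using prod.If_cases[OF assms, of "\<lambda>i. i \<in> B" "\<lambda>_. s" "\<lambda>_. 1"] by simp
  qed simp
  also have "\<dots> = (1 + s) ^ card A" by (simp add: sum_Pow_prod_if[OF assms] add.commute)
  finally show ?thesis .
qed

text \<open>Expand \<open>(- 1 - s) ^ card \<tau>\<close> over the faces \<open>\<rho>\<close> of
  \<open>\<tau>\<close> and exchange the sums. The simplices above \<open>\<rho>\<close> correspond
  to the link of \<open>\<sigma> \<union> \<rho>\<close>, whose alternating sum is a sign; combined
  with \<open>(-1) ^ card \<rho>\<close> it no longer depends on \<open>\<rho>\<close>.\<close>

lemma dehn_sommerville:
  fixes L :: "'a set set" and s :: "'r::comm_ring_1"
  assumes L: "eulerian_sphere (int n - 1) L" and \<sigma>: "\<sigma> \<in> L"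
  shows "(\<Sum>\<tau>\<in>simplex_link L \<sigma>. (- 1 - s) ^ card \<tau>) =
    (-1) ^ (n - card \<sigma>) * (\<Sum>\<tau>\<in>simplex_link L \<sigma>. s ^ card \<tau>)"
proof -
  let ?K = "simplex_link L \<sigma>"
  have sc: "finite L" "\<And>\<sigma>. \<sigma> \<in> L \<Longrightarrow> finite \<sigma>" "\<And>\<sigma> \<tau>. \<sigma> \<in> L \<Longrightarrow> \<tau> \<subseteq> \<sigma> \<Longrightarrow> \<tau> \<in> L"
    using L by (auto simp: eulerian_sphere_def finite_simplicial_complex_def)
  have K: "finite ?K" "\<And>\<tau>. \<tau> \<in> ?K \<Longrightarrow> finite \<tau>" using sc by (auto simp: simplex_link_def)
  have down: "\<rho> \<in> ?K" if "\<tau> \<in> ?K" "\<rho> \<subseteq> \<tau>" for \<rho> \<tau>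
  proof -
    have "\<tau> \<in> L" "\<tau> \<inter> \<sigma> = {}" "\<tau> \<union> \<sigma> \<in> L" using that by (auto simp: simplex_link_def)
    then have "\<rho> \<in> L" "\<rho> \<union> \<sigma> \<in> L" "\<rho> \<inter> \<sigma> = {}"
      using that(2) sc(3)[of \<tau> \<rho>] sc(3)[of "\<tau> \<union> \<sigma>" "\<rho> \<union> \<sigma>"] by auto
    then show ?thesis by (simp add: simplex_link_def)
  qed
  have inner: "(\<Sum>\<tau>\<in>{\<tau> \<in> ?K. \<rho> \<subseteq> \<tau>}. (-1) ^ card \<tau>) = (-1 :: 'r) ^ card \<rho> * (-1) ^ (n - card \<sigma> - card \<rho>)"
    if \<rho>: "\<rho> \<in> ?K" for \<rho>
  proof -
    have \<rho>': "\<sigma> \<union> \<rho> \<in> L" "\<rho> \<inter> \<sigma> = {}" using \<rho> by (auto simp: simplex_link_def Un_commute)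
    have fin: "finite \<rho>" "finite \<sigma>" using K(2)[OF \<rho>] sc(2)[OF \<sigma>] by auto
    have card: "card (\<sigma> \<union> \<rho>) = card \<sigma> + card \<rho>"
      using fin \<rho>'(2) by (intro card_Un_disjoint) auto
    \<comment> \<open>The link of \<open>\<rho>\<close> in the link of \<open>\<sigma>\<close> is
      the link of \<open>\<sigma> \<union> \<rho>\<close>; adding \<open>\<rho>\<close> back
      parametrizes the simplices above it.\<close>
    have bij: "bij_betw (\<lambda>\<tau>. \<tau> \<union> \<rho>) (simplex_link L (\<sigma> \<union> \<rho>)) {\<tau> \<in> ?K. \<rho> \<subseteq> \<tau>}"
    proof (rule bij_betw_byWitness[where f' = "\<lambda>\<tau>. \<tau> - \<rho>"])
      show "\<forall>\<tau>\<in>simplex_link L (\<sigma> \<union> \<rho>). (\<tau> \<union> \<rho>) - \<rho> = \<tau>" by (auto simp: simplex_link_def)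
      show "\<forall>\<tau>\<in>{\<tau> \<in> ?K. \<rho> \<subseteq> \<tau>}. (\<tau> - \<rho>) \<union> \<rho> = \<tau>" by auto
      show "(\<lambda>\<tau>. \<tau> \<union> \<rho>) ` simplex_link L (\<sigma> \<union> \<rho>) \<subseteq> {\<tau> \<in> ?K. \<rho> \<subseteq> \<tau>}"
      proof safe
        fix \<tau> assume "\<tau> \<in> simplex_link L (\<sigma> \<union> \<rho>)"
        then have \<tau>: "\<tau> \<inter> (\<sigma> \<union> \<rho>) = {}" "\<tau> \<union> (\<sigma> \<union> \<rho>) \<in> L" by (auto simp: simplex_link_def)
        have "\<tau> \<union> \<rho> \<in> L" by (rule sc(3)[OF \<tau>(2)]) auto
        moreover have "(\<tau> \<union> \<rho>) \<union> \<sigma> = \<tau> \<union> (\<sigma> \<union> \<rho>)" by auto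
        ultimately show "\<tau> \<union> \<rho> \<in> ?K" using \<tau> \<rho>'(2) by (auto simp: simplex_link_def)
      qed
      show "(\<lambda>\<tau>. \<tau> - \<rho>) ` {\<tau> \<in> ?K. \<rho> \<subseteq> \<tau>} \<subseteq> simplex_link L (\<sigma> \<union> \<rho>)"
      proof safe
        fix \<tau> assume "\<tau> \<in> ?K" "\<rho> \<subseteq> \<tau>"
        then have \<tau>: "\<tau> \<in> L" "\<tau> \<inter> \<sigma> = {}" "\<tau> \<union> \<sigma> \<in> L" by (auto simp: simplex_link_def)
        have "(\<tau> - \<rho>) \<union> (\<sigma> \<union> \<rho>) = \<tau> \<union> \<sigma>" using \<open>\<rho> \<subseteq> \<tau>\<close> by auto
        then show "\<tau> - \<rho> \<in> simplex_link L (\<sigma> \<union> \<rho>)"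
          using \<tau> sc(3)[OF \<tau>(1), of "\<tau> - \<rho>"] by (auto simp: simplex_link_def)
      qed
    qed
    have "(\<Sum>\<tau>\<in>{\<tau> \<in> ?K. \<rho> \<subseteq> \<tau>}. (-1) ^ card \<tau>) = (\<Sum>\<tau>\<in>simplex_link L (\<sigma> \<union> \<rho>). (-1 :: 'r) ^ card (\<tau> \<union> \<rho>))"
      by (rule sum.reindex_bij_betw[OF bij, symmetric])
    also have "\<dots> = (\<Sum>\<tau>\<in>simplex_link L (\<sigma> \<union> \<rho>). (-1) ^ card \<rho> * (-1) ^ card \<tau>)"
    proof (rule sum.cong)
      fix \<tau> assume \<tau>: "\<tau> \<in> simplex_link L (\<sigma> \<union> \<rho>)"
      then have "finite \<tau>" "\<tau> \<inter> \<rho> = {}" using sc(2) by (auto simp: simplex_link_def)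
      then show "(-1 :: 'r) ^ card (\<tau> \<union> \<rho>) = (-1) ^ card \<rho> * (-1) ^ card \<tau>"
        using fin by (simp add: card_Un_disjoint power_add mult.commute)
    qed simp
    also have "\<dots> = (-1) ^ card \<rho> * of_int (\<Sum>\<tau>\<in>simplex_link L (\<sigma> \<union> \<rho>). (-1) ^ card \<tau>)"
      by (simp add: sum_distrib_left)
    also have "\<dots> = (-1) ^ card \<rho> * (-1) ^ (n - card \<sigma> - card \<rho>)"
      using eulerian_sphere_alternating_sum[OF L \<rho>'(1) eulerian_sphere_card_le[OF L \<rho>'(1)]] card
      by simp
    finally show ?thesis .
  qed
  have "(\<Sum>\<tau>\<in>?K. (- 1 - s) ^ card \<tau>) = (\<Sum>\<tau>\<in>?K. \<Sum>\<rho>\<in>Pow \<tau>. (-1) ^ card \<tau> * s ^ card \<rho>)"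
  proof (rule sum.cong)
    fix \<tau> assume "\<tau> \<in> ?K"
    have "(- 1 - s) ^ card \<tau> = (-1) ^ card \<tau> * (1 + s) ^ card \<tau>"
      by (simp flip: power_mult_distrib)
    then show "(- 1 - s) ^ card \<tau> = (\<Sum>\<rho>\<in>Pow \<tau>. (-1) ^ card \<tau> * s ^ card \<rho>)"
      by (simp add: sum_Pow_power_card[OF K(2)[OF \<open>\<tau> \<in> ?K\<close>]] flip: sum_distrib_left)
  qed simp
  also have "\<dots> = (\<Sum>\<tau>\<in>?K. \<Sum>\<rho>\<in>{\<rho> \<in> ?K. \<rho> \<subseteq> \<tau>}. (-1) ^ card \<tau> * s ^ card \<rho>)"
    using down by (intro sum.cong) auto
  also have "\<dots> = (\<Sum>\<rho>\<in>?K. \<Sum>\<tau>\<in>{\<tau> \<in> ?K. \<rho> \<subseteq> \<tau>}. (-1) ^ card \<tau> * s ^ card \<rho>)"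
    using sum.swap_restrict[OF K(1) K(1), of "\<lambda>\<tau> \<rho>. (-1) ^ card \<tau> * s ^ card \<rho>" "\<lambda>\<tau> \<rho>. \<rho> \<subseteq> \<tau>"]
    by simp
  also have "\<dots> = (\<Sum>\<rho>\<in>?K. (-1) ^ (n - card \<sigma>) * s ^ card \<rho>)"
  proof (rule sum.cong)
    fix \<rho> assume \<rho>: "\<rho> \<in> ?K"
    then have \<rho>': "\<sigma> \<union> \<rho> \<in> L" "\<rho> \<inter> \<sigma> = {}" by (auto simp: simplex_link_def Un_commute)
    have "card (\<sigma> \<union> \<rho>) = card \<sigma> + card \<rho>"
      using sc(2)[OF \<sigma>] K(2)[OF \<rho>] \<rho>'(2) by (intro card_Un_disjoint) auto
    then have "card \<sigma> + card \<rho> \<le> n" using eulerian_sphere_card_le[OF L \<rho>'(1)] by simp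
    then have "(-1 :: 'r) ^ card \<rho> * (-1) ^ (n - card \<sigma> - card \<rho>) = (-1) ^ (n - card \<sigma>)"
      by (simp flip: power_add)
    then show "(\<Sum>\<tau>\<in>{\<tau> \<in> ?K. \<rho> \<subseteq> \<tau>}. (-1) ^ card \<tau> * s ^ card \<rho>) = (-1) ^ (n - card \<sigma>) * s ^ card \<rho>"
      using inner[OF \<rho>] by (simp flip: sum_distrib_right)
  qed simp
  finally show ?thesis by (simp add: sum_distrib_left)
qed

section \<open>Links of cubes\<close>

definition link_simplex :: "'v set set \<Rightarrow> 'v set \<Rightarrow> 'v set \<Rightarrow> 'v set set" where
  "link_simplex X P Q = {R \<in> X. P \<subseteq> R \<and> R \<subseteq> Q \<and> cube_dim R = Suc (cube_dim P)}"

lemma cube_link_image: "cube_link X P = link_simplex X P ` {Q \<in> X. P \<subseteq> Q}"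
  by (simp add: cube_link_def link_simplex_def)

context
  fixes X :: "'v set set"
  assumes cc: "cube_complex X"
begin

lemma link_simplex_chart:
  assumes c: "cube_chart X Q k \<phi>" and J: "J \<subseteq> {..<k}"
  shows "link_simplex X (\<phi> ` Pow J) Q = (\<lambda>i. \<phi> ` Pow (insert i J)) ` ({..<k} - J)"
proof (intro subset_antisym subsetI)
  fix R assume "R \<in> link_simplex X (\<phi> ` Pow J) Q"
  then have R: "R \<in> X" "\<phi> ` Pow J \<subseteq> R" "R \<subseteq> Q" "cube_dim R = Suc (card J)"
    using pow_face(2)[OF cc c J] by (auto simp: link_simplex_def)
  have "\<phi> {} \<in> R" using R(2) by auto
  then obtain J' where J': "J' \<subseteq> {..<k}" "R = \<phi> ` Pow J'" "cube_dim R = card J'"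
    by (rule face_at_base[OF cc c R(1,3)])
  have sub: "J \<subseteq> J'" using R(2) pow_face_subset[OF cc c J J'(1)] J'(2) by simp
  have fin: "finite J'" using J'(1) finite_subset by blast
  have "card (J' - J) = 1" using card_Diff_subset[OF finite_subset[OF sub fin] sub] R(4) J'(3) by simp
  then obtain i where i: "J' - J = {i}" by (auto simp: card_1_singleton_iff)
  have "J' = insert i J" using i sub by blast
  moreover have "i \<in> {..<k} - J" using i J'(1) by blast
  ultimately show "R \<in> (\<lambda>i. \<phi> ` Pow (insert i J)) ` ({..<k} - J)" using J'(2) by blast
next
  fix R assume "R \<in> (\<lambda>i. \<phi> ` Pow (insert i J)) ` ({..<k} - J)"
  then obtain i where i: "i < k" "i \<notin> J" "R = \<phi> ` Pow (insert i J)" by auto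
  have iJ: "insert i J \<subseteq> {..<k}" using i J by simp
  have fin: "finite J" using J finite_subset by blast
  have "R \<in> X" "cube_dim R = Suc (card J)" using pow_face[OF cc c iJ] i fin by auto
  moreover have "\<phi> ` Pow J \<subseteq> R" "R \<subseteq> Q"
    using i(3) image_mono[of "Pow (insert i J)" "Pow {..<k}" \<phi>] iJ cube_chart_image[OF c] by auto
  ultimately show "R \<in> link_simplex X (\<phi> ` Pow J) Q"
    using pow_face(2)[OF cc c J] by (simp add: link_simplex_def)
qed

lemma based_subcube:
  assumes "P \<in> X" "Q \<in> X" "P \<subseteq> Q"
  obtains k \<phi> J where "cube_chart X Q k \<phi>" "J \<subseteq> {..<k}" "P = \<phi> ` Pow J"
    "cube_dim Q = k" "cube_dim P = card J"
proof -
  obtain x where x: "x \<in> P" using cube_nonempty[OF cc assms(1)] by blast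
  obtain k \<phi> where c: "cube_chart X Q k \<phi>" "\<phi> {} = x"
    using based_chart_exists[OF cc assms(2), of x] x assms(3) by blast
  have "\<phi> {} \<in> P" using c x by simp
  then obtain J where "J \<subseteq> {..<k}" "P = \<phi> ` Pow J" "cube_dim P = card J"
    by (rule face_at_base[OF cc c(1) assms(1,3)])
  then show thesis using that c(1) cube_chart_dim[OF c(1)] by blast
qed

lemma card_link_simplex:
  assumes "P \<in> X" "Q \<in> X" "P \<subseteq> Q"
  shows "finite (link_simplex X P Q)" "card (link_simplex X P Q) + cube_dim P = cube_dim Q"
proof -
  obtain k \<phi> J where c: "cube_chart X Q k \<phi>" and J: "J \<subseteq> {..<k}" "P = \<phi> ` Pow J"
    and dim: "cube_dim Q = k" "cube_dim P = card J" using based_subcube[OF assms] .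
  have fin: "finite J" using J(1) finite_subset by blast
  have inj: "inj_on (\<lambda>i. \<phi> ` Pow (insert i J)) ({..<k} - J)"
  proof (rule inj_onI)
    fix i j assume ij: "i \<in> {..<k} - J" "j \<in> {..<k} - J" "\<phi> ` Pow (insert i J) = \<phi> ` Pow (insert j J)"
    then have "insert i J \<subseteq> insert j J"
      using pow_face_subset[OF cc c, of "insert i J" "insert j J"] J(1) by simp
    then show "i = j" using ij by auto
  qed
  show "finite (link_simplex X P Q)" unfolding J(2) link_simplex_chart[OF c J(1)] by simp
  have "card (link_simplex X P Q) = card ({..<k} - J)"
    unfolding J(2) link_simplex_chart[OF c J(1)] by (rule card_image[OF inj])
  also have "\<dots> = k - card J" using J(1) fin by (simp add: card_Diff_subset)
  finally show "card (link_simplex X P Q) + cube_dim P = cube_dim Q"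
    using dim card_mono[OF finite_lessThan J(1)] by simp
qed

text \<open>If every direction of \<open>Q\<close> at \<open>P\<close> also lies in
  \<open>Q'\<close>, then the face \<open>Q \<inter> Q'\<close> of \<open>Q\<close> has all
  directions of \<open>Q\<close> and equals \<open>Q\<close>. In particular distinct cubes give
  distinct simplices, so sums over the link are sums over cubes.\<close>

lemma link_simplex_subset_iff:
  assumes P: "P \<in> X" and Q: "Q \<in> X" "P \<subseteq> Q" and Q': "Q' \<in> X" "P \<subseteq> Q'"
  shows "link_simplex X P Q \<subseteq> link_simplex X P Q' \<longleftrightarrow> Q \<subseteq> Q'"
proof
  assume sub: "link_simplex X P Q \<subseteq> link_simplex X P Q'"
  obtain k \<phi> J where c: "cube_chart X Q k \<phi>" and J: "J \<subseteq> {..<k}" "P = \<phi> ` Pow J"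
    using based_subcube[OF P Q] by metis
  have 0: "\<phi> {} \<in> P" using J by auto
  have "Q \<inter> Q' \<in> X" using cube_inter[OF cc Q(1) Q'(1), of "\<phi> {}"] 0 Q Q' by blast
  moreover have "\<phi> {} \<in> Q \<inter> Q'" using 0 Q Q' by blast
  ultimately obtain J' where J': "J' \<subseteq> {..<k}" "Q \<inter> Q' = \<phi> ` Pow J'"
    using face_at_base[OF cc c _ Int_lower1] by metis
  have JJ': "J \<subseteq> J'"
    using pow_face_subset[OF cc c J(1) J'(1)] Q(2) Q'(2) J(2) J'(2) by auto
  have "i \<in> J'" if i: "i < k" for i
  proof (cases "i \<in> J")
    case False
    have "\<phi> ` Pow (insert i J) \<in> link_simplex X P Q"
      unfolding J(2) link_simplex_chart[OF c J(1)] using i False by blast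
    then have "\<phi> ` Pow (insert i J) \<subseteq> Q \<inter> Q'" using sub by (auto simp: link_simplex_def)
    then have "insert i J \<subseteq> J'" using pow_face_subset[OF cc c, of "insert i J" J'] i J J' by simp
    then show ?thesis by simp
  qed (use JJ' in blast)
  then have "J' = {..<k}" using J'(1) by auto
  then have "Q \<inter> Q' = Q" using J'(2) cube_chart_image[OF c] by simp
  then show "Q \<subseteq> Q'" by blast
qed (auto simp: link_simplex_def)

lemma link_simplex_inj: "P \<in> X \<Longrightarrow> inj_on (link_simplex X P) {Q \<in> X. P \<subseteq> Q}"
  by (rule inj_onI) (metis (no_types, lifting) link_simplex_subset_iff mem_Collect_eq order_antisym order_refl)

lemma f_polynomial_link:
  assumes P: "P \<in> X"
  shows "poly (f_polynomial (cube_link X P)) s = (\<Sum>Q\<in>{Q \<in> X. P \<subseteq> Q}. s ^ (cube_dim Q - cube_dim P))"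
proof -
  have "poly (f_polynomial (cube_link X P)) s = (\<Sum>\<sigma>\<in>cube_link X P. s ^ card \<sigma>)"
    by (simp add: f_polynomial_def poly_sum poly_monom)
  also have "\<dots> = (\<Sum>Q\<in>{Q \<in> X. P \<subseteq> Q}. s ^ card (link_simplex X P Q))"
    unfolding cube_link_image by (rule sum.reindex[OF link_simplex_inj[OF P], unfolded o_def])
  also have "\<dots> = (\<Sum>Q\<in>{Q \<in> X. P \<subseteq> Q}. s ^ (cube_dim Q - cube_dim P))"
  proof (rule sum.cong)
    fix Q assume "Q \<in> {Q \<in> X. P \<subseteq> Q}"
    then have "card (link_simplex X P Q) = cube_dim Q - cube_dim P"
      using card_link_simplex(2)[OF P, of Q] by simp
    then show "s ^ card (link_simplex X P Q) = s ^ (cube_dim Q - cube_dim P)" by simp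
  qed simp
  finally show ?thesis .
qed

lemma cube_dim_vertex: "cube_dim {v} = 0"
  by (rule cube_dim_eqI) simp

text \<open>The Eulerian condition speaks of links of vertices only. The link of a cube
  \<open>P\<close> is recovered as the link of the simplex of \<open>P\<close> in the link of any
  vertex \<open>v\<close> of \<open>P\<close>.\<close>

lemma link_of_cube_bij:
  assumes P: "P \<in> X" and v: "v \<in> P" and L: "finite_simplicial_complex (cube_link X {v})"
  shows "bij_betw (\<lambda>Q. link_simplex X {v} Q - link_simplex X {v} P) {Q \<in> X. P \<subseteq> Q}
    (simplex_link (cube_link X {v}) (link_simplex X {v} P))"
proof -
  let ?l = "link_simplex X {v}"
  have vX: "{v} \<in> X" using cube_vertex[OF cc P v] .
  have mono: "?l P \<subseteq> ?l Q \<longleftrightarrow> P \<subseteq> Q" if "Q \<in> X" "v \<in> Q" for Q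
    using link_simplex_subset_iff[OF vX P _ that(1)] v that by simp
  have mem: "?l Q \<in> cube_link X {v}" if "Q \<in> X" "v \<in> Q" for Q
    unfolding cube_link_image using that by blast
  have l_inj: "?l Q = ?l Q' \<Longrightarrow> Q = Q'" if "Q \<in> X" "v \<in> Q" "Q' \<in> X" "v \<in> Q'" for Q Q'
    using inj_onD[OF link_simplex_inj[OF vX], of Q Q'] that by simp
  show ?thesis
  proof (rule bij_betw_imageI[OF inj_onI], goal_cases inj image)
    case (inj Q Q')
    have Q: "Q \<in> {Q \<in> X. P \<subseteq> Q}" and Q': "Q' \<in> {Q \<in> X. P \<subseteq> Q}" and eq: "?l Q - ?l P = ?l Q' - ?l P"
      by fact+
    have "?l P \<subseteq> ?l Q" "?l P \<subseteq> ?l Q'" using mono Q Q' v by blast+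
    then have "?l Q = ?l Q'" using eq by blast
    then show "Q = Q'" using l_inj Q Q' v by blast
  next
    case image
    show ?case
    proof (intro subset_antisym subsetI)
      fix \<tau> assume "\<tau> \<in> (\<lambda>Q. ?l Q - ?l P) ` {Q \<in> X. P \<subseteq> Q}"
      then obtain Q where Q: "Q \<in> X" "P \<subseteq> Q" "\<tau> = ?l Q - ?l P" by auto
      have vQ: "v \<in> Q" using Q v by blast
      have un: "\<tau> \<union> ?l P = ?l Q" using Q mono[OF Q(1) vQ] by blast
      have "\<tau> \<in> cube_link X {v}"
        using L mem[OF Q(1) vQ] Q(3) unfolding finite_simplicial_complex_def by blast
      then show "\<tau> \<in> simplex_link (cube_link X {v}) (?l P)"
        using un mem[OF Q(1) vQ] Q(3) by (auto simp: simplex_link_def)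
    next
      fix \<tau> assume "\<tau> \<in> simplex_link (cube_link X {v}) (?l P)"
      then have \<tau>: "\<tau> \<inter> ?l P = {}" "\<tau> \<union> ?l P \<in> cube_link X {v}" by (auto simp: simplex_link_def)
      then obtain Q where Q: "Q \<in> X" "v \<in> Q" "\<tau> \<union> ?l P = ?l Q" unfolding cube_link_image by auto
      then have "P \<subseteq> Q" using mono[OF Q(1,2)] by blast
      moreover have "\<tau> = ?l Q - ?l P" using Q(3) \<tau>(1) by blast
      ultimately show "\<tau> \<in> (\<lambda>Q. ?l Q - ?l P) ` {Q \<in> X. P \<subseteq> Q}" using Q(1) by blast
    qed
  qed
qed

lemma eulerian_dim_le:
  assumes "eulerian_manifold n X" "Q \<in> X" shows "cube_dim Q \<le> n"
proof -
  obtain v where v: "v \<in> Q" using cube_nonempty[OF cc assms(2)] by blast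
  have vX: "{v} \<in> X" using cube_vertex[OF cc assms(2) v] .
  have "v \<in> vertices X" using v assms(2) by (auto simp: vertices_def)
  then have e: "eulerian_sphere (int n - 1) (cube_link X {v})"
    using assms(1) by (simp add: eulerian_manifold_def)
  have "link_simplex X {v} Q \<in> cube_link X {v}" unfolding cube_link_image using assms(2) v by blast
  then have "card (link_simplex X {v} Q) \<le> n" by (rule eulerian_sphere_card_le[OF e])
  then show ?thesis using card_link_simplex(2)[OF vX assms(2)] v by (simp add: cube_dim_vertex)
qed

lemma dehn_sommerville_cube:
  fixes s :: "'r::comm_ring_1"
  assumes "eulerian_manifold n X" and P: "P \<in> X"
  shows "(\<Sum>Q\<in>{Q \<in> X. P \<subseteq> Q}. (- 1 - s) ^ (cube_dim Q - cube_dim P)) =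
    (-1) ^ (n - cube_dim P) * (\<Sum>Q\<in>{Q \<in> X. P \<subseteq> Q}. s ^ (cube_dim Q - cube_dim P))"
proof -
  obtain v where v: "v \<in> P" using cube_nonempty[OF cc P] by blast
  let ?l = "link_simplex X {v}" and ?L = "cube_link X {v}"
  have vX: "{v} \<in> X" using cube_vertex[OF cc P v] .
  have "v \<in> vertices X" using v P by (auto simp: vertices_def)
  then have e: "eulerian_sphere (int n - 1) ?L"
    using assms(1) by (simp add: eulerian_manifold_def)
  then have sc: "finite_simplicial_complex ?L" by (simp add: eulerian_sphere_def)
  have lP: "?l P \<in> ?L" unfolding cube_link_image using P v by blast
  have dimP: "card (?l P) = cube_dim P" "finite (?l P)"
    using card_link_simplex[OF vX P] v by (simp_all add: cube_dim_vertex)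
  have *: "(\<Sum>Q\<in>{Q \<in> X. P \<subseteq> Q}. x ^ (cube_dim Q - cube_dim P)) = (\<Sum>\<tau>\<in>simplex_link ?L (?l P). x ^ card \<tau>)"
    for x :: 'r
  proof -
    have "(\<Sum>\<tau>\<in>simplex_link ?L (?l P). x ^ card \<tau>) = (\<Sum>Q\<in>{Q \<in> X. P \<subseteq> Q}. x ^ card (?l Q - ?l P))"
      by (rule sum.reindex_bij_betw[OF link_of_cube_bij[OF P v sc], symmetric])
    also have "\<dots> = (\<Sum>Q\<in>{Q \<in> X. P \<subseteq> Q}. x ^ (cube_dim Q - cube_dim P))"
    proof (rule sum.cong)
      fix Q assume "Q \<in> {Q \<in> X. P \<subseteq> Q}"
      then have Q: "Q \<in> X" "P \<subseteq> Q" "{v} \<subseteq> Q" using v by auto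
      have "?l P \<subseteq> ?l Q" using link_simplex_subset_iff[OF vX P _ Q(1,3)] v Q by simp
      then have "card (?l Q - ?l P) = cube_dim Q - cube_dim P"
        using card_Diff_subset[OF dimP(2)] dimP(1) card_link_simplex(2)[OF vX Q(1,3)]
        by (simp add: cube_dim_vertex)
      then show "x ^ card (?l Q - ?l P) = x ^ (cube_dim Q - cube_dim P)" by simp
    qed simp
    finally show ?thesis by simp
  qed
  show ?thesis unfolding * dehn_sommerville[OF e lP] dimP(1) ..
qed

end

section \<open>The kernel inverse to \<open>t\<close> to the power of the distance\<close>

text \<open>The coefficient \<open>c_coeff\<close> over an arbitrary field, with the link polynomial
  written as a sum over cubes. It can be evaluated at \<open>t\<close> and at its inverse, and it
  vanishes by itself for vertices without a common cube.\<close>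

definition c_form :: "'v set set \<Rightarrow> 'k::field \<Rightarrow> 'v \<Rightarrow> 'v \<Rightarrow> 'k" where
  "c_form X t x z = (- t / (1 - t\<^sup>2)) ^ edge_dist X x z *
     (\<Sum>Q | Q \<in> X \<and> x \<in> Q \<and> z \<in> Q. (t\<^sup>2 / (1 - t\<^sup>2)) ^ (cube_dim Q - edge_dist X x z))"

context oriented_complex
begin

lemma minimal_cube:
  assumes Q: "Q \<in> X" "x \<in> Q" "z \<in> Q"
  shows "minimal_cube X x z \<in> X" "cube_dim (minimal_cube X x z) = edge_dist X x z"
    "{P \<in> X. minimal_cube X x z \<subseteq> P} = {P. P \<in> X \<and> x \<in> P \<and> z \<in> P}"
proof -
  obtain k \<phi> where c: "cube_chart X Q k \<phi>" "\<phi> {} = x" using based_chart_exists[OF cc Q(1,2)] .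
  have "z \<in> \<phi> ` Pow {..<k}" using cube_chart_image[OF c(1)] Q(3) by simp
  then obtain A where A: "A \<subseteq> {..<k}" "z = \<phi> A" by auto
  have P: "\<phi> ` Pow A \<in> X" "cube_dim (\<phi> ` Pow A) = card A" using pow_face[OF cc c(1) A(1)] by auto
  have sub: "\<phi> ` Pow A \<subseteq> P" if "P \<in> X" "x \<in> P" "z \<in> P" for P
    using cube_contains_pow[OF cc c(1) A(1) that(1)] that c(2) A(2) by simp
  have mem: "x \<in> \<phi> ` Pow A" "z \<in> \<phi> ` Pow A" using c(2) A(2) by auto
  have "minimal_cube X x z = \<phi> ` Pow A"
    unfolding minimal_cube_def
  proof (rule subset_antisym)
    show "\<Inter> {Q \<in> X. x \<in> Q \<and> z \<in> Q} \<subseteq> \<phi> ` Pow A" by (rule Inter_lower) (use P mem in simp)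
    show "\<phi> ` Pow A \<subseteq> \<Inter> {Q \<in> X. x \<in> Q \<and> z \<in> Q}" by (rule Inter_greatest) (use sub in auto)
  qed
  moreover have "edge_dist X x z = card A" using edge_dist_chart[OF c(1) A(1)] c(2) A(2) by simp
  moreover have "{P \<in> X. \<phi> ` Pow A \<subseteq> P} = {P. P \<in> X \<and> x \<in> P \<and> z \<in> P}"
    using sub mem by blast
  ultimately show "minimal_cube X x z \<in> X" "cube_dim (minimal_cube X x z) = edge_dist X x z"
    "{P \<in> X. minimal_cube X x z \<subseteq> P} = {P. P \<in> X \<and> x \<in> P \<and> z \<in> P}"
    using P by simp_all
qed

lemma c_coeff_eq_form: "c_coeff X x z = c_form X tvar x z"
proof (cases "\<exists>Q\<in>X. x \<in> Q \<and> z \<in> Q")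
  case True
  then obtain Q where Q: "Q \<in> X" "x \<in> Q" "z \<in> Q" by blast
  have "poly (f_pair X x z) s = (\<Sum>Q | Q \<in> X \<and> x \<in> Q \<and> z \<in> Q. s ^ (cube_dim Q - edge_dist X x z))"
    for s :: ratfun
    using f_polynomial_link[OF cc minimal_cube(1)[OF Q], of s] True
    by (simp add: f_pair_def minimal_cube[OF Q])
  then show ?thesis by (simp add: c_coeff_def c_form_def)
next
  case False
  then have none: "{Q. Q \<in> X \<and> x \<in> Q \<and> z \<in> Q} = {}" by blast
  have "f_pair X x z = (0 :: ratfun poly)" unfolding f_pair_def by (rule if_not_P[OF False])
  then show ?thesis unfolding c_coeff_def c_form_def none by simp
qed

text \<open>Inverting \<open>t\<close> turns \<open>s = t^2 / (1 - t^2)\<close> into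
  \<open>- 1 - s\<close>, the substitution of the Dehn--Sommerville relation, and changes the sign
  of \<open>- t / (1 - t^2)\<close>. The two resulting signs combine to
  \<open>(-1) ^ n\<close>.\<close>

lemma c_form_reciprocal:
  fixes t :: "'k::field"
  assumes e: "eulerian_manifold n X" and t: "t \<noteq> 0" "t\<^sup>2 \<noteq> 1"
  shows "c_form X (inverse t) x z = (-1) ^ n * c_form X t x z"
proof (cases "\<exists>Q\<in>X. x \<in> Q \<and> z \<in> Q")
  case True
  then obtain Q where Q: "Q \<in> X" "x \<in> Q" "z \<in> Q" by blast
  let ?m = "edge_dist X x z"
  have nz: "1 - t\<^sup>2 \<noteq> 0" "t\<^sup>2 - 1 \<noteq> 0" using t(2) by auto
  have den: "1 - (inverse t)\<^sup>2 = (t\<^sup>2 - 1) / t\<^sup>2" using t(1) by (simp add: field_simps)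
  have a: "- inverse t / (1 - (inverse t)\<^sup>2) = - (- t / (1 - t\<^sup>2))"
    unfolding den using t(1) nz by (simp add: field_simps power2_eq_square)
  have s: "(inverse t)\<^sup>2 / (1 - (inverse t)\<^sup>2) = - 1 - t\<^sup>2 / (1 - t\<^sup>2)"
    unfolding den using t(1) nz by (simp add: field_simps)
  have "?m \<le> n" using eulerian_dim_le[OF cc e minimal_cube(1)[OF Q]] minimal_cube(2)[OF Q] by simp
  then have sgn: "(-1 :: 'k) ^ ?m * (-1) ^ (n - ?m) = (-1) ^ n" by (simp flip: power_add)
  have "c_form X (inverse t) x z = (- (- t / (1 - t\<^sup>2))) ^ ?m *
     ((-1) ^ (n - ?m) * (\<Sum>Q | Q \<in> X \<and> x \<in> Q \<and> z \<in> Q. (t\<^sup>2 / (1 - t\<^sup>2)) ^ (cube_dim Q - ?m)))"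
    using dehn_sommerville_cube[OF cc e minimal_cube(1)[OF Q], of "t\<^sup>2 / (1 - t\<^sup>2)"]
    unfolding c_form_def a s minimal_cube(2,3)[OF Q] by simp
  also have "(- (- t / (1 - t\<^sup>2))) ^ ?m = (-1) ^ ?m * (- t / (1 - t\<^sup>2)) ^ ?m"
    by (subst power_mult_distrib[symmetric]) simp
  finally show ?thesis unfolding c_form_def sgn[symmetric] by (simp add: mult_ac)
next
  case False
  then have none: "{Q. Q \<in> X \<and> x \<in> Q \<and> z \<in> Q} = {}" by blast
  show ?thesis unfolding c_form_def none by simp
qed

lemma star_finite:
  "locally_finite_complex X \<Longrightarrow> x \<in> vertices X \<Longrightarrow> finite {Q \<in> X. x \<in> Q}"
  by (simp add: locally_finite_complex_def)

text \<open>The summand is a product over the directions of the cube. With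
  \<open>a = - t / (1 - t^2)\<close> and \<open>s = t^2 / (1 - t^2)\<close>, a direction at
  \<open>\<phi> {}\<close> contributes \<open>a / t + s = -1\<close> if it points to
  \<open>y\<close> and \<open>a * t + s = 0\<close> otherwise. These two identities explain the form
  of the kernel.\<close>

lemma cube_sum:
  fixes t :: "'k::field"
  assumes y: "y \<in> vertices X" and c: "cube_chart X Q k \<phi>" and t: "t \<noteq> 0" "t\<^sup>2 \<noteq> 1"
    and J: "J = {i. i < k \<and> D y (\<phi> {}) (\<phi> {i})}"
  shows "(\<Sum>z\<in>Q. (- t / (1 - t\<^sup>2)) ^ edge_dist X (\<phi> {}) z *
      (t\<^sup>2 / (1 - t\<^sup>2)) ^ (k - edge_dist X (\<phi> {}) z) * t ^ edge_dist X z y) =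
    (if J = {..<k} then (-1) ^ k * t ^ edge_dist X (\<phi> {}) y else 0)"
proof -
  define a where "a = - t / (1 - t\<^sup>2)"
  define s where "s = t\<^sup>2 / (1 - t\<^sup>2)"
  let ?d = "edge_dist X (\<phi> {}) y"
  have nz: "1 - t\<^sup>2 \<noteq> 0" using t(2) by auto
  have sa: "a / t + s = -1" "a * t + s = 0"
  proof -
    have "a / t + s = (t\<^sup>2 - 1) / (1 - t\<^sup>2)"
      using t(1) by (simp add: a_def s_def diff_divide_distrib)
    also have "\<dots> = - 1" using nz by (simp add: divide_eq_eq)
    finally show "a / t + s = -1" .
    show "a * t + s = 0" by (simp add: a_def s_def power2_eq_square)
  qed
  have summand: "a ^ card A * s ^ (k - card A) * t ^ edge_dist X (\<phi> A) y =
      t ^ ?d * (\<Prod>i<k. if i \<in> A then (if i \<in> J then a / t else a * t) else s)"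
    if A: "A \<in> Pow {..<k}" for A
  proof -
    have fin: "finite A" using A finite_subset by auto
    have "t ^ edge_dist X (\<phi> A) y * t ^ card (A \<inter> J) = t ^ ?d * t ^ card (A - J)"
      using edge_dist_gate[OF y c J, of A] A by (simp flip: power_add)
    then have tp: "t ^ edge_dist X (\<phi> A) y = t ^ ?d * t ^ card (A - J) / t ^ card (A \<inter> J)"
      using t(1) by (simp add: field_simps)
    have "(\<Prod>i<k. if i \<in> A then (if i \<in> J then a / t else a * t) else s) =
        (\<Prod>i\<in>A. if i \<in> J then a / t else a * t) * s ^ card ({..<k} - A)"
    proof -
      have "{..<k} \<inter> {x. x \<in> A} = A" "{..<k} \<inter> - {x. x \<in> A} = {..<k} - A" using A by auto
      then show ?thesis
        using prod.If_cases[of "{..<k}" "\<lambda>i. i \<in> A" "\<lambda>i. if i \<in> J then a / t else a * t" "\<lambda>_. s"] by simp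
    qed
    also have "card ({..<k} - A) = k - card A" using A fin by (simp add: card_Diff_subset)
    also have "(\<Prod>i\<in>A. if i \<in> J then a / t else a * t) = (a / t) ^ card (A \<inter> J) * (a * t) ^ card (A - J)"
      using prod.If_cases[OF fin, of "\<lambda>i. i \<in> J" "\<lambda>_. a / t" "\<lambda>_. a * t"] by (simp add: Diff_eq)
    also have "\<dots> = a ^ card A * t ^ card (A - J) / t ^ card (A \<inter> J)"
    proof -
      have "card A = card (A \<inter> J) + card (A - J)" using fin
        by (metis card_Un_disjoint finite_Diff finite_Int Int_Diff_Un Int_Diff_disjoint)
      then show ?thesis by (simp add: power_add power_mult_distrib power_divide field_simps)
    qed
    finally show ?thesis unfolding tp by (simp add: mult_ac)
  qed
  have "(\<Sum>z\<in>Q. a ^ edge_dist X (\<phi> {}) z * s ^ (k - edge_dist X (\<phi> {}) z) * t ^ edge_dist X z y) =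
      (\<Sum>A\<in>Pow {..<k}. a ^ card A * s ^ (k - card A) * t ^ edge_dist X (\<phi> A) y)"
    unfolding sum_cube_chart[OF c] by (intro sum.cong) (auto simp: edge_dist_chart[OF c])
  also have "\<dots> = t ^ ?d * (\<Sum>A\<in>Pow {..<k}. \<Prod>i<k. if i \<in> A then (if i \<in> J then a / t else a * t) else s)"
    unfolding sum_distrib_left by (intro sum.cong summand refl)
  also have "\<dots> = t ^ ?d * (\<Prod>i<k. (if i \<in> J then a / t else a * t) + s)"
    by (subst sum_Pow_prod_if) auto
  also have "(\<Prod>i<k. (if i \<in> J then a / t else a * t) + s) = (\<Prod>i<k. if i \<in> J then -1 else 0)"
    using sa by (intro prod.cong) auto
  also have "\<dots> = (if J = {..<k} then (-1) ^ k else 0)"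
  proof (cases "J = {..<k}")
    case False
    then obtain i where "i < k" "i \<notin> J" using J by blast
    then have "(\<Prod>i<k. if i \<in> J then -1 else 0 :: 'k) = 0" by (intro prod_zero) auto
    then show ?thesis using False by simp
  qed simp
  finally show ?thesis unfolding a_def s_def by (simp add: mult_ac)
qed

definition pointing_cubes :: "'v \<Rightarrow> 'v \<Rightarrow> 'v set set" where
  "pointing_cubes x y = {Q \<in> X. x \<in> Q \<and> (\<forall>v\<in>Q. (x, v) \<in> edges X \<longrightarrow> D y x v)}"

lemma pointing_cubes_chart:
  assumes y: "y \<in> vertices X" and c: "cube_chart X Q k \<phi>"
  shows "Q \<in> pointing_cubes (\<phi> {}) y \<longleftrightarrow> {i. i < k \<and> D y (\<phi> {}) (\<phi> {i})} = {..<k}"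
proof
  assume Q: "Q \<in> pointing_cubes (\<phi> {}) y"
  have "D y (\<phi> {}) (\<phi> {i})" if "i < k" for i
    using Q chart_arrow[OF c empty_subsetI that] cube_chart_vertexI[OF c, of "{i}"] that
    by (auto simp: pointing_cubes_def)
  then show "{i. i < k \<and> D y (\<phi> {}) (\<phi> {i})} = {..<k}" by auto
next
  assume all: "{i. i < k \<and> D y (\<phi> {}) (\<phi> {i})} = {..<k}"
  have "D y (\<phi> {}) v" if v: "v \<in> Q" "(\<phi> {}, v) \<in> edges X" for v
  proof -
    have "{\<phi> {}, v} \<in> X" "v \<noteq> \<phi> {}" using v by (auto simp: edges_def)
    then obtain j where "j < k" "v = \<phi> {j}" by (rule edge_at_base[OF cc c v(1)])
    then show ?thesis using all by auto
  qed
  then show "Q \<in> pointing_cubes (\<phi> {}) y"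
    using cube_chart_in[OF c] cube_chart_vertexI[OF c, of "{}"] by (auto simp: pointing_cubes_def)
qed

text \<open>The edges pointing from \<open>x\<close> to \<open>y\<close> span a single cube, so the cubes at \<open>x\<close> all of whose edges
  point to \<open>y\<close> are the faces at \<open>x\<close> of that cube, and their signs cancel.\<close>

lemma pointing_cubes_sum:
  assumes y: "y \<in> vertices X" and x: "x \<in> vertices X"
  shows "(\<Sum>Q\<in>pointing_cubes x y. (-1 :: 'k::comm_ring_1) ^ cube_dim Q) = (if x = y then 1 else 0)"
proof -
  obtain Q0 where Q0: "Q0 \<in> X" "x \<in> Q0" "\<And>v. (x, v) \<in> edges X \<Longrightarrow> D y x v \<Longrightarrow> v \<in> Q0"
    using D_cube[OF y x] by blast
  obtain k \<phi> where c: "cube_chart X Q0 k \<phi>" "\<phi> {} = x" using based_chart_exists[OF cc Q0(1,2)] .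
  define J0 where "J0 = {i. i < k \<and> D y x (\<phi> {i})}"
  have J0: "J0 \<subseteq> {..<k}" "finite J0" by (auto simp: J0_def)
  have eq: "pointing_cubes x y = (\<lambda>J. \<phi> ` Pow J) ` Pow J0"
  proof (intro subset_antisym subsetI)
    fix Q assume Q: "Q \<in> pointing_cubes x y"
    then have QX: "Q \<in> X" "x \<in> Q" by (auto simp: pointing_cubes_def)
    obtain l \<psi> where c': "cube_chart X Q l \<psi>" "\<psi> {} = x" using based_chart_exists[OF cc QX] .
    have edges': "\<psi> {i} \<in> Q0" if "i < l" for i
    proof -
      have "(x, \<psi> {i}) \<in> edges X" using chart_arrow[OF c'(1) empty_subsetI that] c'(2) by simp
      moreover have "\<psi> {i} \<in> Q" using cube_chart_vertexI[OF c'(1), of "{i}"] that by simp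
      ultimately show ?thesis using Q0(3) Q by (auto simp: pointing_cubes_def)
    qed
    have "Q \<inter> Q0 \<in> X" by (rule cube_inter[OF cc QX(1) Q0(1) QX(2) Q0(2)])
    moreover have "\<psi> {} \<in> Q \<inter> Q0" using QX Q0 c' by simp
    ultimately obtain J where J: "J \<subseteq> {..<l}" "Q \<inter> Q0 = \<psi> ` Pow J"
      using face_at_base[OF cc c'(1) _ Int_lower1] by metis
    have "i \<in> J" if "i < l" for i
    proof -
      have "\<psi> {i} \<in> Q \<inter> Q0" using edges'[OF that] cube_chart_vertexI[OF c'(1), of "{i}"] that by simp
      then show ?thesis unfolding J(2) using mem_pow_face[OF cc c'(1) J(1), of "{i}"] that by simp
    qed
    then have "J = {..<l}" using J(1) by auto
    then have sub: "Q \<subseteq> Q0" using J(2) cube_chart_image[OF c'(1)] by auto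
    have "\<phi> {} \<in> Q" using QX c by simp
    then obtain J' where J': "J' \<subseteq> {..<k}" "Q = \<phi> ` Pow J'"
      by (rule face_at_base[OF cc c(1) QX(1) sub])
    have "J' \<subseteq> J0"
    proof
      fix i assume i: "i \<in> J'"
      then have ik: "i < k" using J' by auto
      have "\<phi> {i} \<in> Q" using J' i by auto
      moreover have "(x, \<phi> {i}) \<in> edges X" using chart_arrow[OF c(1) empty_subsetI ik] c(2) by simp
      ultimately show "i \<in> J0" using Q ik by (auto simp: pointing_cubes_def J0_def)
    qed
    then show "Q \<in> (\<lambda>J. \<phi> ` Pow J) ` Pow J0" using J' by blast
  next
    fix Q assume "Q \<in> (\<lambda>J. \<phi> ` Pow J) ` Pow J0"
    then obtain J where J: "J \<subseteq> J0" "Q = \<phi> ` Pow J" by auto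
    have Jk: "J \<subseteq> {..<k}" using J J0 by auto
    have QX: "Q \<in> X" "x \<in> Q" using pow_face(1)[OF cc c(1) Jk] J c(2) by auto
    have "D y x v" if v: "v \<in> Q" "(x, v) \<in> edges X" for v
    proof -
      have vQ0: "v \<in> Q0" using v(1) J(2) Jk cube_chart_image[OF c(1)] by auto
      have "{\<phi> {}, v} \<in> X" "v \<noteq> \<phi> {}" using v c by (auto simp: edges_def)
      then obtain j where j: "j < k" "v = \<phi> {j}" by (rule edge_at_base[OF cc c(1) vQ0])
      then have "j \<in> J" using v(1) J(2) mem_pow_face[OF cc c(1) Jk, of "{j}"] by simp
      then show ?thesis using J(1) j by (auto simp: J0_def)
    qed
    then show "Q \<in> pointing_cubes x y" using QX by (simp add: pointing_cubes_def)
  qed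
  have inj: "inj_on (\<lambda>J. \<phi> ` Pow J) (Pow J0)"
  proof (rule inj_onI)
    fix J J' assume JJ': "J \<in> Pow J0" "J' \<in> Pow J0" "\<phi> ` Pow J = \<phi> ` Pow J'"
    then have "J \<subseteq> {..<k}" "J' \<subseteq> {..<k}" using J0 by auto
    then show "J = J'" using pow_face_subset[OF cc c(1), of J J'] pow_face_subset[OF cc c(1), of J' J] JJ'(3)
      by (intro subset_antisym) simp_all
  qed
  have "(\<Sum>Q\<in>pointing_cubes x y. (-1 :: 'k) ^ cube_dim Q) = (\<Sum>J\<in>Pow J0. (-1) ^ cube_dim (\<phi> ` Pow J))"
    unfolding eq by (simp add: sum.reindex[OF inj])
  also have "\<dots> = (\<Sum>J\<in>Pow J0. (-1) ^ card J)"
    using J0 by (intro sum.cong refl) (auto simp: pow_face(2)[OF cc c(1)])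
  also have "\<dots> = (1 + (-1)) ^ card J0" by (rule sum_Pow_power_card[OF J0(2)])
  also have "\<dots> = (if x = y then 1 else 0)"
  proof -
    have "J0 = {} \<longleftrightarrow> x = y"
    proof
      assume "J0 = {}"
      show "x = y"
      proof (rule ccontr)
        assume "x \<noteq> y"
        then obtain v where v: "(x, v) \<in> edges X" "D y x v" using arrow_leaves[OF y x] by blast
        have "{\<phi> {}, v} \<in> X" "v \<noteq> \<phi> {}" using v c by (auto simp: edges_def)
        then obtain j where j: "j < k" "v = \<phi> {j}" by (rule edge_at_base[OF cc c(1) Q0(3)[OF v]])
        then show False using v \<open>J0 = {}\<close> by (auto simp: J0_def)
      qed
    next
      assume xy: "x = y"
      have "\<not> D y x (\<phi> {i})" if "i < k" for i
        using D_sink[OF y] chart_arrow[OF c(1) empty_subsetI that] c(2) xy by simp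
      then show "J0 = {}" by (auto simp: J0_def)
    qed
    then show ?thesis using J0(2) by (cases "J0 = {}") (auto simp: card_gt_0_iff zero_power)
  qed
  finally show ?thesis .
qed

text \<open>Exchange the sums over \<open>z\<close> and over the cubes \<open>Q\<close> at
  \<open>x\<close>: each cube is evaluated by \<open>cube_sum\<close>, and the surviving signs are
  added up by \<open>pointing_cubes_sum\<close>.\<close>

theorem c_form_inverse:
  fixes t :: "'k::field"
  assumes lf: "locally_finite_complex X" and y: "y \<in> vertices X" and x: "x \<in> vertices X"
    and t: "t \<noteq> 0" "t\<^sup>2 \<noteq> 1"
  shows "(\<Sum>z\<in>\<Union>{Q \<in> X. x \<in> Q}. c_form X t x z * t ^ edge_dist X z y) = (if x = y then 1 else 0)"
proof -
  let ?a = "- t / (1 - t\<^sup>2)" and ?s = "t\<^sup>2 / (1 - t\<^sup>2)" and ?S = "{Q \<in> X. x \<in> Q}"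
  have fin: "finite ?S" by (rule star_finite[OF lf x])
  then have finU: "finite (\<Union>?S)" using cube_finite[OF cc] by auto
  define g where "g z Q = ?a ^ edge_dist X x z * ?s ^ (cube_dim Q - edge_dist X x z) * t ^ edge_dist X z y"
    for z :: 'v and Q :: "'v set"
  have "(\<Sum>z\<in>\<Union>?S. c_form X t x z * t ^ edge_dist X z y) = (\<Sum>z\<in>\<Union>?S. \<Sum>Q\<in>{Q \<in> ?S. z \<in> Q}. g z Q)"
  proof (rule sum.cong)
    fix z
    have "{Q. Q \<in> X \<and> x \<in> Q \<and> z \<in> Q} = {Q \<in> ?S. z \<in> Q}" by auto
    then show "c_form X t x z * t ^ edge_dist X z y = (\<Sum>Q\<in>{Q \<in> ?S. z \<in> Q}. g z Q)"
      by (simp add: c_form_def g_def sum_distrib_left sum_distrib_right)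
  qed simp
  also have "\<dots> = (\<Sum>Q\<in>?S. \<Sum>z\<in>{z \<in> \<Union>?S. z \<in> Q}. g z Q)"
    using sum.swap_restrict[OF finU fin, of g "\<lambda>z Q. z \<in> Q"] by simp
  also have "\<dots> = (\<Sum>Q\<in>?S. if Q \<in> pointing_cubes x y then (-1) ^ cube_dim Q * t ^ edge_dist X x y else 0)"
  proof (rule sum.cong)
    fix Q assume Q: "Q \<in> ?S"
    then have "{z \<in> \<Union>?S. z \<in> Q} = Q" by auto
    moreover obtain k \<phi> where c: "cube_chart X Q k \<phi>" "\<phi> {} = x"
      using based_chart_exists[OF cc, of Q x] Q by auto
    have "(\<Sum>z\<in>Q. g z Q) = (if Q \<in> pointing_cubes x y then (-1) ^ cube_dim Q * t ^ edge_dist X x y else 0)"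
      using cube_sum[OF y c(1) t refl] pointing_cubes_chart[OF y c(1)] cube_chart_dim[OF c(1)] c(2)
      by (simp add: g_def)
    ultimately show "(\<Sum>z\<in>{z \<in> \<Union>?S. z \<in> Q}. g z Q) =
        (if Q \<in> pointing_cubes x y then (-1) ^ cube_dim Q * t ^ edge_dist X x y else 0)" by simp
  qed simp
  also have "\<dots> = (\<Sum>Q\<in>?S \<inter> pointing_cubes x y. (-1) ^ cube_dim Q * t ^ edge_dist X x y)"
    using sum.inter_restrict[OF fin, of "\<lambda>Q. (-1) ^ cube_dim Q * t ^ edge_dist X x y" "pointing_cubes x y"] by simp
  also have "?S \<inter> pointing_cubes x y = pointing_cubes x y" by (auto simp: pointing_cubes_def)
  also have "(\<Sum>Q\<in>pointing_cubes x y. (-1) ^ cube_dim Q * t ^ edge_dist X x y) =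
      (if x = y then 1 else 0) * t ^ edge_dist X x y"
    using pointing_cubes_sum[OF y x, where 'k = 'k] by (simp flip: sum_distrib_right)
  also have "\<dots> = (if x = y then 1 else 0)"
    using edge_dist_eqI[OF y, of y 0] by simp
  finally show ?thesis .
qed

end

section \<open>Cocompactness and vertex orbits\<close>

lemma supp_in_vertices: "cube_complex X \<Longrightarrow> p \<in> realization X \<Longrightarrow> supp p \<subseteq> vertices X"
  using supp_cube unfolding vertices_def by blast

lemma (in group_action) orbit_subset: "x \<in> E \<Longrightarrow> orbit G \<phi> x \<subseteq> E"
  unfolding orbit_def using element_image by blast

lemma (in group_action) orbit_eq:
  assumes "x \<in> E" "y \<in> orbit G \<phi> x" shows "orbit G \<phi> y = orbit G \<phi> x"
proof -
  have y: "y \<in> E" using orbit_subset assms by blast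
  have "x \<in> orbit G \<phi> y" by (rule orbit_sym[OF assms(1) y assms(2)])
  then show ?thesis
    using orbit_trans assms y orbit_subset by (intro subset_antisym subsetI) blast+
qed

context cat0_complex
begin

lemma open_star_openin: "openin (Metric_space.mtopology R d) {p \<in> R. \<exists>v\<in>V. p v \<noteq> 0}"
proof -
  interpret Metric_space R d by (rule metric)
  show ?thesis unfolding openin_mtopology
  proof (intro conjI allI impI)
    fix p assume "p \<in> {p \<in> R. \<exists>v\<in>V. p v \<noteq> 0}"
    then obtain v where p: "p \<in> R" "v \<in> V" "v \<in> supp p" by (auto simp: supp_def)
    obtain \<epsilon> where \<epsilon>: "0 < \<epsilon>" "\<And>q. q \<in> R \<Longrightarrow> d p q < \<epsilon> \<Longrightarrow> supp p \<subseteq> supp q"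
      by (rule supp_nbhd[OF p(1)]) blast
    have "mball p \<epsilon> \<subseteq> {p \<in> R. \<exists>v\<in>V. p v \<noteq> 0}"
    proof
      fix q assume "q \<in> mball p \<epsilon>"
      then have q: "q \<in> R" "d p q < \<epsilon>" by (auto simp: in_mball)
      then have "v \<in> supp q" using \<epsilon>(2) p(3) by blast
      then show "q \<in> {p \<in> R. \<exists>v\<in>V. p v \<noteq> 0}" using q p(2) by (auto simp: supp_def)
    qed
    then show "\<exists>r>0. mball p r \<subseteq> {p \<in> R. \<exists>v\<in>V. p v \<noteq> 0}" using \<epsilon>(1) by blast
  qed auto
qed

text \<open>The open stars of the vertex orbits form an open cover of the quotient in which each vertex
  lies in only one member.\<close>

lemma finite_vertex_orbits:
  fixes G :: "('g, 'b) monoid_scheme"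
  assumes act: "group_action G (vertices X) \<rho>" and cocompact: "cocompact_action G X \<rho>"
  shows "finite (orbits G (vertices X) \<rho>)"
proof -
  interpret group_action G "vertices X" \<rho> by (rule act)
  let ?T = "Metric_space.mtopology R d" and ?q = "orbit G (realization_action X \<rho>)"
  have topT: "topspace ?T = R" by (rule Metric_space.topspace_mtopology[OF metric])
  obtain Y where Y: "quotient_map ?T Y ?q" "compact_space Y"
    using cocompact by (auto simp: cocompact_action_def)
  define U where "U V = {p \<in> R. \<exists>v\<in>V. p v \<noteq> 0}" for V
  have one: "\<one>\<^bsub>G\<^esub> \<in> carrier G" using group_hom by (simp add: group_hom_def group.is_monoid monoid.one_closed)
  \<comment> \<open>The identity acts trivially on the realization: points have no weight outside
    \<open>vertices X\<close>, where \<open>realization_action\<close> is 0 by default.\<close>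
  have self: "p \<in> ?q p" if "p \<in> R" for p
  proof -
    have "realization_action X \<rho> \<one>\<^bsub>G\<^esub> p v = p v" for v
    proof (cases "v \<in> vertices X")
      case True
      have "\<rho> \<one>\<^bsub>G\<^esub> v = v" using True id_eq_one by (metis restrict_apply')
      then have "inv_into (vertices X) (\<rho> \<one>\<^bsub>G\<^esub>) v = v"
        using inv_into_f_f[OF inj_prop[OF one] True] by simp
      then show ?thesis using True by (simp add: realization_action_def)
    next
      case False
      then show ?thesis using supp_in_vertices[OF cc that] by (auto simp: realization_action_def supp_def)
    qed
    then have "realization_action X \<rho> \<one>\<^bsub>G\<^esub> p = p" by (rule ext)
    then have "\<exists>g. p = realization_action X \<rho> g p \<and> g \<in> carrier G" using one by metis
    then show ?thesis unfolding orbit_def by simp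
  qed
  \<comment> \<open>Saturation: the action carries the weight at \<open>v\<close> to
    \<open>\<rho> g v\<close>, which lies in the same orbit. So the open star of \<open>V\<close> is
    a union of fibres of the quotient map and has an open image.\<close>
  have sat: "p' \<in> U V"
    if V: "V \<in> orbits G (vertices X) \<rho>" and p: "p \<in> U V" and p': "p' \<in> R" "?q p = ?q p'" for V p p'
  proof -
    obtain x where x: "x \<in> vertices X" "V = orbit G \<rho> x" using V by (auto simp: orbits_def)
    obtain v where v: "v \<in> V" "p v \<noteq> 0" using p by (auto simp: U_def)
    have vX: "v \<in> vertices X" using v x orbit_subset by blast
    have "p' \<in> ?q p" using self[OF p'(1)] p'(2) by simp
    then obtain g where g: "g \<in> carrier G" "p' = realization_action X \<rho> g p" by (auto simp: orbit_def)
    have gv: "\<rho> g v \<in> vertices X" using element_image[OF g(1) vX] by simp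
    have "p' (\<rho> g v) = p v"
      using inv_into_f_f[OF inj_prop[OF g(1)] vX] gv by (simp add: g(2) realization_action_def)
    moreover have "\<rho> g v \<in> orbit G \<rho> v" using g by (auto simp: orbit_def)
    then have "\<rho> g v \<in> V" using orbit_eq[OF x(1)] v(1) x(2) by simp
    ultimately have "\<exists>v\<in>V. p' v \<noteq> 0" using v(2) by (intro bexI[of _ "\<rho> g v"]) simp_all
    then show ?thesis using p'(1) by (simp add: U_def)
  qed
  have img: "?q ` R = topspace Y" using Y(1) topT by (auto simp: quotient_map_def)
  have opn: "openin Y (?q ` U V)" if V: "V \<in> orbits G (vertices X) \<rho>" for V
  proof -
    have eq: "{p. p \<in> topspace ?T \<and> ?q p \<in> ?q ` U V} = U V"
    proof (intro subset_antisym subsetI)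
      fix p assume "p \<in> {p. p \<in> topspace ?T \<and> ?q p \<in> ?q ` U V}"
      then obtain p0 where "p \<in> R" "p0 \<in> U V" "?q p0 = ?q p" using topT by auto
      then show "p \<in> U V" using sat[OF V] by blast
    qed (auto simp: topT U_def)
    have "?q ` U V \<subseteq> topspace Y" using img by (auto simp: U_def)
    then have "openin ?T {p. p \<in> topspace ?T \<and> ?q p \<in> ?q ` U V} \<longleftrightarrow> openin Y (?q ` U V)"
      using Y(1)[unfolded quotient_map_def, THEN conjunct2] by blast
    then show ?thesis unfolding eq using open_star_openin by (simp add: U_def)
  qed
  have cover: "topspace Y \<subseteq> \<Union> ((\<lambda>V. ?q ` U V) ` orbits G (vertices X) \<rho>)"
  proof
    fix z assume "z \<in> topspace Y"
    then obtain p where p: "p \<in> R" "z = ?q p" using img by blast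
    obtain v where v: "v \<in> supp p" using supp_nonempty[OF cc p(1)] by blast
    have vX: "v \<in> vertices X" using supp_in_vertices[OF cc p(1)] v by blast
    have "p \<in> U (orbit G \<rho> v)" using p(1) v orbit_refl[OF vX] by (auto simp: U_def supp_def)
    moreover have "orbit G \<rho> v \<in> orbits G (vertices X) \<rho>" using vX by (auto simp: orbits_def)
    ultimately show "z \<in> \<Union> ((\<lambda>V. ?q ` U V) ` orbits G (vertices X) \<rho>)" using p(2) by blast
  qed
  obtain \<F> where \<F>: "finite \<F>" "\<F> \<subseteq> (\<lambda>V. ?q ` U V) ` orbits G (vertices X) \<rho>" "topspace Y \<subseteq> \<Union>\<F>"
    using Y(2)[unfolded compact_space_alt, rule_format, of "(\<lambda>V. ?q ` U V) ` orbits G (vertices X) \<rho>"]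
      opn cover by blast
  obtain \<O> where \<O>: "\<O> \<subseteq> orbits G (vertices X) \<rho>" "finite \<O>" "\<F> = (\<lambda>V. ?q ` U V) ` \<O>"
    using finite_subset_image[OF \<F>(1,2)] by blast
  \<comment> \<open>A vertex point has weight only at its own vertex, so a member of the subcover
    that contains its image comes from its own orbit.\<close>
  have "orbits G (vertices X) \<rho> \<subseteq> \<O>"
  proof
    fix W assume "W \<in> orbits G (vertices X) \<rho>"
    then obtain w where w: "w \<in> vertices X" "W = orbit G \<rho> w" by (auto simp: orbits_def)
    have wR: "vertex_point w \<in> R" by (rule vertex_point_realization[OF cc w(1)])
    then have "?q (vertex_point w) \<in> topspace Y" using img by blast
    then obtain V p where V: "V \<in> \<O>" "p \<in> U V" "?q p = ?q (vertex_point w)" using \<F>(3) \<O>(3) by auto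
    then have "vertex_point w \<in> U V" using sat[OF _ V(2) wR V(3)] \<O>(1) by blast
    then have wV: "w \<in> V" by (auto simp: U_def vertex_point_def split: if_splits)
    obtain x where x: "x \<in> vertices X" "V = orbit G \<rho> x" using V(1) \<O>(1) by (auto simp: orbits_def)
    have "W = V" using orbit_eq[OF x(1)] wV x(2) w(2) by simp
    then show "W \<in> \<O>" using V(1) by simp
  qed
  then show ?thesis using \<O>(2) finite_subset by blast
qed

end

section \<open>Invariance under the action\<close>

lemma (in group_action) cellular_inverse_image:
  assumes "cellular_action G X \<phi>" "E = vertices X" "g \<in> carrier G" "Q \<subseteq> E" "\<phi> g ` Q \<in> X"
  shows "Q \<in> X"
proof -
  have "\<phi> (inv g) ` \<phi> g ` Q = Q"
  proof -
    have "\<phi> (inv g) (\<phi> g x) = x" if "x \<in> Q" for x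
      using orbit_sym_aux[OF assms(3)] that assms(4) by blast
    then show ?thesis by (simp add: image_image)
  qed
  moreover have "inv g \<in> carrier G"
    using group_hom assms(3) by (simp add: group_hom_def group.inv_closed)
  ultimately show ?thesis using assms(1,5) unfolding cellular_action_def by metis
qed

locale complex_action = group_action G "vertices X" \<rho>
  for G :: "('g, 'b) monoid_scheme" and X :: "'v set set" and \<rho> +
  assumes cellular: "cellular_action G X \<rho>"
begin

lemma image_cube_iff:
  assumes "g \<in> carrier G" "Q \<subseteq> vertices X" shows "\<rho> g ` Q \<in> X \<longleftrightarrow> Q \<in> X"
  using cellular_inverse_image[OF cellular refl assms] cellular assms(1)
  by (auto simp: cellular_action_def)

lemma edges_image:
  assumes g: "g \<in> carrier G" and u: "u \<in> vertices X" and v: "v \<in> vertices X"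
  shows "(\<rho> g u, \<rho> g v) \<in> edges X \<longleftrightarrow> (u, v) \<in> edges X"
proof -
  have "\<rho> g u = \<rho> g v \<longleftrightarrow> u = v" using inj_on_eq_iff[OF inj_prop[OF g] u v] .
  moreover have "{\<rho> g u, \<rho> g v} \<in> X \<longleftrightarrow> {u, v} \<in> X" using image_cube_iff[OF g, of "{u, v}"] u v by simp
  ultimately show ?thesis by (simp add: edges_def)
qed

lemma relpow_image:
  assumes g: "g \<in> carrier G" and u: "u \<in> vertices X" and v: "v \<in> vertices X"
  shows "(\<rho> g u, \<rho> g v) \<in> edges X ^^ k \<longleftrightarrow> (u, v) \<in> edges X ^^ k"
  using v
proof (induction k arbitrary: v)
  case 0
  then show ?case using inj_on_eq_iff[OF inj_prop[OF g] u] by simp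
next
  case (Suc k)
  show ?case
  proof
    assume "(\<rho> g u, \<rho> g v) \<in> edges X ^^ Suc k"
    then obtain w' where w': "(\<rho> g u, w') \<in> edges X ^^ k" "(w', \<rho> g v) \<in> edges X" by auto
    have "w' \<in> \<rho> g ` vertices X" unfolding surj_prop[OF g] using edges_in_vertices[OF w'(2)] by simp
    then obtain w where w: "w \<in> vertices X" "\<rho> g w = w'" by auto
    have "(u, w) \<in> edges X ^^ k" using w' w Suc.IH[OF w(1)] by simp
    moreover have "(w, v) \<in> edges X" using w' w edges_image[OF g w(1) Suc.prems] by simp
    ultimately show "(u, v) \<in> edges X ^^ Suc k" by (rule relpow_Suc_I)
  next
    assume "(u, v) \<in> edges X ^^ Suc k"
    then obtain w where w: "(u, w) \<in> edges X ^^ k" "(w, v) \<in> edges X" by auto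
    have wX: "w \<in> vertices X" using edges_in_vertices[OF w(2)] by simp
    have "(\<rho> g u, \<rho> g w) \<in> edges X ^^ k" using w(1) Suc.IH[OF wX] by simp
    moreover have "(\<rho> g w, \<rho> g v) \<in> edges X" using w(2) edges_image[OF g wX Suc.prems] by simp
    ultimately show "(\<rho> g u, \<rho> g v) \<in> edges X ^^ Suc k" by (rule relpow_Suc_I)
  qed
qed

lemma edge_dist_image:
  assumes "g \<in> carrier G" "u \<in> vertices X" "v \<in> vertices X"
  shows "edge_dist X (\<rho> g u) (\<rho> g v) = edge_dist X u v"
  unfolding edge_dist_def relpow_image[OF assms] ..

end

section \<open>Substitution in rational functions\<close>

definition ev :: "ratfun \<Rightarrow> int poly \<Rightarrow> ratfun" where
  "ev a p = poly (map_poly of_int p) a"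

lemma ev_pCons: "ev a (pCons c p) = of_int c + a * ev a p"
  by (simp add: ev_def map_poly_pCons)

lemma ev_0: "ev a 0 = 0" and ev_1: "ev a 1 = 1"
  by (simp_all add: ev_def)

lemma ev_add: "ev a (p + q) = ev a p + ev a q"
  by (induction p q rule: poly_induct2) (simp_all add: ev_pCons ev_0 algebra_simps)

lemma ev_smult: "ev a (Polynomial.smult c p) = of_int c * ev a p"
  by (induction p) (simp_all add: ev_pCons ev_0 algebra_simps)

lemma ev_mult: "ev a (p * q) = ev a p * ev a q"
  by (induction p) (simp_all add: ev_pCons ev_0 ev_add ev_smult algebra_simps)

lemma of_int_ratfun: "(of_int c :: ratfun) = to_fract [:c:]"
proof (induction c rule: int_induct[where k = 0])
  case (step1 i)
  have "[:i + 1:] = [:i:] + (1 :: int poly)" by (simp add: one_pCons)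
  then show ?case using step1 by simp
next
  case (step2 i)
  have "[:i - 1:] = [:i:] - (1 :: int poly)" by (simp add: one_pCons)
  then show ?case using step2 by simp
qed simp

lemma tvar_eq: "tvar = to_fract [:0, 1:]"
  by (simp add: tvar_def to_fract_def)

lemma tvar_nonzero: "tvar \<noteq> 0" and tvar_square: "tvar\<^sup>2 \<noteq> 1"
proof -
  show "tvar \<noteq> 0" by (simp add: tvar_eq)
  have "[:0, 1:] * [:0, 1:] \<noteq> (1 :: int poly)" by (simp add: one_pCons)
  then have "to_fract ([:0, 1:] * [:0, 1:] :: int poly) \<noteq> to_fract 1"
    by (simp only: to_fract_eq_iff not_False_eq_True)
  then show "tvar\<^sup>2 \<noteq> 1" unfolding tvar_eq power2_eq_square to_fract_mult to_fract_1 .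
qed

lemma ev_tvar: "ev tvar p = to_fract p"
proof (induction p)
  case (pCons c p)
  have "pCons c p = [:c:] + [:0, 1:] * p" by simp
  then have "to_fract (pCons c p) = of_int c + tvar * to_fract p"
    by (simp only: to_fract_add to_fract_mult of_int_ratfun tvar_eq)
  then show ?case using pCons by (simp add: ev_pCons)
qed (simp add: ev_0)

text \<open>Up to a power of \<open>t\<close>, the value of \<open>p\<close> at 1/t is the reversed
  polynomial at \<open>t\<close>, a nonzero element of the fraction field. Hence no denominator
  vanishes when 1/t is substituted.\<close>

lemma ev_inverse_tvar_nonzero:
  assumes "p \<noteq> 0" shows "ev (inverse tvar) p \<noteq> 0"
proof
  let ?p = "map_poly of_int p :: ratfun poly"
  assume "ev (inverse tvar) p = 0"
  then have "poly (reflect_poly ?p) tvar = 0"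
    using poly_reflect_poly_nz[OF tvar_nonzero, of ?p] by (simp add: ev_def)
  moreover have "reflect_poly ?p = map_poly of_int (reflect_poly p)"
  proof (rule poly_eqI)
    have "degree ?p = degree p" by (rule degree_map_poly) simp
    then show "coeff (reflect_poly ?p) i = coeff (map_poly of_int (reflect_poly p)) i" for i
      by (simp add: coeff_reflect_poly coeff_map_poly)
  qed
  ultimately have "ev tvar (reflect_poly p) = 0" by (simp add: ev_def)
  then show False using assms by (simp add: ev_tvar)
qed

abbreviation (input) invert :: "ratfun \<Rightarrow> ratfun" where
  "invert R \<equiv> ratfun_subst R (inverse tvar)"

text \<open>\<open>ratfun_subst\<close> uses the normalized fraction; by cross multiplication every
  fraction gives the same value, from which the homomorphism laws of \<open>invert\<close>
  follow.\<close>

lemma invert_fract: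
  assumes "q \<noteq> 0"
  shows "invert (to_fract p / to_fract q) = ev (inverse tvar) p / ev (inverse tvar) q"
proof -
  let ?R = "to_fract p / to_fract q"
  obtain p' q' where pq: "quot_of_fract ?R = (p', q')" by fastforce
  have q': "q' \<noteq> 0" using snd_quot_of_fract_nonzero[of ?R] pq by simp
  have "?R = to_fract p' / to_fract q'"
    using Fract_quot_of_fract[of ?R] pq by (simp add: Fract_conv_to_fract)
  then have "to_fract p * to_fract q' = to_fract p' * to_fract q"
    using assms q' by (simp add: frac_eq_eq)
  then have "p * q' = p' * q" by (simp only: to_fract_mult[symmetric] to_fract_eq_iff)
  then have "ev (inverse tvar) p * ev (inverse tvar) q' = ev (inverse tvar) p' * ev (inverse tvar) q"
    by (simp flip: ev_mult)
  then have "ev (inverse tvar) p' / ev (inverse tvar) q' = ev (inverse tvar) p / ev (inverse tvar) q"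
    using ev_inverse_tvar_nonzero[OF assms] ev_inverse_tvar_nonzero[OF q'] by (simp add: frac_eq_eq)
  then show ?thesis by (simp add: ratfun_subst_def pq ev_def)
qed

lemma ratfun_cases:
  fixes R :: ratfun
  obtains p q where "q \<noteq> 0" "R = to_fract p / to_fract q"
  using Fract_quot_of_fract[of R] snd_quot_of_fract_nonzero[of R] Fract_conv_to_fract by metis

lemma invert_to_fract: "invert (to_fract p) = ev (inverse tvar) p"
  using invert_fract[of 1 p] by (simp add: ev_1)

lemma invert_0: "invert 0 = 0" and invert_1: "invert 1 = 1"
  using invert_to_fract[of 0] invert_to_fract[of 1] by (simp_all add: ev_0 ev_1)

lemma invert_tvar: "invert tvar = inverse tvar"
  using invert_to_fract[of "[:0, 1:]"] by (simp add: tvar_eq[symmetric] ev_pCons ev_0)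

lemma invert_add: "invert (R + S) = invert R + invert S"
proof -
  obtain p q where R: "q \<noteq> 0" "R = to_fract p / to_fract q" by (rule ratfun_cases)
  obtain p' q' where S: "q' \<noteq> 0" "S = to_fract p' / to_fract q'" by (rule ratfun_cases)
  have RS: "R + S = to_fract (p * q' + p' * q) / to_fract (q * q')"
    using R S by (simp add: add_frac_eq)
  have nz: "q * q' \<noteq> 0" using R S by simp
  have "invert (R + S) = ev (inverse tvar) (p * q' + p' * q) / ev (inverse tvar) (q * q')"
    unfolding RS by (rule invert_fract[OF nz])
  then show ?thesis
    unfolding R(2) S(2) invert_fract[OF R(1)] invert_fract[OF S(1)]
    using ev_inverse_tvar_nonzero[OF R(1)] ev_inverse_tvar_nonzero[OF S(1)]
    by (simp add: ev_add ev_mult add_frac_eq)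
qed

lemma invert_mult: "invert (R * S) = invert R * invert S"
proof -
  obtain p q where R: "q \<noteq> 0" "R = to_fract p / to_fract q" by (rule ratfun_cases)
  obtain p' q' where S: "q' \<noteq> 0" "S = to_fract p' / to_fract q'" by (rule ratfun_cases)
  have "R * S = to_fract (p * p') / to_fract (q * q')" using R S by simp
  moreover have "q * q' \<noteq> 0" using R S by simp
  ultimately show ?thesis
    unfolding R(2) S(2) invert_fract[OF R(1)] invert_fract[OF S(1)]
    using invert_fract[of "q * q'" "p * p'"] by (simp add: ev_mult)
qed

lemma invert_sum: "invert (\<Sum>i\<in>I. f i) = (\<Sum>i\<in>I. invert (f i))"
  by (induction I rule: infinite_finite_induct) (simp_all add: invert_0 invert_add)

lemma invert_power: "invert (R ^ k) = invert R ^ k"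
  by (induction k) (simp_all add: invert_1 invert_mult)

lemma invert_uminus: "invert (- R) = - invert R"
  using invert_add[of R "- R"] by (simp add: invert_0 eq_neg_iff_add_eq_0 add.commute)

lemma invert_diff: "invert (R - S) = invert R - invert S"
  using invert_add[of R "- S"] by (simp add: invert_uminus)

lemma invert_divide: "invert (R / S) = invert R / invert S"
proof (cases "S = 0")
  case False
  have "invert (R / S) * invert S = invert R" using False by (simp flip: invert_mult)
  moreover have "invert (inverse S) * invert S = 1" using False invert_1 by (simp flip: invert_mult)
  then have "invert S \<noteq> 0" by auto
  ultimately show ?thesis by (simp add: nonzero_eq_divide_eq)
qed (simp add: invert_0)

lemma invert_c_form: "invert (c_form X tvar x z) = c_form X (inverse tvar) x z"
  unfolding c_form_def
  by (simp add: invert_mult invert_sum invert_power invert_divide invert_diff invert_uminus invert_1 invert_tvar)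

section \<open>Inverting matrices of polynomials\<close>

text \<open>The adjugate satisfies both equations with \<open>\<delta>\<close> the determinant, and
  \<open>\<delta>\<close> has constant term 1 because the matrix is the identity at 0. The
  enumeration \<open>e\<close> passes between functions on \<open>I\<close> and matrices.\<close>

lemma poly_matrix_adjugate:
  fixes m :: "'i \<Rightarrow> 'i \<Rightarrow> int poly"
  assumes fin: "finite I" and m0: "\<And>i j. i \<in> I \<Longrightarrow> j \<in> I \<Longrightarrow> poly (m i j) 0 = (if i = j then 1 else 0)"
  shows "\<exists>(a :: 'i \<Rightarrow> 'i \<Rightarrow> int poly) \<delta>. poly \<delta> 0 = 1 \<and>
    (\<forall>i\<in>I. \<forall>k\<in>I. (\<Sum>j\<in>I. a i j * m j k) = (if i = k then \<delta> else 0)) \<and>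
    (\<forall>i\<in>I. \<forall>k\<in>I. (\<Sum>j\<in>I. m i j * a j k) = (if i = k then \<delta> else 0))"
proof -
  define N where "N = card I"
  obtain e where e: "bij_betw e {0..<N} I"
    using ex_bij_betw_nat_finite[OF fin] unfolding N_def by blast
  define A where "A = mat N N (\<lambda>(i, j). m (e i) (e j))"
  have A: "A \<in> carrier_mat N N" by (simp add: A_def)
  define f where "f = inv_into {0..<N} e"
  have f: "f i < N" "e (f i) = i" if "i \<in> I" for i
    using that bij_betw_inv_into_right[OF e that] inv_into_into[of i e "{0..<N}"] e
    by (auto simp: f_def bij_betw_def)
  have f_inj: "f i = f k \<longleftrightarrow> i = k" if "i \<in> I" "k \<in> I" for i k using f that by metis
  define a where "a i j = adj_mat A $$ (f i, f j)" for i j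
  have adj: "adj_mat A \<in> carrier_mat N N" "A * adj_mat A = det A \<cdot>\<^sub>m 1\<^sub>m N" "adj_mat A * A = det A \<cdot>\<^sub>m 1\<^sub>m N"
    using adj_mat[OF A] by auto
  have sum_I: "(\<Sum>j\<in>I. g (f j)) = (\<Sum>j<N. g j)" for g :: "nat \<Rightarrow> int poly"
  proof -
    have "(\<Sum>j\<in>I. g (f j)) = (\<Sum>j\<in>{0..<N}. g (f (e j)))"
      by (rule sum.reindex_bij_betw[OF e, symmetric])
    also have "\<dots> = (\<Sum>j\<in>{0..<N}. g j)"
      using bij_betw_inv_into_left[OF e] by (intro sum.cong) (auto simp: f_def)
    finally show ?thesis by (simp add: lessThan_atLeast0)
  qed
  have mA: "m i j = A $$ (f i, f j)" if "i \<in> I" "j \<in> I" for i j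
    using f that by (simp add: A_def)
  have prod: "(B * C) $$ (i, k) = (\<Sum>j<N. B $$ (i, j) * C $$ (j, k))"
    if "B \<in> carrier_mat N N" "C \<in> carrier_mat N N" "i < N" "k < N" for B C :: "int poly mat" and i k
    using that by (simp add: times_mat_def scalar_prod_def lessThan_atLeast0)
  have one: "(det A \<cdot>\<^sub>m 1\<^sub>m N) $$ (i, k) = (if i = k then det A else 0)" if "i < N" "k < N" for i k
    using that by simp
  show ?thesis
  proof (intro exI[of _ a] exI[of _ "det A"] conjI ballI)
    interpret h: comm_ring_hom "\<lambda>p :: int poly. poly p 0" by unfold_locales auto
    have "map_mat (\<lambda>p. poly p 0) A = 1\<^sub>m N"
    proof (rule eq_matI)
      fix i j assume "i < dim_row (1\<^sub>m N :: int mat)" "j < dim_col (1\<^sub>m N :: int mat)"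
      then have ij: "i < N" "j < N" by auto
      then have "e i \<in> I" "e j \<in> I" using e by (auto simp: bij_betw_def)
      moreover have "e i = e j \<longleftrightarrow> i = j"
        using inj_on_eq_iff[of e "{0..<N}" i j] e ij by (auto simp: bij_betw_def)
      ultimately show "map_mat (\<lambda>p. poly p 0) A $$ (i, j) = 1\<^sub>m N $$ (i, j)"
        using ij m0 by (simp add: A_def)
    qed (simp_all add: A_def)
    then show "poly (det A) 0 = 1" using h.hom_det[of A] by simp
    fix i k assume ik: "i \<in> I" "k \<in> I"
    have "(\<Sum>j\<in>I. a i j * m j k) = (\<Sum>j\<in>I. adj_mat A $$ (f i, f j) * A $$ (f j, f k))"
      using mA ik by (intro sum.cong) (auto simp: a_def)
    also have "\<dots> = (adj_mat A * A) $$ (f i, f k)"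
      unfolding prod[OF adj(1) A f(1)[OF ik(1)] f(1)[OF ik(2)]] by (rule sum_I)
    finally show "(\<Sum>j\<in>I. a i j * m j k) = (if i = k then det A else 0)"
      using f ik one f_inj[OF ik] unfolding adj(3) by simp
  next
    fix i k assume ik: "i \<in> I" "k \<in> I"
    have "(\<Sum>j\<in>I. m i j * a j k) = (\<Sum>j\<in>I. A $$ (f i, f j) * adj_mat A $$ (f j, f k))"
      using mA ik by (intro sum.cong) (auto simp: a_def)
    also have "\<dots> = (A * adj_mat A) $$ (f i, f k)"
      unfolding prod[OF A adj(1) f(1)[OF ik(1)] f(1)[OF ik(2)]] by (rule sum_I)
    finally show "(\<Sum>j\<in>I. m i j * a j k) = (if i = k then det A else 0)"
      using f ik one f_inj[OF ik] unfolding adj(2) by simp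
  qed
qed

section \<open>Expansions at 0 and reciprocity of an inverse matrix\<close>

lemma has_expansion_unique:
  assumes "has_expansion_at_0 R F" "has_expansion_at_0 S F" shows "R = S"
proof -
  obtain p q where R: "poly q 0 \<noteq> 0" "R = Fract p q" "fps_of_poly q * F = fps_of_poly p"
    using assms(1) unfolding has_expansion_at_0_def by blast
  obtain p' q' where S: "poly q' 0 \<noteq> 0" "S = Fract p' q'" "fps_of_poly q' * F = fps_of_poly p'"
    using assms(2) unfolding has_expansion_at_0_def by blast
  have "fps_of_poly (p * q') = (fps_of_poly q * F) * fps_of_poly q'" by (simp add: fps_of_poly_mult R(3))
  also have "\<dots> = fps_of_poly (p' * q)" unfolding fps_of_poly_mult S(3)[symmetric] by (simp add: mult_ac)
  finally have "p * q' = p' * q" by (simp only: fps_of_poly_eq_iff)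
  moreover have "q \<noteq> 0" "q' \<noteq> 0" using R S by auto
  ultimately show ?thesis unfolding R(2) S(2) by (simp add: eq_fract)
qed

text \<open>The adjugate gives rationality; \<open>R\<close> and \<open>\<epsilon> * invert R\<close> solve the same linear system.\<close>

lemma inverse_matrix_reciprocity:
  fixes m :: "'i \<Rightarrow> 'i \<Rightarrow> int poly" and F :: "'i \<Rightarrow> 'i \<Rightarrow> int fps"
  assumes fin: "finite I" and m0: "\<And>i j. i \<in> I \<Longrightarrow> j \<in> I \<Longrightarrow> poly (m i j) 0 = (if i = j then 1 else 0)"
    and inv: "\<And>i k. i \<in> I \<Longrightarrow> k \<in> I \<Longrightarrow>
      (\<Sum>j\<in>I. fps_of_poly (m i j) * F j k) = (if i = k then fps_of_poly D else 0)"
    and D: "D \<noteq> 0"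
    and sym: "\<And>i j. i \<in> I \<Longrightarrow> j \<in> I \<Longrightarrow>
      invert (to_fract (m i j) / to_fract D) = \<epsilon> * (to_fract (m i j) / to_fract D)"
    and \<epsilon>: "\<epsilon> * \<epsilon> = 1"
    and ik: "i \<in> I" "k \<in> I"
  shows "\<exists>R. has_expansion_at_0 R (F i k) \<and> invert R = \<epsilon> * R"
proof -
  have "\<exists>(a :: 'i \<Rightarrow> 'i \<Rightarrow> int poly) \<delta>. poly \<delta> 0 = 1 \<and>
    (\<forall>i\<in>I. \<forall>k\<in>I. (\<Sum>j\<in>I. a i j * m j k) = (if i = k then \<delta> else 0)) \<and>
    (\<forall>i\<in>I. \<forall>k\<in>I. (\<Sum>j\<in>I. m i j * a j k) = (if i = k then \<delta> else 0))"
    by (rule poly_matrix_adjugate[OF fin]) (rule m0)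
  then obtain a :: "'i \<Rightarrow> 'i \<Rightarrow> int poly" and \<delta> where \<delta>: "poly \<delta> 0 = 1"
    and adj: "\<forall>i\<in>I. \<forall>k\<in>I. (\<Sum>j\<in>I. a i j * m j k) = (if i = k then \<delta> else 0)"
      "\<forall>i\<in>I. \<forall>k\<in>I. (\<Sum>j\<in>I. m i j * a j k) = (if i = k then \<delta> else 0)"
    by (elim exE conjE)
  note am = adj(1)[rule_format] and ma = adj(2)[rule_format]
  have \<delta>0: "\<delta> \<noteq> 0" using \<delta> by auto
  \<comment> \<open>The inverse of the matrix \<open>m / D\<close> by Cramer's rule; the denominator
    \<open>\<delta>\<close> is 1 at 0, so the entries have expansions there.\<close>
  define R where "R j k = to_fract (a j k * D) / to_fract \<delta>" for j k
  have exp: "has_expansion_at_0 (R i k) (F i k)" if ik: "i \<in> I" "k \<in> I" for i k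
  proof -
    have "fps_of_poly \<delta> * F i k = (\<Sum>l\<in>I. (if i = l then fps_of_poly \<delta> else 0) * F l k)"
      using fin ik by (simp add: if_distrib[of "\<lambda>x. x * _"] cong: if_cong)
    also have "\<dots> = (\<Sum>l\<in>I. fps_of_poly (\<Sum>j\<in>I. a i j * m j l) * F l k)"
      using am[OF ik(1)] by (intro sum.cong) auto
    also have "\<dots> = (\<Sum>l\<in>I. \<Sum>j\<in>I. fps_of_poly (a i j) * (fps_of_poly (m j l) * F l k))"
      by (simp add: fps_of_poly_sum fps_of_poly_mult sum_distrib_right mult.assoc)
    also have "\<dots> = (\<Sum>j\<in>I. fps_of_poly (a i j) * (\<Sum>l\<in>I. fps_of_poly (m j l) * F l k))"
      unfolding sum_distrib_left by (rule sum.swap)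
    also have "\<dots> = (\<Sum>j\<in>I. if j = k then fps_of_poly (a i k) * fps_of_poly D else 0)"
      using inv[OF _ ik(2)] by (intro sum.cong) auto
    also have "\<dots> = fps_of_poly (a i k * D)" using fin ik by (simp add: fps_of_poly_mult)
    finally show ?thesis
      unfolding has_expansion_at_0_def R_def using \<delta> by (intro exI[of _ "a i k * D"] exI[of _ \<delta>])
        (simp add: Fract_conv_to_fract)
  qed
  define C where "C i j = to_fract (m i j) / to_fract D" for i j
  have CR: "(\<Sum>j\<in>I. C i j * R j k) = (if i = k then 1 else 0)" if ik: "i \<in> I" "k \<in> I" for i k
  proof -
    have "(\<Sum>j\<in>I. C i j * R j k) = (\<Sum>j\<in>I. to_fract (m i j * a j k) / to_fract \<delta>)"
      using D by (intro sum.cong) (auto simp: C_def R_def)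
    also have "\<dots> = to_fract (\<Sum>j\<in>I. m i j * a j k) / to_fract \<delta>" by (simp add: sum_divide_distrib)
    also have "\<dots> = (if i = k then 1 else 0)" unfolding ma[OF ik] using \<delta>0 by simp
    finally show ?thesis .
  qed
  \<comment> \<open>Apply \<open>invert\<close> to the equation \<open>CR\<close> and use
    \<open>sym\<close>: the sign multiplying \<open>C\<close> moves over to
    \<open>R\<close>.\<close>
  have CS: "(\<Sum>j\<in>I. C i j * (\<epsilon> * invert (R j k))) = (if i = k then 1 else 0)" if ik: "i \<in> I" "k \<in> I" for i k
  proof -
    have "(\<Sum>j\<in>I. C i j * (\<epsilon> * invert (R j k))) = (\<Sum>j\<in>I. invert (C i j * R j k))"
    proof (rule sum.cong)
      fix j assume "j \<in> I"
      then have "invert (C i j) = \<epsilon> * C i j" unfolding C_def by (rule sym[OF ik(1)])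
      then show "C i j * (\<epsilon> * invert (R j k)) = invert (C i j * R j k)"
        unfolding invert_mult by (simp add: mult_ac)
    qed simp
    also have "\<dots> = invert (if i = k then 1 else 0)" unfolding CR[OF ik, symmetric] by (simp add: invert_sum)
    finally show ?thesis by (simp add: invert_0 invert_1)
  qed
  have "R i k = \<epsilon> * invert (R i k)" if ik: "i \<in> I" "k \<in> I" for i k
  proof -
    \<comment> \<open>The difference of the two solutions is annihilated by \<open>m\<close>;
      multiplying by the adjugate leaves \<open>\<delta>\<close> times it, and
      \<open>\<delta>\<close> is not 0.\<close>
    define V where "V j = R j k - \<epsilon> * invert (R j k)" for j
    have CV: "(\<Sum>l\<in>I. to_fract (m j l) * V l) = 0" if "j \<in> I" for j
    proof -
      have "(\<Sum>l\<in>I. C j l * V l) = 0"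
        using CR[OF that ik(2)] CS[OF that ik(2)] by (simp add: V_def right_diff_distrib sum_subtractf)
      moreover have "(\<Sum>l\<in>I. C j l * V l) = (\<Sum>l\<in>I. to_fract (m j l) * V l) / to_fract D"
        by (simp add: C_def sum_divide_distrib)
      ultimately show ?thesis using D by simp
    qed
    have "to_fract \<delta> * V i = (\<Sum>l\<in>I. (if i = l then to_fract \<delta> else 0) * V l)"
      using fin ik by (simp add: if_distrib[of "\<lambda>x. x * _"] cong: if_cong)
    also have "\<dots> = (\<Sum>l\<in>I. to_fract (\<Sum>j\<in>I. a i j * m j l) * V l)"
      using am[OF ik(1)] by (intro sum.cong) auto
    also have "\<dots> = (\<Sum>l\<in>I. \<Sum>j\<in>I. to_fract (a i j) * (to_fract (m j l) * V l))"
      by (simp add: sum_distrib_right mult.assoc)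
    also have "\<dots> = (\<Sum>j\<in>I. to_fract (a i j) * (\<Sum>l\<in>I. to_fract (m j l) * V l))"
      unfolding sum_distrib_left by (rule sum.swap)
    also have "\<dots> = 0" using CV by simp
    finally show ?thesis using \<delta>0 by (simp add: V_def)
  qed
  from this[OF ik] have "\<epsilon> * R i k = (\<epsilon> * \<epsilon>) * invert (R i k)" by (metis mult.assoc)
  then have "invert (R i k) = \<epsilon> * R i k" using \<epsilon> by simp
  then show ?thesis using exp[OF ik] by blast
qed

section \<open>Orbit growth series\<close>

text \<open>The product of \<open>c_form X t x z\<close> and \<open>(1 - t^2)^n\<close>, cleared of denominators.\<close>

definition c_num :: "'v set set \<Rightarrow> nat \<Rightarrow> 'r::comm_ring_1 \<Rightarrow> 'v \<Rightarrow> 'v \<Rightarrow> 'r" where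
  "c_num X n t x z = (- t) ^ edge_dist X x z *
     (\<Sum>Q | Q \<in> X \<and> x \<in> Q \<and> z \<in> Q. t ^ (2 * (cube_dim Q - edge_dist X x z)) * (1 - t\<^sup>2) ^ (n - cube_dim Q))"

lemma to_fract_power: "to_fract (p ^ k) = to_fract p ^ k"
  by (induction k) simp_all

text \<open>\<open>c_num\<close> is defined over any commutative ring so that one formula can be
  read as a polynomial, as a rational function at \<open>tvar\<close> and as an integer at
  0.\<close>

lemma to_fract_c_num: "to_fract (c_num X n [:0, 1:] x z) = c_num X n tvar x z"
  unfolding c_num_def tvar_eq
  by (simp only: to_fract_mult to_fract_power to_fract_sum to_fract_uminus to_fract_diff to_fract_1)

lemma poly_c_num: "poly (c_num X n [:0, 1:] x z) (0 :: int) = c_num X n 0 x z"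
  unfolding c_num_def by (simp add: poly_sum)

context oriented_complex
begin

lemma edge_dist_zero_iff:
  assumes "x \<in> vertices X" "y \<in> vertices X" shows "edge_dist X x y = 0 \<longleftrightarrow> x = y"
proof -
  obtain k where k: "(x, y) \<in> arrows y ^^ k" using arrows_exist[OF assms(2,1)] by blast
  show ?thesis
  proof
    assume "edge_dist X x y = 0"
    then show "x = y" using edge_dist_eqI[OF assms(2) k] k by simp
  next
    assume "x = y"
    then show "edge_dist X x y = 0" using edge_dist_eqI[OF assms(2), of x 0] by simp
  qed
qed

lemma edge_dist_le_dim:
  assumes Q: "Q \<in> X" "x \<in> Q" "z \<in> Q" shows "edge_dist X x z \<le> cube_dim Q"
proof -
  have "minimal_cube X x z \<subseteq> Q" using minimal_cube(3)[OF Q] Q by blast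
  then show ?thesis
    using card_link_simplex(2)[OF cc minimal_cube(1)[OF Q] Q(1)] minimal_cube(2)[OF Q] by simp
qed

lemma c_num_eq:
  fixes t :: "'k::field"
  assumes t: "t\<^sup>2 \<noteq> 1" and dim: "\<And>Q. Q \<in> X \<Longrightarrow> cube_dim Q \<le> n"
  shows "c_num X n t x z = c_form X t x z * (1 - t\<^sup>2) ^ n"
proof -
  define u where "u = 1 - t\<^sup>2"
  have u: "u \<noteq> 0" using t by (simp add: u_def)
  let ?d = "edge_dist X x z"
  have "(- t / u) ^ ?d * (t\<^sup>2 / u) ^ (cube_dim Q - ?d) * u ^ n = (- t) ^ ?d * (t ^ (2 * (cube_dim Q - ?d)) * u ^ (n - cube_dim Q))"
    if Q: "Q \<in> X" "x \<in> Q" "z \<in> Q" for Q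
  proof -
    obtain a where a: "cube_dim Q = ?d + a" using edge_dist_le_dim[OF Q] le_Suc_ex by blast
    obtain b where b: "n = cube_dim Q + b" using dim[OF Q(1)] le_Suc_ex by blast
    have un: "u ^ n = u ^ ?d * u ^ a * u ^ b" by (simp add: b a power_add mult.assoc)
    have d: "(- t / u) ^ ?d * u ^ ?d = (- t) ^ ?d"
      using u by (subst power_mult_distrib[symmetric]) simp
    have s: "(t\<^sup>2 / u) ^ a * u ^ a = t ^ (2 * a)"
      using u by (subst power_mult_distrib[symmetric]) (simp add: power_mult)
    have ab: "cube_dim Q - ?d = a" "n - cube_dim Q = b" using a b by auto
    have "(- t / u) ^ ?d * (t\<^sup>2 / u) ^ a * u ^ n =
        ((- t / u) ^ ?d * u ^ ?d) * (((t\<^sup>2 / u) ^ a * u ^ a) * u ^ b)"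
      unfolding un by (simp only: mult_ac)
    then show ?thesis unfolding ab d s .
  qed
  then show ?thesis
    unfolding c_num_def c_form_def u_def[symmetric] sum_distrib_left sum_distrib_right
    by (intro sum.cong) (auto simp: mult.assoc)
qed

text \<open>Off the diagonal the leading power of \<open>- t\<close> vanishes; on it only the cube
  \<open>{x}\<close> of dimension 0 survives. This makes the matrix of orbit sums the identity at
  0.\<close>

lemma c_num_zero:
  assumes lf: "locally_finite_complex X" and x: "x \<in> vertices X" and z: "z \<in> vertices X"
  shows "c_num X n 0 x z = (if x = z then 1 else 0 :: int)"
proof (cases "x = z")
  case True
  have fin: "finite {Q \<in> X. x \<in> Q}" by (rule star_finite[OF lf x])
  have d: "edge_dist X x x = 0" using edge_dist_zero_iff[OF x x] by simp
  have xX: "{x} \<in> X" by (rule vertex_cube[OF cc x])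
  have "cube_dim Q = 0 \<longleftrightarrow> Q = {x}" if "Q \<in> X" "x \<in> Q" for Q
  proof
    assume "cube_dim Q = 0"
    then have "card Q = 1" using chart_exists[OF cc that(1)] cube_chart_card cube_chart_dim by force
    then show "Q = {x}" using that(2) by (auto simp: card_1_singleton_iff)
  qed (simp add: cube_dim_vertex[OF cc])
  then have "(\<Sum>Q\<in>{Q \<in> X. x \<in> Q}. 0 ^ (2 * cube_dim Q) :: int) = (\<Sum>Q\<in>{Q \<in> X. x \<in> Q}. if Q = {x} then 1 else 0)"
    by (intro sum.cong) (auto simp: power_0_left)
  also have "\<dots> = 1" using fin xX by simp
  finally have "c_num X n 0 x x = (1 :: int)" by (simp add: c_num_def d)
  then show ?thesis using True by simp
next
  case False
  then have "0 < edge_dist X x z" using edge_dist_zero_iff[OF x z] by simp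
  then show ?thesis using False by (simp add: c_num_def)
qed

lemma star_in_vertices: "\<Union>{Q \<in> X. x \<in> Q} \<subseteq> vertices X"
  by (auto simp: vertices_def)

lemma star_mem: "x \<in> vertices X \<Longrightarrow> x \<in> \<Union>{Q \<in> X. x \<in> Q}"
  by (auto simp: vertices_def)

lemma star_vertices_finite:
  "locally_finite_complex X \<Longrightarrow> x \<in> vertices X \<Longrightarrow> finite (\<Union>{Q \<in> X. x \<in> Q})"
  using star_finite cube_finite[OF cc] by (intro finite_Union) auto

lemma sphere_finite:
  assumes lf: "locally_finite_complex X" and x: "x \<in> vertices X"
  shows "finite {z \<in> vertices X. edge_dist X x z = k}"
proof -
  have "finite {z. (x, z) \<in> edges X ^^ j}" for j
  proof (induction j)
    case (Suc j)
    have "{z. (x, z) \<in> edges X ^^ Suc j} \<subseteq> (\<Union>w\<in>{w \<in> vertices X. (x, w) \<in> edges X ^^ j}. \<Union>{Q \<in> X. w \<in> Q})"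
    proof
      fix z assume "z \<in> {z. (x, z) \<in> edges X ^^ Suc j}"
      then obtain w where w: "(x, w) \<in> edges X ^^ j" "(w, z) \<in> edges X" by auto
      then have "w \<in> vertices X" "{w, z} \<in> X" using edges_in_vertices[OF w(2)] by (auto simp: edges_def)
      then show "z \<in> (\<Union>w\<in>{w \<in> vertices X. (x, w) \<in> edges X ^^ j}. \<Union>{Q \<in> X. w \<in> Q})" using w(1) by blast
    qed
    moreover have "finite {w \<in> vertices X. (x, w) \<in> edges X ^^ j}"
      using Suc by (rule rev_finite_subset) auto
    then have "finite (\<Union>w\<in>{w \<in> vertices X. (x, w) \<in> edges X ^^ j}. \<Union>{Q \<in> X. w \<in> Q})"
      using star_vertices_finite[OF lf] by (intro finite_UN_I) auto
    ultimately show ?case by (rule finite_subset)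
  qed simp
  moreover have "{z \<in> vertices X. edge_dist X x z = k} \<subseteq> {z. (x, z) \<in> edges X ^^ k}"
  proof safe
    fix z assume "z \<in> vertices X"
    then have "\<exists>j. (x, z) \<in> edges X ^^ j" using conn[OF x] rtrancl_power by blast
    then show "(x, z) \<in> edges X ^^ edge_dist X x z" unfolding edge_dist_def by (rule LeastI_ex)
  qed
  ultimately show ?thesis using finite_subset by blast
qed

text \<open>A polynomial identity, obtained in the fraction field from \<open>c_form_inverse\<close>
  and pulled back along the injection \<open>to_fract\<close>.\<close>

lemma c_num_inverse:
  assumes lf: "locally_finite_complex X" and dim: "\<And>Q. Q \<in> X \<Longrightarrow> cube_dim Q \<le> n"
    and x: "x \<in> vertices X" and y: "y \<in> vertices X"
  shows "(\<Sum>z\<in>\<Union>{Q \<in> X. x \<in> Q}. c_num X n [:0, 1:] x z * [:0, 1:] ^ edge_dist X z y) =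
    (if x = y then (1 - [:0, 1 :: int:]\<^sup>2) ^ n else 0)"
proof -
  let ?N = "\<Union>{Q \<in> X. x \<in> Q}"
  have "to_fract (\<Sum>z\<in>?N. c_num X n [:0, 1:] x z * [:0, 1:] ^ edge_dist X z y) =
      (\<Sum>z\<in>?N. c_num X n tvar x z * tvar ^ edge_dist X z y)"
    by (simp only: to_fract_sum to_fract_mult to_fract_c_num to_fract_power tvar_eq[symmetric])
  also have "\<dots> = (\<Sum>z\<in>?N. c_form X tvar x z * tvar ^ edge_dist X z y) * (1 - tvar\<^sup>2) ^ n"
    unfolding sum_distrib_right
    by (intro sum.cong) (auto simp: c_num_eq[OF tvar_square dim] mult_ac)
  also have "\<dots> = to_fract (if x = y then (1 - [:0, 1 :: int:]\<^sup>2) ^ n else 0)"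
    unfolding c_form_inverse[OF lf y x tvar_nonzero tvar_square]
    by (simp only: tvar_eq to_fract_power[symmetric] to_fract_1[symmetric] to_fract_diff[symmetric]
        mult_1_left mult_zero_left to_fract_0 if_True if_False split: if_split) simp
  finally show ?thesis by (simp only: to_fract_eq_iff)
qed

end

locale orbit_growth_setting = oriented_complex X D + complex_action G X \<rho>
  for X :: "'v set set" and D and G :: "('g, 'b) monoid_scheme" and \<rho> +
  fixes n :: nat
  assumes lf: "locally_finite_complex X" and eulerian: "eulerian_manifold n X"
    and finite_orbits: "finite (orbits G (vertices X) \<rho>)"
begin

abbreviation star where "star x \<equiv> \<Union>{Q \<in> X. x \<in> Q}"
abbreviation "\<Gamma> \<equiv> orbit_series G X \<rho>"
abbreviation "Orb \<equiv> orbits G (vertices X) \<rho>"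

text \<open>Formally this is \<open>c_num_inverse\<close> summed over the targets \<open>w\<close>
  in the orbit of \<open>y\<close>. The orbit may be infinite, so the coefficient of degree
  \<open>k\<close> is computed with the finitely many \<open>w\<close> that can influence
  it.\<close>

lemma orbit_series_inverse:
  assumes x: "x \<in> vertices X" and y: "y \<in> vertices X"
  shows "(\<Sum>z\<in>star x. fps_of_poly (c_num X n [:0, 1:] x z) * \<Gamma> z y) =
    (if x \<in> orbit G \<rho> y then fps_of_poly ((1 - [:0, 1:]\<^sup>2) ^ n) else 0)"
proof (rule fps_ext)
  fix k
  let ?O = "orbit G \<rho> y" and ?P = "fps_of_poly ((1 - [:0, 1 :: int:]\<^sup>2) ^ n)"
  let ?c = "\<lambda>z. fps_of_poly (c_num X n [:0, 1 :: int:] x z)"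
  have OV: "?O \<subseteq> vertices X" by (rule orbit_subset[OF y])
  have NV: "star x \<subseteq> vertices X" by (rule star_in_vertices)
  \<comment> \<open>Orbit points farther than \<open>k\<close> from every vertex of the star
    contribute nothing up to degree \<open>k\<close>. If \<open>x\<close> is in the orbit it belongs
    to \<open>F\<close>, being in its own star.\<close>
  define F where "F = {w \<in> ?O. \<exists>z\<in>star x. edge_dist X z w \<le> k}"
  have finF: "finite F"
  proof -
    have "F \<subseteq> (\<Union>z\<in>star x. \<Union>j\<in>{..k}. {w \<in> vertices X. edge_dist X z w = j})"
      using OV by (auto simp: F_def)
    moreover have "finite (\<Union>z\<in>star x. \<Union>j\<in>{..k}. {w \<in> vertices X. edge_dist X z w = j})"
      using star_vertices_finite[OF lf x] sphere_finite[OF lf] NV by (intro finite_UN_I) auto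
    ultimately show ?thesis by (rule finite_subset)
  qed
  have FV: "F \<subseteq> vertices X" using OV by (auto simp: F_def)
  have coeff: "fps_nth (\<Gamma> z y) j = fps_nth (\<Sum>w\<in>F. fps_X ^ edge_dist X z w) j" if z: "z \<in> star x" and j: "j \<le> k" for z j
  proof -
    have "{w \<in> ?O. edge_dist X z w = j} = {w \<in> F. edge_dist X z w = j}"
      using z j by (auto simp: F_def)
    then have "fps_nth (\<Gamma> z y) j = int (card {w \<in> F. edge_dist X z w = j})" by (simp add: orbit_series_def)
    also have "\<dots> = (\<Sum>w\<in>F. if edge_dist X z w = j then 1 else 0)"
      using finF by (simp add: sum.If_cases Int_def)
    also have "\<dots> = fps_nth (\<Sum>w\<in>F. fps_X ^ edge_dist X z w) j"
      by (simp add: fps_sum_nth fps_X_power_nth eq_commute)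
    finally show ?thesis .
  qed
  have "fps_nth (?c z * \<Gamma> z y) k = fps_nth (?c z * (\<Sum>w\<in>F. fps_X ^ edge_dist X z w)) k"
    if z: "z \<in> star x" for z
    unfolding fps_mult_nth
  proof (rule sum.cong)
    fix i assume "i \<in> {0..k}"
    show "fps_nth (?c z) i * fps_nth (\<Gamma> z y) (k - i) =
        fps_nth (?c z) i * fps_nth (\<Sum>w\<in>F. fps_X ^ edge_dist X z w) (k - i)"
      by (simp only: coeff[OF z diff_le_self])
  qed simp
  then have "fps_nth (\<Sum>z\<in>star x. ?c z * \<Gamma> z y) k =
      fps_nth (\<Sum>z\<in>star x. ?c z * (\<Sum>w\<in>F. fps_X ^ edge_dist X z w)) k"
    unfolding fps_sum_nth by (intro sum.cong refl)
  also have "(\<Sum>z\<in>star x. ?c z * (\<Sum>w\<in>F. fps_X ^ edge_dist X z w)) =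
      (\<Sum>w\<in>F. \<Sum>z\<in>star x. ?c z * fps_X ^ edge_dist X z w)"
    unfolding sum_distrib_left by (rule sum.swap)
  also have "\<dots> = (\<Sum>w\<in>F. if x = w then ?P else 0)"
  proof (rule sum.cong)
    fix w assume w: "w \<in> F"
    have X: "fps_of_poly [:0, 1 :: int:] = fps_X" by (simp add: fps_of_poly_pCons)
    have "(\<Sum>z\<in>star x. ?c z * fps_X ^ edge_dist X z w) =
        fps_of_poly (\<Sum>z\<in>star x. c_num X n [:0, 1:] x z * [:0, 1:] ^ edge_dist X z w)"
      by (simp only: fps_of_poly_sum fps_of_poly_mult fps_of_poly_power X)
    also have "\<dots> = (if x = w then ?P else 0)"
      using c_num_inverse[OF lf eulerian_dim_le[OF cc eulerian] x, of w] w FV by auto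
    finally show "(\<Sum>z\<in>star x. ?c z * fps_X ^ edge_dist X z w) = (if x = w then ?P else 0)" .
  qed simp
  also have "\<dots> = (if x \<in> F then ?P else 0)" using finF by simp
  also have "x \<in> F \<longleftrightarrow> x \<in> ?O"
    using star_mem[OF x] edge_dist_zero_iff[OF x x] by (force simp: F_def)
  finally show "fps_nth (\<Sum>z\<in>star x. ?c z * \<Gamma> z y) k = fps_nth (if x \<in> ?O then ?P else 0) k" .
qed

lemma orbit_series_translate:
  assumes g: "g \<in> carrier G" and s: "s \<in> vertices X" and y: "y \<in> vertices X"
  shows "\<Gamma> (\<rho> g s) y = \<Gamma> s y"
proof -
  let ?O = "orbit G \<rho> y"
  have OV: "?O \<subseteq> vertices X" by (rule orbit_subset[OF y])
  have mem: "\<rho> g w \<in> ?O \<longleftrightarrow> w \<in> ?O" if w: "w \<in> vertices X" for w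
  proof -
    have gw: "\<rho> g w \<in> orbit G \<rho> w" "\<rho> g w \<in> vertices X"
      using g element_image[OF g w] by (auto simp: orbit_def)
    show ?thesis
      using orbit_eq[OF w gw(1)] orbit_eq[OF y] orbit_refl[OF w] orbit_refl[OF gw(2)] by metis
  qed
  have "card {w \<in> ?O. edge_dist X (\<rho> g s) w = k} = card {w \<in> ?O. edge_dist X s w = k}" for k
  proof -
    have "{w \<in> ?O. edge_dist X (\<rho> g s) w = k} = \<rho> g ` {w \<in> ?O. edge_dist X s w = k}"
    proof (intro subset_antisym subsetI)
      fix w assume w: "w \<in> {w \<in> ?O. edge_dist X (\<rho> g s) w = k}"
      then have "w \<in> \<rho> g ` vertices X" using OV surj_prop[OF g] by auto
      then obtain w' where w': "w' \<in> vertices X" "w = \<rho> g w'" by auto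
      then show "w \<in> \<rho> g ` {w \<in> ?O. edge_dist X s w = k}"
        using w mem[OF w'(1)] edge_dist_image[OF g s w'(1)] by auto
    next
      fix w assume "w \<in> \<rho> g ` {w \<in> ?O. edge_dist X s w = k}"
      then obtain w' where w': "w' \<in> ?O" "edge_dist X s w' = k" "w = \<rho> g w'" by auto
      have "w' \<in> vertices X" using w' OV by auto
      then show "w \<in> {w \<in> ?O. edge_dist X (\<rho> g s) w = k}"
        using w' mem edge_dist_image[OF g s] by auto
    qed
    moreover have "inj_on (\<rho> g) {w \<in> ?O. edge_dist X s w = k}"
      by (rule inj_on_subset[OF inj_prop[OF g]]) (use OV in auto)
    ultimately show ?thesis by (simp add: card_image)
  qed
  then show ?thesis by (simp add: orbit_series_def)
qed

definition rep :: "'v set \<Rightarrow> 'v" where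
  "rep V = (SOME v. v \<in> vertices X \<and> V = orbit G \<rho> v)"

lemma rep: "V \<in> Orb \<Longrightarrow> rep V \<in> vertices X \<and> orbit G \<rho> (rep V) = V"
  unfolding rep_def by (rule someI2_ex) (auto simp: orbits_def)

lemma orbit_in_Orb: "z \<in> vertices X \<Longrightarrow> orbit G \<rho> z \<in> Orb"
  by (auto simp: orbits_def)

lemma mem_orbit_iff:
  assumes "V \<in> Orb" "z \<in> vertices X" shows "z \<in> V \<longleftrightarrow> orbit G \<rho> z = V"
  using rep[OF assms(1)] orbit_eq[of "rep V" z] orbit_refl[OF assms(2)] by auto

lemma orbit_series_rep:
  assumes x: "x \<in> vertices X" and y: "y \<in> vertices X"
  shows "\<Gamma> x y = \<Gamma> (rep (orbit G \<rho> x)) (rep (orbit G \<rho> y))"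
proof -
  define r where "r = rep (orbit G \<rho> x)"
  let ?s = "rep (orbit G \<rho> y)"
  have r: "r \<in> vertices X" "orbit G \<rho> r = orbit G \<rho> x" using rep[OF orbit_in_Orb[OF x]] by (auto simp: r_def)
  have s: "?s \<in> vertices X" "orbit G \<rho> ?s = orbit G \<rho> y" using rep[OF orbit_in_Orb[OF y]] by auto
  have "x \<in> orbit G \<rho> r" using orbit_refl[OF x] r by simp
  then obtain g where g: "g \<in> carrier G" "x = \<rho> g r" by (auto simp: orbit_def)
  have "\<Gamma> x y = \<Gamma> r y" unfolding g(2) by (rule orbit_series_translate[OF g(1) r(1) y])
  also have "\<dots> = \<Gamma> r ?s" by (simp add: orbit_series_def s(2))
  finally show ?thesis by (simp only: r_def)
qed

text \<open>The inversion formula holds vertex by vertex; grouping the star of a representative by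
  orbits turns it into a finite system, because the growth series from \<open>z\<close> depends on
  the orbit of \<open>z\<close> alone.\<close>

theorem orbit_series_reciprocity:
  assumes x: "x \<in> vertices X" and y: "y \<in> vertices X"
  shows "\<exists>R. has_expansion_at_0 R (\<Gamma> x y) \<and> invert R = (-1) ^ n * R"
proof -
  \<comment> \<open>Row \<open>V\<close>, column \<open>W\<close>: the kernel from the
    representative of \<open>V\<close> summed over the orbit \<open>W\<close>, scaled by
    \<open>Dp\<close> to a polynomial.\<close>
  define m where "m V W = (\<Sum>z\<in>{z \<in> star (rep V). orbit G \<rho> z = W}. c_num X n [:0, 1 :: int:] (rep V) z)" for V W
  define Dp where "Dp = (1 - [:0, 1 :: int:]\<^sup>2) ^ n"
  have finN: "finite (star (rep V))" if "V \<in> Orb" for V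
    using star_vertices_finite[OF lf] rep[OF that] by simp
  have NV: "z \<in> vertices X" if "z \<in> star v" for z v
    using star_in_vertices that by blast
  have Dp: "to_fract Dp = (1 - tvar\<^sup>2) ^ n" "Dp \<noteq> 0"
  proof -
    show eq: "to_fract Dp = (1 - tvar\<^sup>2) ^ n"
      unfolding Dp_def tvar_eq by (simp only: to_fract_power to_fract_diff to_fract_1)
    have "to_fract Dp \<noteq> 0" unfolding eq using tvar_square by simp
    then show "Dp \<noteq> 0" by auto
  qed
  have "\<exists>R. has_expansion_at_0 R (\<Gamma> (rep (orbit G \<rho> x)) (rep (orbit G \<rho> y))) \<and> invert R = (-1) ^ n * R"
  proof (rule inverse_matrix_reciprocity[where m = m and I = Orb and D = Dp
      and F = "\<lambda>V W. \<Gamma> (rep V) (rep W)"])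
    show "finite Orb" by (rule finite_orbits)
    show "Dp \<noteq> 0" by (rule Dp)
    show "(-1 :: ratfun) ^ n * (-1) ^ n = 1" by (simp flip: power_mult_distrib)
    show "orbit G \<rho> x \<in> Orb" "orbit G \<rho> y \<in> Orb" using orbit_in_Orb x y by auto
  next
    fix V W assume V: "V \<in> Orb" and W: "W \<in> Orb"
    have r: "rep V \<in> vertices X" "orbit G \<rho> (rep V) = V" using rep[OF V] by auto
    have "poly (m V W) 0 = (\<Sum>z\<in>{z \<in> star (rep V). orbit G \<rho> z = W}. if rep V = z then 1 else 0)"
      unfolding m_def poly_sum poly_c_num
    proof (rule sum.cong)
      fix z assume "z \<in> {z \<in> star (rep V). orbit G \<rho> z = W}"
      then have "z \<in> vertices X" using NV by blast
      then show "c_num X n 0 (rep V) z = (if rep V = z then 1 else 0 :: int)" by (rule c_num_zero[OF lf r(1)])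
    qed simp
    also have "\<dots> = (if rep V \<in> {z \<in> star (rep V). orbit G \<rho> z = W} then 1 else 0)"
      by (rule sum.delta') (rule finite_subset[OF _ finN[OF V]], blast)
    also have "rep V \<in> {z \<in> star (rep V). orbit G \<rho> z = W} \<longleftrightarrow> V = W"
      using star_mem[OF r(1)] r(2) by blast
    finally show "poly (m V W) 0 = (if V = W then 1 else 0)" .
  next
    fix V W assume V: "V \<in> Orb" and W: "W \<in> Orb"
    have r: "rep V \<in> vertices X" "orbit G \<rho> (rep V) = V" using rep[OF V] by auto
    have rW: "rep W \<in> vertices X" "orbit G \<rho> (rep W) = W" using rep[OF W] by auto
    let ?h = "\<lambda>z. fps_of_poly (c_num X n [:0, 1 :: int:] (rep V) z) * \<Gamma> z (rep W)"
    have "(\<Sum>U\<in>Orb. fps_of_poly (m V U) * \<Gamma> (rep U) (rep W)) =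
        (\<Sum>U\<in>Orb. \<Sum>z\<in>{z \<in> star (rep V). orbit G \<rho> z = U}. ?h z)"
    proof (rule sum.cong)
      fix U assume U: "U \<in> Orb"
      have "\<Gamma> (rep U) (rep W) = \<Gamma> z (rep W)" if "z \<in> star (rep V)" "orbit G \<rho> z = U" for z
        using orbit_series_rep[OF NV[OF that(1)] rW(1)] that(2) rW(2) by simp
      then show "fps_of_poly (m V U) * \<Gamma> (rep U) (rep W) = (\<Sum>z\<in>{z \<in> star (rep V). orbit G \<rho> z = U}. ?h z)"
        unfolding m_def fps_of_poly_sum sum_distrib_right by (intro sum.cong) auto
    qed simp
    also have "\<dots> = (\<Sum>z\<in>star (rep V). ?h z)"
      by (rule sum.group[OF finN[OF V] finite_orbits]) (use NV orbit_in_Orb in auto)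
    also have "\<dots> = (if rep V \<in> orbit G \<rho> (rep W) then fps_of_poly Dp else 0)"
      unfolding Dp_def by (rule orbit_series_inverse[OF r(1) rW(1)])
    also have "rep V \<in> orbit G \<rho> (rep W) \<longleftrightarrow> V = W"
      using mem_orbit_iff[OF W r(1)] r(2) rW(2) by simp
    finally show "(\<Sum>U\<in>Orb. fps_of_poly (m V U) * \<Gamma> (rep U) (rep W)) = (if V = W then fps_of_poly Dp else 0)" .
  next
    fix V W assume "V \<in> Orb" "W \<in> Orb"
    let ?S = "{z \<in> star (rep V). orbit G \<rho> z = W}"
    have nz: "(1 - tvar\<^sup>2) ^ n \<noteq> 0" using tvar_square by simp
    have eq: "to_fract (m V W) / to_fract Dp = (\<Sum>z\<in>?S. c_form X tvar (rep V) z)"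
    proof -
      have "to_fract (m V W) = (\<Sum>z\<in>?S. c_form X tvar (rep V) z) * (1 - tvar\<^sup>2) ^ n"
        unfolding m_def to_fract_sum to_fract_c_num sum_distrib_right
        by (intro sum.cong refl c_num_eq tvar_square eulerian_dim_le[OF cc eulerian])
      then show ?thesis unfolding Dp(1) using nz by simp
    qed
    show "invert (to_fract (m V W) / to_fract Dp) = (-1) ^ n * (to_fract (m V W) / to_fract Dp)"
      unfolding eq invert_sum invert_c_form sum_distrib_left
      by (intro sum.cong refl c_form_reciprocal[OF eulerian tvar_nonzero tvar_square])
  qed
  then show ?thesis unfolding orbit_series_rep[OF x y] .
qed

end

theorem corollary5:
  fixes X :: "'v set set"
    and G :: "('g, 'b) monoid_scheme"
    and \<rho> :: "'g \<Rightarrow> 'v \<Rightarrow> 'v"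
    and n :: nat
    and x y :: 'v
  assumes "cat0_cube_complex X"
    and "locally_finite_complex X"
    and "cellular_action G X \<rho>"
    and "cocompact_action G X \<rho>"
    and "eulerian_manifold n X"
    and "x \<in> vertices X"
    and "y \<in> vertices X"
  shows "ratfun_subst (c_coeff X x y) (inverse tvar) = (-1) ^ n * c_coeff X x y \<and>
         has_expansion_at_0 (orbit_growth G X \<rho> x y) (orbit_series G X \<rho> x y) \<and>
         ratfun_subst (orbit_growth G X \<rho> x y) (inverse tvar) = (-1) ^ n * orbit_growth G X \<rho> x y"
proof -
  have cc: "cube_complex X" and cat0: "cat0_space (realization X) (length_dist X)"
    using assms(1) by (auto simp: cat0_cube_complex_def)
  \<comment> \<open>The \<open>n\<close> of the manifold serves as the dimension bound of the
    locale, since simplices of the vertex links have at most \<open>n\<close> vertices.\<close>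
  interpret cat0_complex X n
    by unfold_locales (use cc cat0 eulerian_dim_le[OF cc assms(5)] in auto)
  have act: "group_action G (vertices X) \<rho>" using assms(3) by (simp add: cellular_action_def)
  interpret oriented_complex X D by (rule oriented)
  interpret complex_action G X \<rho>
    by (rule complex_action.intro[OF act]) (unfold_locales, rule assms(3))
  interpret orbit_growth_setting X D G \<rho> n
    by unfold_locales (use assms finite_vertex_orbits[OF act assms(4)] in auto)
  have c: "ratfun_subst (c_coeff X x y) (inverse tvar) = (-1) ^ n * c_coeff X x y"
    unfolding c_coeff_eq_form invert_c_form
    by (rule c_form_reciprocal[OF assms(5) tvar_nonzero tvar_square])
  obtain R where R: "has_expansion_at_0 R (orbit_series G X \<rho> x y)" "invert R = (-1) ^ n * R"
    using orbit_series_reciprocity[OF assms(6,7)] by blast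
  \<comment> \<open>The definite description is resolved: existence comes from the linear system,
    uniqueness from cross multiplication.\<close>
  have "orbit_growth G X \<rho> x y = R"
    unfolding orbit_growth_def by (rule the_equality) (rule R(1), rule has_expansion_unique[OF _ R(1)])
  then show ?thesis using c R by simp
qed

end
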